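(* Let $G$ be an infinite connected graph of bounded degree with vertex set $V$, and consider Bernoulli bond percolation on $G$ with critical threshold $p_c$. (i) Assume that: (Uniqueness) for every $p\in[0,1]$ there is $\mathbb{P}_p$-almost surely at most one infinite open cluster; and (Quasi-multiplicativity) for some $v\in V$ and some $\delta>0$ with $p_c+\delta\le 1$, there exists $c_*>0$ such that for every $p\in[p_c,p_c+\delta]$, every integer $m>0$, every finite connected set $Z\subset V$ with $Z\supseteq A(v,m,4m)$, and all sets $X\subset Z\cap B(v,m)$ and $Y\subset Z\setminus B(v,4m)$, \[ \mathbb{P}_p[X\leftrightarrow Y\text{ in }Z]\ \geq\ c_*\cdot \mathbb{P}_p[X\leftrightarrow S(v,2m)\text{ in }Z]\cdot \mathbb{P}_p[Y\leftrightarrow S(v,2m)\text{ in }Z]. \] Then for every $w\in V$ and every cylinder event $E$, the two limits \[ \lim_{n\to\infty}\mathbb{P}_{p_c}\left[E\,|\,w\leftrightarrow S(w,n)\right]\quad\text{and}\quad \lim_{p\searrow p_c}\mathbb{P}_p\left[E\,|\,|C(w)|=\infty\right] \] exist and have the same value. (ii) Assume instead only that the two assumptions hold at $p=p_c$, i.e. there is $\mathbb{P}_{p_c}$-almost surely at most one infinite open cluster, and for some $v\in V$ there exists $c_*>0$ such that the displayed inequality of the quasi-multiplicativity assumption holds with $p=p_c$ for all $m,Z,X,Y$ as there. Then for every $w\in V$ and every cylinder event $E$, the limit $\lim_{n\to\infty}\mathbb{P}_{p_c}[E\,|\,w\leftrightarrow S(w,n)]$ exists.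
   Context: Let $\rho$ be the graph metric on $V$. For $v\in V$ and positive integers $m\le n$: $B(v,n)=\{x\in V:\rho(v,x)\le n\}$, $S(v,n)=\{x\in V:\rho(v,x)=n\}$, and $A(v,m,n)=B(v,n)\setminus B(v,m-1)$. In Bernoulli bond percolation with parameter $p\in[0,1]$, each edge of $G$ is independently open with probability $p$ and closed otherwise; the law is denoted $\mathbb{P}_p$. $C(v)$ is the open cluster of $v$, i.e. the set of vertices joined to $v$ by a path of open edges. The critical threshold is $p_c=\inf\{p:\mathbb{P}_p[|C(v)|=\infty]>0\}$, which does not depend on $v\in V$. For $x,y\in V$ and $X,Y,Z\subset V$: $x\leftrightarrow y$ in $Z$ means that there is a nearest-neighbor path of open edges from $x$ to $y$ all of whose vertices are in $Z$; $X\leftrightarrow Y$ in $Z$ means that $x\leftrightarrow y$ in $Z$ for some $x\in X$, $y\in Y$; $x\leftrightarrow Y$ in $Z$ means $\{x\}\leftrightarrow Y$ in $Z$. If $Z=V$, "in $Z$" is omitted. A cylinder event is an event depending only on the states of finitely many edges. *)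

theory Defs
  imports "HOL-Probability.Probability"
begin

section \<open>Graphs\<close>

text \<open>A simple graph is given by a vertex set and a set of two-element edges. The functions
  below also take an arbitrary set \<open>F\<close> of edges in place of the edge set of the graph; this is used
  with the set of open edges of a percolation configuration.\<close>

definition walk_in :: "'a set set \<Rightarrow> 'a set \<Rightarrow> 'a list \<Rightarrow> bool" where
  "walk_in F Z xs \<longleftrightarrow> xs \<noteq> [] \<and> set xs \<subseteq> Z \<and> successively (\<lambda>x y. {x, y} \<in> F) xs"

definition joined_in :: "'a set set \<Rightarrow> 'a set \<Rightarrow> 'a \<Rightarrow> 'a \<Rightarrow> bool" where
  "joined_in F Z x y \<longleftrightarrow> (\<exists>xs. walk_in F Z xs \<and> hd xs = x \<and> last xs = y)"

definition connected_set :: "'a set set \<Rightarrow> 'a set \<Rightarrow> bool" where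
  "connected_set F Z \<longleftrightarrow> (\<forall>x\<in>Z. \<forall>y\<in>Z. joined_in F Z x y)"

locale infinite_bounded_degree_graph =
  fixes V :: "'a set" and E :: "'a set set"
  assumes edges: "e \<in> E \<Longrightarrow> \<exists>x\<in>V. \<exists>y\<in>V. x \<noteq> y \<and> e = {x, y}"
    and infinite_vertices: "infinite V"
    and connected: "connected_set E V"
    and bounded_degree: "\<exists>D. \<forall>x\<in>V. finite {y \<in> V. {x, y} \<in> E} \<and> card {y \<in> V. {x, y} \<in> E} \<le> D"

definition graph_dist :: "'a set \<Rightarrow> 'a set set \<Rightarrow> 'a \<Rightarrow> 'a \<Rightarrow> nat" where
  "graph_dist V E x y =
     (LEAST n. \<exists>xs. walk_in E V xs \<and> hd xs = x \<and> last xs = y \<and> length xs = Suc n)"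

definition graph_ball :: "'a set \<Rightarrow> 'a set set \<Rightarrow> 'a \<Rightarrow> nat \<Rightarrow> 'a set" where
  "graph_ball V E v n = {x \<in> V. graph_dist V E v x \<le> n}"

definition graph_sphere :: "'a set \<Rightarrow> 'a set set \<Rightarrow> 'a \<Rightarrow> nat \<Rightarrow> 'a set" where
  "graph_sphere V E v n = {x \<in> V. graph_dist V E v x = n}"

text \<open>Used only for \<open>m > 0\<close>, so the subtraction does not truncate.\<close>

definition graph_annulus :: "'a set \<Rightarrow> 'a set set \<Rightarrow> 'a \<Rightarrow> nat \<Rightarrow> nat \<Rightarrow> 'a set" where
  "graph_annulus V E v m n = graph_ball V E v n - graph_ball V E v (m - 1)"


section \<open>Bernoulli bond percolation\<close>

text \<open>A configuration \<open>\<omega>\<close> assigns to each edge the value \<open>True\<close> (open) or \<open>False\<close> (closed);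
  \<open>bond_percolation E p\<close> is the law with parameter \<open>p \<in> [0,1]\<close>.\<close>

definition bond_percolation :: "'a set set \<Rightarrow> real \<Rightarrow> ('a set \<Rightarrow> bool) measure" where
  "bond_percolation E p = (\<Pi>\<^sub>M e\<in>E. measure_pmf (bernoulli_pmf p))"

definition open_edges :: "'a set set \<Rightarrow> ('a set \<Rightarrow> bool) \<Rightarrow> 'a set set" where
  "open_edges E \<omega> = {e \<in> E. \<omega> e}"

text \<open>\<open>X \<leftrightarrow> Y in Z\<close>\<close>

definition open_connection ::
    "'a set set \<Rightarrow> 'a set \<Rightarrow> 'a set \<Rightarrow> 'a set \<Rightarrow> ('a set \<Rightarrow> bool) \<Rightarrow> bool" where
  "open_connection E Z X Y \<omega> \<longleftrightarrow> (\<exists>x\<in>X. \<exists>y\<in>Y. joined_in (open_edges E \<omega>) Z x y)"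

definition open_cluster :: "'a set \<Rightarrow> 'a set set \<Rightarrow> ('a set \<Rightarrow> bool) \<Rightarrow> 'a \<Rightarrow> 'a set" where
  "open_cluster V E \<omega> v = {x \<in> V. joined_in (open_edges E \<omega>) V v x}"

text \<open>The value does not depend on the vertex \<open>v \<in> V\<close> when the graph is connected.\<close>

definition critical_threshold :: "'a set \<Rightarrow> 'a set set \<Rightarrow> 'a \<Rightarrow> real" where
  "critical_threshold V E v =
     Inf {p \<in> {0..1}. \<P>(\<omega> in bond_percolation E p. infinite (open_cluster V E \<omega> v)) > 0}"

definition cylinder_event :: "'a set set \<Rightarrow> ('a set \<Rightarrow> bool) set \<Rightarrow> bool" where
  "cylinder_event E A \<longleftrightarrow>
     A \<subseteq> (\<Pi>\<^sub>E e\<in>E. UNIV) \<and>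
     (\<exists>F. finite F \<and> F \<subseteq> E \<and>
        (\<forall>\<omega> \<in> (\<Pi>\<^sub>E e\<in>E. UNIV). \<forall>\<omega>' \<in> (\<Pi>\<^sub>E e\<in>E. UNIV).
           (\<forall>e\<in>F. \<omega> e = \<omega>' e) \<longrightarrow> (\<omega> \<in> A \<longleftrightarrow> \<omega>' \<in> A)))"

definition unique_infinite_cluster :: "'a set \<Rightarrow> 'a set set \<Rightarrow> real \<Rightarrow> bool" where
  "unique_infinite_cluster V E p \<longleftrightarrow>
     (AE \<omega> in bond_percolation E p.
        \<exists>\<^sub>\<le>\<^sub>1 C. C \<in> open_cluster V E \<omega> ` V \<and> infinite C)"

definition quasi_multiplicative :: "'a set \<Rightarrow> 'a set set \<Rightarrow> 'a \<Rightarrow> real \<Rightarrow> real \<Rightarrow> bool" where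
  "quasi_multiplicative V E v c p \<longleftrightarrow>
     (\<forall>m Z X Y. m > 0 \<longrightarrow> Z \<subseteq> V \<longrightarrow> finite Z \<longrightarrow> connected_set E Z \<longrightarrow>
        graph_annulus V E v m (4 * m) \<subseteq> Z \<longrightarrow>
        X \<subseteq> Z \<inter> graph_ball V E v m \<longrightarrow> Y \<subseteq> Z - graph_ball V E v (4 * m) \<longrightarrow>
        \<P>(\<omega> in bond_percolation E p. open_connection E Z X Y \<omega>) \<ge>
          c * \<P>(\<omega> in bond_percolation E p. open_connection E Z X (graph_sphere V E v (2 * m)) \<omega>)
            * \<P>(\<omega> in bond_percolation E p. open_connection E Z Y (graph_sphere V E v (2 * m)) \<omega>))"

end

(* A connection from w to a distant set Y is cut at two scales. Exploring outwards the clusters of a ball,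
   quasi-multiplicativity splits the probability of the remaining connection, up to constants, into a factor
   depending on the explored set and a factor depending on Y. So all conditional laws given w <-> Y, for Y
   distant, dominate a fixed multiple of one common law near v. Exploring inwards from a sphere, the
   conditional probability of A given w <-> Y is an average of the same quantity for closer targets. The two
   facts contract the oscillation over all targets by a fixed factor per step. Both explorations ignore
   configurations in which two disjoint clusters cross the annulus: these are negligible by uniqueness if
   there is an infinite cluster, and otherwise because two disjoint crossings cost a square. Every step
   concerns finitely many edges, so by continuity it persists for p slightly above p_c, which makes the
   two limits agree.

   Removing explored sets may disconnect the annuli of quasi-multiplicativity. This does not happen because
   the graph is one-ended if 0 < p_c < 1: for two ends, quasi-multiplicativity forces the product of their
   crossing probabilities either to decay like exp(- m^(log_2 3)), faster than exponentially, or to stay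
   bounded below, and then both ends contain infinite clusters. *)

theory Submission
  imports Defs
begin

section \<open>Open paths and explored sets\<close>

text \<open>No conditional measures occur. The event that an exploration finds exactly
  \<open>U\<close> depends only on edges touching \<open>U\<close>, hence is independent of
  connections avoiding \<open>U\<close>; one sums over the finitely many \<open>U\<close>.

  The constant \<open>c / 2\<close>: quasi-multiplicativity costs a factor \<open>c\<close> in a
  lower bound, and two-cluster configurations are made to carry at most half of the connection
  probability in an upper bound. Each contraction step has factor \<open>1 - c / 2\<close>.

  Uniformity over targets cannot come from continuity, since targets involve arbitrarily many edges.
  It comes from having one \<open>c\<close> for all parameters; continuity serves only for strict
  inequalities at fixed scales. Both parts of the theorem are one statement about parameters near
  p_c in a set \<open>I\<close>, which is {p_c} or an interval starting at p_c.

  The exponent 3 behind the decay rate for two ends: a path between the ends returns to a central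
  ball, so it crosses both ends, and crossing an annulus in one end is at most as likely, up to
  \<open>c\<close>, as crossing both ends. Doubling the radius multiplies the product of the two
  crossing probabilities by two such annulus factors.\<close>

definition adj :: "'a set set \<Rightarrow> 'a set \<Rightarrow> ('a \<times> 'a) set" where
  "adj \<eta> Z = {(x, y). x \<in> Z \<and> y \<in> Z \<and> {x, y} \<in> \<eta>}"

text \<open>Gives access to the induction rules of the reflexive transitive closure. Membership of
  \<open>x\<close> in \<open>Z\<close> is added because the closure relates every point to
  itself.\<close>

lemma joined_in_iff: "joined_in \<eta> Z x y \<longleftrightarrow> x \<in> Z \<and> (x, y) \<in> (adj \<eta> Z)\<^sup>*"
proof
  assume "joined_in \<eta> Z x y"
  then obtain xs where xs: "walk_in \<eta> Z xs" "hd xs = x" "last xs = y"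
    unfolding joined_in_def by blast
  from xs(1) have "hd xs \<in> Z \<and> (hd xs, last xs) \<in> (adj \<eta> Z)\<^sup>*"
  proof (induction xs)
    case (Cons a xs)
    show ?case
    proof (cases xs)
      case Nil
      with Cons.prems show ?thesis by (simp add: walk_in_def)
    next
      case (Cons b ys)
      then have "walk_in \<eta> Z xs" "(a, b) \<in> adj \<eta> Z"
        using \<open>walk_in \<eta> Z (a # xs)\<close> by (auto simp: walk_in_def adj_def)
      with Cons Cons.IH show ?thesis
        by (auto simp: adj_def intro: converse_rtrancl_into_rtrancl)
    qed
  qed (simp add: walk_in_def)
  with xs show "x \<in> Z \<and> (x, y) \<in> (adj \<eta> Z)\<^sup>*" by simp
next
  assume "x \<in> Z \<and> (x, y) \<in> (adj \<eta> Z)\<^sup>*"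
  then have "(x, y) \<in> (adj \<eta> Z)\<^sup>*" "x \<in> Z" by auto
  then show "joined_in \<eta> Z x y"
  proof (induction rule: converse_rtrancl_induct)
    case base
    then show ?case unfolding joined_in_def walk_in_def by (intro exI[of _ "[y]"]) auto
  next
    case (step x z)
    then have "z \<in> Z" "{x, z} \<in> \<eta>" by (auto simp: adj_def)
    with step obtain xs where xs: "walk_in \<eta> Z xs" "hd xs = z" "last xs = y"
      unfolding joined_in_def by blast
    then have "walk_in \<eta> Z (x # xs)"
      using \<open>x \<in> Z\<close> \<open>{x, z} \<in> \<eta>\<close> by (cases xs) (auto simp: walk_in_def)
    with xs show ?case
      unfolding joined_in_def by (intro exI[of _ "x # xs"]) (auto simp: walk_in_def)
  qed
qed

lemma joined_in_refl [simp]: "joined_in \<eta> Z x x \<longleftrightarrow> x \<in> Z"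
  by (simp add: joined_in_iff)

lemma joined_in_mem: "joined_in \<eta> Z x y \<Longrightarrow> x \<in> Z \<and> y \<in> Z"
  unfolding joined_in_iff by (auto elim: rtranclE simp: adj_def)

lemma joined_in_trans: "joined_in \<eta> Z x y \<Longrightarrow> joined_in \<eta> Z y z \<Longrightarrow> joined_in \<eta> Z x z"
  unfolding joined_in_iff by auto

lemma joined_in_sym: "joined_in \<eta> Z x y \<Longrightarrow> joined_in \<eta> Z y x"
proof -
  have "sym (adj \<eta> Z)" by (auto simp: sym_def adj_def insert_commute)
  then have "sym ((adj \<eta> Z)\<^sup>*)" by (rule sym_rtrancl)
  then show "joined_in \<eta> Z x y \<Longrightarrow> joined_in \<eta> Z y x"
    using joined_in_mem[of \<eta> Z x y] by (auto simp: joined_in_iff sym_def)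
qed

lemma joined_in_edge: "x \<in> Z \<Longrightarrow> y \<in> Z \<Longrightarrow> {x, y} \<in> \<eta> \<Longrightarrow> joined_in \<eta> Z x y"
  by (auto simp: joined_in_iff adj_def)

lemma joined_in_step: "joined_in \<eta> Z x y \<Longrightarrow> z \<in> Z \<Longrightarrow> {y, z} \<in> \<eta> \<Longrightarrow> joined_in \<eta> Z x z"
  by (meson joined_in_edge joined_in_mem joined_in_trans)

lemma joined_in_mono: "joined_in \<eta> Z x y \<Longrightarrow> \<eta> \<subseteq> \<eta>' \<Longrightarrow> Z \<subseteq> Z' \<Longrightarrow> joined_in \<eta>' Z' x y"
  unfolding joined_in_iff using rtrancl_mono[of "adj \<eta> Z" "adj \<eta>' Z'"] by (auto simp: adj_def)

lemma joined_in_induct [consumes 1, case_names refl step]: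
  assumes "joined_in \<eta> Z x y" "P x"
    and "\<And>y z. joined_in \<eta> Z x y \<Longrightarrow> P y \<Longrightarrow> z \<in> Z \<Longrightarrow> {y, z} \<in> \<eta> \<Longrightarrow> P z"
  shows "P y"
proof -
  from assms(1) have *: "(x, y) \<in> (adj \<eta> Z)\<^sup>*" "x \<in> Z" by (auto simp: joined_in_iff)
  from *(1) have "joined_in \<eta> Z x y \<and> P y"
  proof (induction rule: rtrancl_induct)
    case base
    with assms(2) *(2) show ?case by simp
  next
    case (step y z)
    then have "z \<in> Z" "{y, z} \<in> \<eta>" by (auto simp: adj_def)
    with step.IH assms(3) show ?case by (blast intro: joined_in_step)
  qed
  then show ?thesis ..
qed

lemma joined_in_closed:
  assumes "joined_in \<eta> Z x y" "x \<in> U" "\<And>a b. a \<in> U \<Longrightarrow> b \<in> Z - U \<Longrightarrow> {a, b} \<notin> \<eta>"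
  shows "joined_in \<eta> (Z \<inter> U) x y"
  using assms(1)
proof (induction rule: joined_in_induct)
  case refl
  then show ?case using assms by (auto dest: joined_in_mem)
next
  case (step y z)
  then have "y \<in> U" by (auto dest: joined_in_mem)
  with step assms(3) have "z \<in> Z \<inter> U" by blast
  with step show ?case by (blast intro: joined_in_step)
qed

lemma joined_in_first_exit:
  assumes "joined_in \<eta> Z x y" "x \<in> Q" "y \<notin> Q"
  obtains a b where "joined_in \<eta> (Z \<inter> Q) x a" "b \<in> Z - Q" "{a, b} \<in> \<eta>" "joined_in \<eta> Z b y"
proof -
  have "joined_in \<eta> (Z \<inter> Q) x y \<or>
    (\<exists>a b. joined_in \<eta> (Z \<inter> Q) x a \<and> b \<in> Z - Q \<and> {a, b} \<in> \<eta> \<and> joined_in \<eta> Z b y)"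
    using assms(1)
  proof (induction rule: joined_in_induct)
    case refl
    then show ?case using assms by (auto dest: joined_in_mem)
  next
    case (step y z)
    from step.IH show ?case
    proof
      assume y: "joined_in \<eta> (Z \<inter> Q) x y"
      show ?thesis
      proof (cases "z \<in> Q")
        case True
        then show ?thesis using y step by (blast intro: joined_in_step)
      next
        case False
        then show ?thesis using y step by (intro disjI2 exI[of _ y] exI[of _ z]) auto
      qed
    next
      assume "\<exists>a b. joined_in \<eta> (Z \<inter> Q) x a \<and> b \<in> Z - Q \<and> {a, b} \<in> \<eta> \<and> joined_in \<eta> Z b y"
      then show ?thesis using step by (blast intro: joined_in_step)
    qed
  qed
  then show ?thesis using that assms(3) joined_in_mem[of \<eta> "Z \<inter> Q" x y] by blast
qed

text \<open>The last exit from \<open>Q\<close> is the first exit of the reversed path from the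
  complement of \<open>Q\<close>.\<close>

lemma joined_in_last_exit:
  assumes "joined_in \<eta> Z x y" "x \<in> Q" "y \<notin> Q"
  obtains a b where "joined_in \<eta> Z x a" "a \<in> Z \<inter> Q" "b \<in> Z - Q" "{a, b} \<in> \<eta>" "joined_in \<eta> (Z - Q) b y"
proof -
  obtain b a where *: "joined_in \<eta> (Z \<inter> - Q) y b" "a \<in> Z - (- Q)" "{b, a} \<in> \<eta>" "joined_in \<eta> Z a x"
    using joined_in_first_exit[OF joined_in_sym[OF assms(1)], of "- Q"] assms by blast
  moreover have "b \<in> Z - Q" using joined_in_mem[OF *(1)] by blast
  moreover have "Z \<inter> - Q = Z - Q" by blast
  ultimately show ?thesis
    by (intro that[of a b]) (auto intro: joined_in_sym simp: insert_commute)
qed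

lemma connected_setI:
  assumes "\<And>x. x \<in> Z \<Longrightarrow> joined_in \<eta> Z o' x"
  shows "connected_set \<eta> Z"
  unfolding connected_set_def using assms by (blast intro: joined_in_sym joined_in_trans)

text \<open>The counterpart of \<open>open_connection\<close> with the set of open edges as its
  argument, the form in which all events are handled below.\<close>

definition connects :: "'a set \<Rightarrow> 'a set \<Rightarrow> 'a set \<Rightarrow> 'a set set \<Rightarrow> bool" where
  "connects Z X Y \<eta> \<longleftrightarrow> (\<exists>x\<in>X. \<exists>y\<in>Y. joined_in \<eta> Z x y)"

lemma open_connection_eq: "open_connection E Z X Y \<omega> = connects Z X Y (open_edges E \<omega>)"
  by (simp add: open_connection_def connects_def)

lemma connectsI: "joined_in \<eta> Z x y \<Longrightarrow> x \<in> X \<Longrightarrow> y \<in> Y \<Longrightarrow> connects Z X Y \<eta>"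
  unfolding connects_def by blast

lemma connectsE:
  assumes "connects Z X Y \<eta>"
  obtains x y where "x \<in> X" "y \<in> Y" "joined_in \<eta> Z x y"
  using assms unfolding connects_def by blast

lemma connects_sym: "connects Z X Y \<eta> \<longleftrightarrow> connects Z Y X \<eta>"
  unfolding connects_def using joined_in_sym by metis

lemma connects_mono:
  "connects Z X Y \<eta> \<Longrightarrow> \<eta> \<subseteq> \<eta>' \<Longrightarrow> Z \<subseteq> Z' \<Longrightarrow> X \<subseteq> X' \<Longrightarrow> Y \<subseteq> Y' \<Longrightarrow> connects Z' X' Y' \<eta>'"
  unfolding connects_def by (meson joined_in_mono subsetD)

lemma joined_in_cong:
  assumes "joined_in \<eta> Z x y" "\<And>a b. a \<in> Z \<Longrightarrow> b \<in> Z \<Longrightarrow> {a, b} \<in> \<eta> \<Longrightarrow> {a, b} \<in> \<eta>'"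
  shows "joined_in \<eta>' Z x y"
  using assms(1)
proof (induction rule: joined_in_induct)
  case refl
  then show ?case using assms by (auto dest: joined_in_mem)
next
  case (step y z)
  then show ?case using assms(2)[of y z] joined_in_mem[of \<eta> Z x y] by (blast intro: joined_in_step)
qed

section \<open>Exploration of open clusters\<close>

definition explored :: "'a set \<Rightarrow> 'a set \<Rightarrow> 'a set set \<Rightarrow> 'a set" where
  "explored Q A \<eta> = {x. \<exists>a\<in>A. joined_in \<eta> Q a x}"

lemma explored_subset: "explored Q A \<eta> \<subseteq> Q"
  unfolding explored_def by (auto dest: joined_in_mem)

lemma explored_seed: "a \<in> A \<Longrightarrow> a \<in> Q \<Longrightarrow> a \<in> explored Q A \<eta>"
  unfolding explored_def by (intro CollectI bexI[of _ a]) simp_all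

lemma explored_boundary: "a \<in> explored Q A \<eta> \<Longrightarrow> b \<in> Q \<Longrightarrow> {a, b} \<in> \<eta> \<Longrightarrow> b \<in> explored Q A \<eta>"
  unfolding explored_def by (auto intro: joined_in_step)

lemma joined_in_explored:
  assumes "joined_in \<eta> Q a x" "a \<in> explored Q A \<eta>"
  shows "joined_in \<eta> (explored Q A \<eta>) a x"
proof -
  have "joined_in \<eta> (Q \<inter> explored Q A \<eta>) a x"
    using assms explored_boundary[of _ Q A \<eta>] by (intro joined_in_closed) auto
  then show ?thesis by (rule joined_in_mono) auto
qed

text \<open>The exploration reads only edges with an endpoint in the set it discovers: open edges
  inside \<open>U\<close> produce \<open>U\<close>, and closed edges from \<open>U\<close> to the
  rest of \<open>Q\<close> stop it. This is the spatial Markov property behind every conditioning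
  below.\<close>

lemma explored_cong:
  assumes U: "explored Q A \<eta> = U"
    and eq: "\<And>a b. a \<in> U \<Longrightarrow> b \<in> Q \<Longrightarrow> {a, b} \<in> \<eta> \<longleftrightarrow> {a, b} \<in> \<eta>'"
  shows "explored Q A \<eta>' = U"
proof
  show "U \<subseteq> explored Q A \<eta>'"
  proof
    fix x assume "x \<in> U"
    then obtain a where a: "a \<in> A" "joined_in \<eta> Q a x" using U by (auto simp: explored_def)
    then have "a \<in> explored Q A \<eta>" using explored_seed[of a A Q \<eta>] joined_in_mem[OF a(2)] by blast
    from joined_in_explored[OF a(2) this] have "joined_in \<eta> U a x" by (simp add: U)
    then have "joined_in \<eta>' U a x"
      by (rule joined_in_cong) (use eq U explored_subset[of Q A \<eta>] in blast)
    then have "joined_in \<eta>' Q a x" by (rule joined_in_mono) (use U explored_subset[of Q A \<eta>] in auto)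
    with a show "x \<in> explored Q A \<eta>'" by (auto simp: explored_def)
  qed
  show "explored Q A \<eta>' \<subseteq> U"
  proof
    fix x assume "x \<in> explored Q A \<eta>'"
    then obtain a where a: "a \<in> A" "joined_in \<eta>' Q a x" by (auto simp: explored_def)
    then have "a \<in> U" using explored_seed[of a A Q \<eta>] joined_in_mem[OF a(2)] U by blast
    have "joined_in \<eta>' (Q \<inter> U) a x"
      using a(2) \<open>a \<in> U\<close>
    proof (rule joined_in_closed)
      fix c b assume "c \<in> U" "b \<in> Q - U"
      then show "{c, b} \<notin> \<eta>'" using eq[of c b] explored_boundary[of c Q A \<eta> b] U by blast
    qed
    then show "x \<in> U" by (auto dest: joined_in_mem)
  qed
qed

text \<open>Applied with \<open>\<zeta>\<close> the full edge set: passing to a component of the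
  graph on \<open>Z\<close> loses no open path.\<close>

lemma joined_in_component:
  assumes "joined_in \<eta> Z x y" "\<eta> \<subseteq> \<zeta>" "x \<in> explored Z A \<zeta>"
  shows "joined_in \<eta> (explored Z A \<zeta>) x y"
proof -
  have "joined_in \<eta> (Z \<inter> explored Z A \<zeta>) x y"
    using assms(1,3)
  proof (rule joined_in_closed)
    fix c d assume "c \<in> explored Z A \<zeta>" "d \<in> Z - explored Z A \<zeta>"
    then have "{c, d} \<notin> \<zeta>" using explored_boundary[of c Z A \<zeta> d] by blast
    then show "{c, d} \<notin> \<eta>" using assms(2) by blast
  qed
  then show ?thesis by (rule joined_in_mono) auto
qed

context infinite_bounded_degree_graph
begin

section \<open>Cylinder events\<close>

text \<open>An event is a predicate on the set of open edges. Edge sets that are not contained in \<open>E\<close> never occur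
  as arguments, and \<open>determined_by\<close> leaves the predicate unconstrained on them.\<close>

definition perc_prob :: "real \<Rightarrow> ('a set set \<Rightarrow> bool) \<Rightarrow> real" where
  "perc_prob p Q = \<P>(\<omega> in bond_percolation E p. Q (open_edges E \<omega>))"

text \<open>Measurability is asked for all \<open>p\<close> at once, which keeps \<open>p\<close>
  out of the notion; the \<sigma>-algebra does not depend on \<open>p\<close>.\<close>

definition perc_event :: "('a set set \<Rightarrow> bool) \<Rightarrow> bool" where
  "perc_event Q \<longleftrightarrow> (\<forall>p. {\<omega> \<in> space (bond_percolation E p). Q (open_edges E \<omega>)} \<in> sets (bond_percolation E p))"

definition determined_by :: "'a set set \<Rightarrow> ('a set set \<Rightarrow> bool) \<Rightarrow> bool" where
  "determined_by F Q \<longleftrightarrow> (\<forall>\<eta>\<subseteq>E. \<forall>\<eta>'\<subseteq>E. \<eta> \<inter> F = \<eta>' \<inter> F \<longrightarrow> Q \<eta> = Q \<eta>')"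

definition cylinder :: "('a set set \<Rightarrow> bool) \<Rightarrow> bool" where
  "cylinder Q \<longleftrightarrow> (\<exists>F\<subseteq>E. finite F \<and> determined_by F Q)"

text \<open>The probability of \<open>Q\<close> as an explicit polynomial in \<open>p\<close>,
  summed over the configurations on the finite set \<open>F\<close>. Independence, monotonicity and
  continuity in \<open>p\<close> are all read off from it.\<close>

definition weight :: "real \<Rightarrow> 'a set set \<Rightarrow> ('a set set \<Rightarrow> bool) \<Rightarrow> real" where
  "weight p F Q = (\<Sum>S\<in>Pow F. if Q S then p ^ card S * (1 - p) ^ (card F - card S) else 0)"

lemma space_bond_percolation: "space (bond_percolation E p) = (\<Pi>\<^sub>E e\<in>E. UNIV)"
  by (simp add: bond_percolation_def space_PiM)

lemma prob_space_bond_percolation: "prob_space (bond_percolation E p)"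
  unfolding bond_percolation_def by (intro prob_space_PiM prob_space_measure_pmf)

lemma open_edges_subset: "open_edges E \<omega> \<subseteq> E"
  by (auto simp: open_edges_def)

lemma determined_byD:
  "determined_by F Q \<Longrightarrow> \<eta> \<subseteq> E \<Longrightarrow> \<eta>' \<subseteq> E \<Longrightarrow> \<eta> \<inter> F = \<eta>' \<inter> F \<Longrightarrow> Q \<eta> = Q \<eta>'"
  unfolding determined_by_def by blast

lemma determined_byI:
  assumes "\<And>\<eta> \<eta>'. \<eta> \<subseteq> E \<Longrightarrow> \<eta>' \<subseteq> E \<Longrightarrow> \<eta> \<inter> F = \<eta>' \<inter> F \<Longrightarrow> Q \<eta> \<Longrightarrow> Q \<eta>'"
  shows "determined_by F Q"
  unfolding determined_by_def using assms by metis

lemma determined_by_mono: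
  assumes "determined_by F Q" "F \<inter> E \<subseteq> F'"
  shows "determined_by F' Q"
proof (rule determined_byI)
  fix \<eta> \<eta>' assume *: "\<eta> \<subseteq> E" "\<eta>' \<subseteq> E" "\<eta> \<inter> F' = \<eta>' \<inter> F'" "Q \<eta>"
  have "\<eta> \<inter> F = \<eta>' \<inter> F" using *(1-3) assms(2) by auto
  with * assms(1) show "Q \<eta>'" using determined_byD by metis
qed

lemma determined_by_const [simp]: "determined_by F (\<lambda>_. b)"
  by (simp add: determined_by_def)

lemma determined_by_not: "determined_by F Q \<Longrightarrow> determined_by F (\<lambda>\<eta>. \<not> Q \<eta>)"
  unfolding determined_by_def by metis

lemma determined_by_conj:
  "determined_by F Q \<Longrightarrow> determined_by F R \<Longrightarrow> determined_by F (\<lambda>\<eta>. Q \<eta> \<and> R \<eta>)"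
  unfolding determined_by_def by metis

lemma determined_by_bex:
  "(\<And>x. x \<in> X \<Longrightarrow> determined_by F (Q x)) \<Longrightarrow> determined_by F (\<lambda>\<eta>. \<exists>x\<in>X. Q x \<eta>)"
  unfolding determined_by_def by metis

lemma determined_by_ball:
  "(\<And>x. x \<in> X \<Longrightarrow> determined_by F (Q x)) \<Longrightarrow> determined_by F (\<lambda>\<eta>. \<forall>x\<in>X. Q x \<eta>)"
  unfolding determined_by_def by metis

lemma cylinderI: "F \<subseteq> E \<Longrightarrow> finite F \<Longrightarrow> determined_by F Q \<Longrightarrow> cylinder Q"
  unfolding cylinder_def by blast

lemma cylinder_const [intro, simp]: "cylinder (\<lambda>_. b)"
  by (rule cylinderI[of "{}"]) auto

lemma cylinder_not [intro]: "cylinder Q \<Longrightarrow> cylinder (\<lambda>\<eta>. \<not> Q \<eta>)"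
  unfolding cylinder_def by (metis determined_by_not)

lemma cylinder_common:
  assumes "finite X" "\<And>x. x \<in> X \<Longrightarrow> cylinder (Q x)"
  shows "\<exists>F\<subseteq>E. finite F \<and> (\<forall>x\<in>X. determined_by F (Q x))"
proof -
  have "\<forall>x\<in>X. \<exists>F\<subseteq>E. finite F \<and> determined_by F (Q x)"
    using assms(2) unfolding cylinder_def by blast
  then obtain F where F: "\<And>x. x \<in> X \<Longrightarrow> F x \<subseteq> E \<and> finite (F x) \<and> determined_by (F x) (Q x)"
    by metis
  have "determined_by (\<Union>x\<in>X. F x) (Q x)" if "x \<in> X" for x
    by (rule determined_by_mono[of "F x"]) (use F that in auto)
  then show ?thesis
    using F assms(1) by (intro exI[of _ "\<Union>x\<in>X. F x"]) auto
qed

lemma cylinder_conj [intro]: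
  assumes "cylinder Q" "cylinder R"
  shows "cylinder (\<lambda>\<eta>. Q \<eta> \<and> R \<eta>)"
proof -
  have "\<exists>F\<subseteq>E. finite F \<and> (\<forall>b\<in>UNIV. determined_by F (if b then Q else R))"
    by (rule cylinder_common) (use assms in auto)
  then obtain F where "F \<subseteq> E" "finite F" "\<forall>b. determined_by F (if b then Q else R)"
    by auto
  then show ?thesis
    using determined_by_conj[of F Q R] by (intro cylinderI[of F]) (auto simp: all_bool_eq)
qed

lemma cylinder_bex [intro]:
  "finite X \<Longrightarrow> (\<And>x. x \<in> X \<Longrightarrow> cylinder (Q x)) \<Longrightarrow> cylinder (\<lambda>\<eta>. \<exists>x\<in>X. Q x \<eta>)"
  using cylinder_common[of X Q] unfolding cylinder_def by (metis determined_by_bex)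

section \<open>Finite weights and the calculus of percolation probabilities\<close>

lemma weight_empty: "weight p {} Q = (if Q {} then 1 else 0)"
  by (simp add: weight_def)

lemma weight_insert:
  assumes "finite F" "e \<notin> F"
  shows "weight p (insert e F) Q = p * weight p F (\<lambda>S. Q (insert e S)) + (1 - p) * weight p F Q"
proof -
  have inj: "inj_on (insert e) (Pow F)"
    using assms(2) by (auto simp: inj_on_def)
  have c: "card S \<le> card F" "card (insert e S) = Suc (card S)" if "S \<in> Pow F" for S
    using that assms card_mono[of F S] finite_subset[of S F] by (auto intro!: card_insert_disjoint)
  have "weight p (insert e F) Q
      = (\<Sum>S\<in>Pow F. if Q S then p ^ card S * (1 - p) ^ (card (insert e F) - card S) else 0)
        + (\<Sum>S\<in>insert e ` Pow F. if Q S then p ^ card S * (1 - p) ^ (card (insert e F) - card S) else 0)"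
    unfolding weight_def Pow_insert using assms by (intro sum.union_disjoint) auto
  also have "(\<Sum>S\<in>Pow F. if Q S then p ^ card S * (1 - p) ^ (card (insert e F) - card S) else 0)
      = (1 - p) * weight p F Q"
    unfolding weight_def sum_distrib_left using assms c
    by (intro sum.cong) (auto simp: Suc_diff_le)
  also have "(\<Sum>S\<in>insert e ` Pow F. if Q S then p ^ card S * (1 - p) ^ (card (insert e F) - card S) else 0)
      = p * weight p F (\<lambda>S. Q (insert e S))"
    unfolding weight_def sum_distrib_left sum.reindex[OF inj] using assms c
    by (intro sum.cong) auto
  finally show ?thesis by simp
qed

text \<open>Induction on edges in place of the coupling of two parameters: conditioning on
  \<open>e\<close> gives \<open>p * a + (1 - p) * b\<close>, which increases in \<open>p\<close>
  because \<open>a \<ge> b\<close> for an increasing event.\<close>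

lemma weight_mono_param:
  assumes "finite F" "0 \<le> p" "p \<le> q" "q \<le> 1"
    and "\<And>S T. S \<subseteq> T \<Longrightarrow> T \<subseteq> F \<Longrightarrow> Q S \<Longrightarrow> Q T"
  shows "weight p F Q \<le> weight q F Q"
  using assms(1,5)
proof (induction F arbitrary: Q rule: finite_induct)
  case empty
  show ?case by (simp only: weight_empty order_refl)
next
  case (insert e F)
  let ?Q = "\<lambda>S. Q (insert e S)"
  have 1: "weight p F ?Q \<le> weight q F ?Q"
  proof (rule insert.IH)
    fix S T assume "S \<subseteq> T" "T \<subseteq> F" "?Q S"
    then show "?Q T" using insert.prems[of "insert e S" "insert e T"] by blast
  qed
  have 2: "weight p F Q \<le> weight q F Q"
  proof (rule insert.IH)
    fix S T assume "S \<subseteq> T" "T \<subseteq> F" "Q S"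
    then show "Q T" using insert.prems[of S T] by blast
  qed
  have 3: "weight q F Q \<le> weight q F ?Q"
    unfolding weight_def
  proof (intro sum_mono)
    fix S assume "S \<in> Pow F"
    then have "Q S \<Longrightarrow> Q (insert e S)"
      using insert.prems[of S "insert e S"] by blast
    then show "(if Q S then q ^ card S * (1 - q) ^ (card F - card S) else 0)
        \<le> (if Q (insert e S) then q ^ card S * (1 - q) ^ (card F - card S) else 0)"
      using assms by auto
  qed
  have "weight p (insert e F) Q \<le> p * weight q F ?Q + (1 - p) * weight q F Q"
    using 1 2 assms by (simp add: weight_insert[OF insert.hyps] add_mono mult_left_mono)
  also have "\<dots> = weight q F Q + p * (weight q F ?Q - weight q F Q)"
    by (simp add: algebra_simps)
  also have "\<dots> \<le> weight q F Q + q * (weight q F ?Q - weight q F Q)"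
    using 3 assms by (intro add_left_mono mult_right_mono) auto
  also have "\<dots> = weight q (insert e F) Q"
    by (simp add: weight_insert[OF insert.hyps] algebra_simps)
  finally show ?case .
qed

lemma weight_union_conj:
  assumes "finite F" "finite F'" "F \<inter> F' = {}"
    and "\<And>S T. S \<subseteq> F \<Longrightarrow> T \<subseteq> F' \<Longrightarrow> R (S \<union> T) \<longleftrightarrow> Q S \<and> Q' T"
  shows "weight p (F \<union> F') R = weight p F Q * weight p F' Q'"
  using assms(1,3,4)
proof (induction F arbitrary: Q R rule: finite_induct)
  case empty
  have "R T \<longleftrightarrow> Q {} \<and> Q' T" if "T \<subseteq> F'" for T
    using empty(2)[of "{}" T] that by simp
  then have "weight p F' R = (if Q {} then weight p F' Q' else 0)"
    by (auto simp: weight_def intro!: sum.cong sum.neutral)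
  then show ?case by (simp add: weight_empty)
next
  case (insert e F)
  have 1: "weight p (F \<union> F') (\<lambda>S. R (insert e S)) = weight p F (\<lambda>S. Q (insert e S)) * weight p F' Q'"
  proof (rule insert.IH)
    fix S T assume "S \<subseteq> F" "T \<subseteq> F'"
    then show "R (insert e (S \<union> T)) \<longleftrightarrow> Q (insert e S) \<and> Q' T"
      using insert.prems(2)[of "insert e S" T] by auto
  qed (use insert.prems in auto)
  have 2: "weight p (F \<union> F') R = weight p F Q * weight p F' Q'"
  proof (rule insert.IH)
    fix S T assume "S \<subseteq> F" "T \<subseteq> F'"
    then show "R (S \<union> T) \<longleftrightarrow> Q S \<and> Q' T"
      using insert.prems(2)[of S T] by blast
  qed (use insert.prems in auto)
  have "finite (F \<union> F')" "e \<notin> F \<union> F'"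
    using insert assms(2) by auto
  from weight_insert[OF this, of p R] show ?case
    using 1 2 by (simp add: weight_insert[OF insert.hyps, of p Q] distrib_right mult.assoc)
qed

lemma perc_config_prob:
  assumes p: "p \<in> {0..1}" and F: "finite F" "F \<subseteq> E" "S \<subseteq> F"
  shows "{\<omega> \<in> space (bond_percolation E p). \<forall>e\<in>F. \<omega> e = (e \<in> S)} \<in> sets (bond_percolation E p)"
    and "\<P>(\<omega> in bond_percolation E p. \<forall>e\<in>F. \<omega> e = (e \<in> S)) = p ^ card S * (1 - p) ^ (card F - card S)"
proof -
  interpret product_prob_space "\<lambda>_. measure_pmf (bernoulli_pmf p)" E
    by unfold_locales
  interpret B: finite_measure "bond_percolation E p"
    by (rule prob_space.finite_measure[OF prob_space_bond_percolation])
  have fin: "finite S" "finite (F - S)" "card (F - S) = card F - card S"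
    using F finite_subset[OF F(3,1)] by (auto simp: card_Diff_subset)
  have eq: "{\<omega> \<in> space (bond_percolation E p). \<forall>e\<in>F. \<omega> e = (e \<in> S)}
      = {\<omega> \<in> space (Pi\<^sub>M E (\<lambda>_. measure_pmf (bernoulli_pmf p))). \<forall>e\<in>F. \<omega> e \<in> {e \<in> S}}"
    by (simp add: bond_percolation_def)
  show "{\<omega> \<in> space (bond_percolation E p). \<forall>e\<in>F. \<omega> e = (e \<in> S)} \<in> sets (bond_percolation E p)"
  proof -
    have "{\<omega> \<in> space (bond_percolation E p). \<omega> e = (e \<in> S)} \<in> sets (bond_percolation E p)" if "e \<in> F" for e
      using measurable_sets[OF measurable_component_singleton, of e E "{e \<in> S}" "\<lambda>_. measure_pmf (bernoulli_pmf p)"] that F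
      by (auto simp: bond_percolation_def vimage_def Int_def conj_commute)
    then show ?thesis
      using F by (intro sets.sets_Collect_finite_All) auto
  qed
  have "emeasure (bond_percolation E p) {\<omega> \<in> space (bond_percolation E p). \<forall>e\<in>F. \<omega> e = (e \<in> S)}
      = (\<Prod>e\<in>F. emeasure (measure_pmf (bernoulli_pmf p)) {e \<in> S})"
    unfolding eq unfolding bond_percolation_def
    by (rule emeasure_PiM_Collect) (use F in auto)
  also have "\<dots> = (\<Prod>e\<in>F. ennreal (if e \<in> S then p else 1 - p))"
    using p by (intro prod.cong) (auto simp: emeasure_pmf_single)
  also have "\<dots> = ennreal (\<Prod>e\<in>F. if e \<in> S then p else 1 - p)"
    using p by (intro prod_ennreal) auto
  also have "(\<Prod>e\<in>F. if e \<in> S then p else 1 - p) = p ^ card S * (1 - p) ^ (card F - card S)"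
    using F fin by (simp add: prod.If_cases Int_absorb1 Diff_eq[symmetric])
  finally show "\<P>(\<omega> in bond_percolation E p. \<forall>e\<in>F. \<omega> e = (e \<in> S)) = p ^ card S * (1 - p) ^ (card F - card S)"
    using p by (simp add: measure_def)
qed

lemma determined_by_eq_Union:
  assumes F: "finite F" "F \<subseteq> E" and Q: "determined_by F Q"
  shows "{\<omega> \<in> space (bond_percolation E p). Q (open_edges E \<omega>)}
    = (\<Union>S\<in>{S \<in> Pow F. Q S}. {\<omega> \<in> space (bond_percolation E p). \<forall>e\<in>F. \<omega> e = (e \<in> S)})"
proof (intro set_eqI iffI)
  fix \<omega> assume \<omega>: "\<omega> \<in> {\<omega> \<in> space (bond_percolation E p). Q (open_edges E \<omega>)}"
  have "Q (open_edges E \<omega>) = Q (open_edges E \<omega> \<inter> F)"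
    by (rule determined_byD[OF Q]) (auto simp: open_edges_def)
  then show "\<omega> \<in> (\<Union>S\<in>{S \<in> Pow F. Q S}. {\<omega> \<in> space (bond_percolation E p). \<forall>e\<in>F. \<omega> e = (e \<in> S)})"
    using \<omega> F by (intro UN_I[of "open_edges E \<omega> \<inter> F"]) (auto simp: open_edges_def)
next
  fix \<omega> assume "\<omega> \<in> (\<Union>S\<in>{S \<in> Pow F. Q S}. {\<omega> \<in> space (bond_percolation E p). \<forall>e\<in>F. \<omega> e = (e \<in> S)})"
  then obtain S where S: "S \<subseteq> F" "Q S" "\<omega> \<in> space (bond_percolation E p)" "\<And>e. e \<in> F \<Longrightarrow> \<omega> e = (e \<in> S)"
    by auto
  have "Q (open_edges E \<omega>) = Q S"
    by (rule determined_byD[OF Q]) (use S F in \<open>auto simp: open_edges_def\<close>)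
  then show "\<omega> \<in> {\<omega> \<in> space (bond_percolation E p). Q (open_edges E \<omega>)}"
    using S by simp
qed

lemma sets_bond_percolation: "sets (bond_percolation E p) = sets (bond_percolation E q)"
  unfolding bond_percolation_def by (intro sets_PiM_cong) auto

lemma perc_event_determined_by:
  assumes F: "finite F" "F \<subseteq> E" and Q: "determined_by F Q"
  shows "perc_event Q"
proof -
  have "{\<omega> \<in> space (bond_percolation E p). Q (open_edges E \<omega>)} \<in> sets (bond_percolation E p)" for p
    unfolding determined_by_eq_Union[OF assms]
    using F perc_config_prob(1)[of 0 F] sets_bond_percolation[of p 0]
    by (intro sets.finite_UN) (auto simp: space_bond_percolation)
  then show ?thesis by (simp add: perc_event_def)
qed

lemma perc_prob_weight:
  assumes p: "p \<in> {0..1}" and F: "finite F" "F \<subseteq> E" and Q: "determined_by F Q"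
  shows "perc_prob p Q = weight p F Q"
proof -
  interpret P: prob_space "bond_percolation E p" by (rule prob_space_bond_percolation)
  let ?A = "\<lambda>S. {\<omega> \<in> space (bond_percolation E p). \<forall>e\<in>F. \<omega> e = (e \<in> S)}"
  have "perc_prob p Q = measure (bond_percolation E p) (\<Union>S\<in>{S \<in> Pow F. Q S}. ?A S)"
    unfolding perc_prob_def determined_by_eq_Union[OF F Q] ..
  also have "\<dots> = (\<Sum>S\<in>{S \<in> Pow F. Q S}. measure (bond_percolation E p) (?A S))"
  proof (rule P.finite_measure_finite_Union)
    show "finite {S \<in> Pow F. Q S}" using F by auto
    show "?A ` {S \<in> Pow F. Q S} \<subseteq> P.events"
      using perc_config_prob(1)[OF p F] by auto
    show "disjoint_family_on ?A {S \<in> Pow F. Q S}"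
      unfolding disjoint_family_on_def by blast
  qed
  also have "\<dots> = (\<Sum>S\<in>{S \<in> Pow F. Q S}. p ^ card S * (1 - p) ^ (card F - card S))"
    using perc_config_prob(2)[OF p F] by (intro sum.cong) auto
  also have "\<dots> = weight p F Q"
    unfolding weight_def using F by (subst sum.inter_filter) auto
  finally show ?thesis .
qed

lemma cylinder_imp_perc_event [intro]: "cylinder Q \<Longrightarrow> perc_event Q"
  unfolding cylinder_def using perc_event_determined_by by blast

lemma perc_prob_nonneg [simp]: "perc_prob p Q \<ge> 0"
  by (simp add: perc_prob_def)

lemma perc_prob_le_1 [simp]: "perc_prob p Q \<le> 1"
  unfolding perc_prob_def by (rule prob_space.prob_le_1[OF prob_space_bond_percolation])

lemma perc_prob_True: "perc_prob p (\<lambda>_. True) = 1"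
  unfolding perc_prob_def using prob_space.prob_space[OF prob_space_bond_percolation] by simp

lemma perc_prob_mono:
  assumes "perc_event R" "\<And>\<eta>. \<eta> \<subseteq> E \<Longrightarrow> Q \<eta> \<Longrightarrow> R \<eta>"
  shows "perc_prob p Q \<le> perc_prob p R"
proof -
  interpret P: prob_space "bond_percolation E p" by (rule prob_space_bond_percolation)
  show ?thesis
    unfolding perc_prob_def using assms open_edges_subset
    by (intro P.finite_measure_mono) (auto simp: perc_event_def)
qed

lemma perc_prob_cong:
  assumes "\<And>\<eta>. \<eta> \<subseteq> E \<Longrightarrow> Q \<eta> \<longleftrightarrow> R \<eta>"
  shows "perc_prob p Q = perc_prob p R"
  unfolding perc_prob_def using assms[OF open_edges_subset] by simp

lemma perc_prob_disj_le:
  assumes "perc_event Q" "perc_event R"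
  shows "perc_prob p (\<lambda>\<eta>. Q \<eta> \<or> R \<eta>) \<le> perc_prob p Q + perc_prob p R"
proof -
  interpret P: prob_space "bond_percolation E p" by (rule prob_space_bond_percolation)
  have "{\<omega> \<in> space (bond_percolation E p). Q (open_edges E \<omega>) \<or> R (open_edges E \<omega>)} =
     {\<omega> \<in> space (bond_percolation E p). Q (open_edges E \<omega>)} \<union> {\<omega> \<in> space (bond_percolation E p). R (open_edges E \<omega>)}"
    by auto
  then show ?thesis
    unfolding perc_prob_def using assms
    by (auto simp: perc_event_def intro!: measure_Un_le)
qed

lemma perc_prob_Bex_le:
  assumes "finite X" "\<And>x. x \<in> X \<Longrightarrow> cylinder (Q x)"
  shows "perc_prob p (\<lambda>\<eta>. \<exists>x\<in>X. Q x \<eta>) \<le> (\<Sum>x\<in>X. perc_prob p (Q x))"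
  using assms
proof (induction X rule: finite_induct)
  case empty
  then show ?case by (simp add: perc_prob_def)
next
  case (insert x X)
  have "perc_prob p (\<lambda>\<eta>. \<exists>x\<in>insert x X. Q x \<eta>) = perc_prob p (\<lambda>\<eta>. Q x \<eta> \<or> (\<exists>x\<in>X. Q x \<eta>))"
    by (intro perc_prob_cong) auto
  also have "\<dots> \<le> perc_prob p (Q x) + perc_prob p (\<lambda>\<eta>. \<exists>x\<in>X. Q x \<eta>)"
    using insert by (intro perc_prob_disj_le) auto
  finally show ?case using insert by force
qed

text \<open>\<open>\<sigma>\<close> will be an explored set or a state of an exploration; summing
  over its finitely many values replaces conditional expectations.\<close>

lemma perc_prob_partition:
  assumes "finite X" "\<And>\<eta>. \<eta> \<subseteq> E \<Longrightarrow> Q \<eta> \<Longrightarrow> \<sigma> \<eta> \<in> X" "\<And>x. x \<in> X \<Longrightarrow> perc_event (\<lambda>\<eta>. Q \<eta> \<and> \<sigma> \<eta> = x)"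
  shows "perc_prob p Q = (\<Sum>x\<in>X. perc_prob p (\<lambda>\<eta>. Q \<eta> \<and> \<sigma> \<eta> = x))"
proof -
  interpret P: prob_space "bond_percolation E p" by (rule prob_space_bond_percolation)
  let ?A = "\<lambda>x. {\<omega> \<in> space (bond_percolation E p). Q (open_edges E \<omega>) \<and> \<sigma> (open_edges E \<omega>) = x}"
  have "{\<omega> \<in> space (bond_percolation E p). Q (open_edges E \<omega>)} = (\<Union>x\<in>X. ?A x)"
    using assms(2)[OF open_edges_subset] by auto
  moreover have "measure (bond_percolation E p) (\<Union>x\<in>X. ?A x) = (\<Sum>x\<in>X. measure (bond_percolation E p) (?A x))"
    using assms by (intro P.finite_measure_finite_Union) (auto simp: perc_event_def disjoint_family_on_def)
  ultimately show ?thesis unfolding perc_prob_def by simp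
qed

lemma perc_prob_split:
  assumes "cylinder Q" "cylinder R"
  shows "perc_prob p Q = perc_prob p (\<lambda>\<eta>. Q \<eta> \<and> R \<eta>) + perc_prob p (\<lambda>\<eta>. Q \<eta> \<and> \<not> R \<eta>)"
proof -
  have "perc_prob p Q = (\<Sum>x\<in>{True, False}. perc_prob p (\<lambda>\<eta>. Q \<eta> \<and> R \<eta> = x))"
  proof (rule perc_prob_partition)
    fix x
    have "cylinder (\<lambda>\<eta>. Q \<eta> \<and> R \<eta>)" "cylinder (\<lambda>\<eta>. Q \<eta> \<and> \<not> R \<eta>)"
      using assms by auto
    then show "perc_event (\<lambda>\<eta>. Q \<eta> \<and> R \<eta> = x)"
      by (cases x) auto
  qed auto
  then show ?thesis by simp
qed

text \<open>\<open>F\<close> and \<open>F'\<close> may be infinite. Each event is first shown to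
  depend only on the part of its finite support that lies in the given set; then the weights
  factorise.\<close>

lemma perc_prob_indep:
  assumes p: "p \<in> {0..1}" and Q: "cylinder Q" "determined_by F Q" and R: "cylinder R" "determined_by F' R"
    and disj: "F \<inter> F' \<inter> E = {}"
  shows "perc_prob p (\<lambda>\<eta>. Q \<eta> \<and> R \<eta>) = perc_prob p Q * perc_prob p R"
proof -
  have restr: "\<exists>J\<subseteq>F. finite J \<and> J \<subseteq> E \<and> determined_by J Q" if "cylinder Q" "determined_by F Q" for F Q
  proof -
    obtain G where G: "finite G" "G \<subseteq> E" "determined_by G Q"
      using \<open>cylinder Q\<close> unfolding cylinder_def by blast
    have "determined_by (G \<inter> F) Q"
    proof (rule determined_byI)
      fix \<eta> \<eta>' assume *: "\<eta> \<subseteq> E" "\<eta>' \<subseteq> E" "\<eta> \<inter> (G \<inter> F) = \<eta>' \<inter> (G \<inter> F)" "Q \<eta>"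
      \<comment> \<open>A hybrid configuration: it agrees with \<open>\<eta>\<close> on the finite
        support \<open>G\<close>, and with \<open>\<eta>'\<close> on \<open>F\<close>.\<close>
      let ?\<zeta> = "(\<eta> \<inter> G) \<union> (\<eta>' - G)"
      have "Q \<eta> = Q ?\<zeta>" by (rule determined_byD[OF G(3)]) (use * in auto)
      moreover have "Q ?\<zeta> = Q \<eta>'" by (rule determined_byD[OF that(2)]) (use * in auto)
      ultimately show "Q \<eta>'" using * by simp
    qed
    then show ?thesis using G by (intro exI[of _ "G \<inter> F"]) auto
  qed
  obtain J where J: "J \<subseteq> F" "finite J" "J \<subseteq> E" "determined_by J Q"
    using restr[OF Q] by blast
  obtain J' where J': "J' \<subseteq> F'" "finite J'" "J' \<subseteq> E" "determined_by J' R"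
    using restr[OF R] by blast
  have dis: "J \<inter> J' = {}" using J J' disj by blast
  have "perc_prob p (\<lambda>\<eta>. Q \<eta> \<and> R \<eta>) = weight p (J \<union> J') (\<lambda>\<eta>. Q \<eta> \<and> R \<eta>)"
    using J J' by (intro perc_prob_weight[OF p]) (auto intro!: determined_by_conj intro: determined_by_mono)
  also have "\<dots> = weight p J Q * weight p J' R"
  proof (rule weight_union_conj)
    fix S T assume "S \<subseteq> J" "T \<subseteq> J'"
    then have "Q (S \<union> T) = Q S" "R (S \<union> T) = R T"
      using J J' dis by (intro determined_byD[OF J(4)] determined_byD[OF J'(4)]; blast)+
    then show "(Q (S \<union> T) \<and> R (S \<union> T)) = (Q S \<and> R T)" by simp
  qed (use J J' dis in auto)
  also have "\<dots> = perc_prob p Q * perc_prob p R"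
    using J J' p by (simp add: perc_prob_weight)
  finally show ?thesis .
qed

lemma perc_prob_mono_param:
  assumes "cylinder Q" "\<And>\<eta> \<eta>'. \<eta> \<subseteq> \<eta>' \<Longrightarrow> \<eta>' \<subseteq> E \<Longrightarrow> Q \<eta> \<Longrightarrow> Q \<eta>'"
    and "0 \<le> p" "p \<le> q" "q \<le> 1"
  shows "perc_prob p Q \<le> perc_prob q Q"
proof -
  obtain F where F: "finite F" "F \<subseteq> E" "determined_by F Q"
    using assms(1) unfolding cylinder_def by blast
  have "weight p F Q \<le> weight q F Q"
    using assms F by (intro weight_mono_param) blast+
  then show ?thesis using F assms by (simp add: perc_prob_weight)
qed

lemma continuous_on_perc_prob:
  assumes "cylinder Q"
  shows "continuous_on {0..1} (\<lambda>p. perc_prob p Q)"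
proof -
  obtain F where F: "finite F" "F \<subseteq> E" "determined_by F Q"
    using assms(1) unfolding cylinder_def by blast
  have "weight p F Q = (\<Sum>S\<in>{S \<in> Pow F. Q S}. p ^ card S * (1 - p) ^ (card F - card S))" for p
    unfolding weight_def using F by (subst sum.inter_filter) auto
  then have "continuous_on {0..1} (\<lambda>p. weight p F Q)"
    by (auto intro!: continuous_intros)
  then show ?thesis
    by (rule continuous_on_eq) (use F in \<open>simp add: perc_prob_weight\<close>)
qed

lemma weight_all_open:
  assumes "finite F"
  shows "weight p F (\<lambda>\<eta>. F \<subseteq> \<eta>) = p ^ card F"
proof -
  have "weight p F (\<lambda>\<eta>. F \<subseteq> \<eta>) = (\<Sum>S\<in>Pow F. if S = F then p ^ card S * (1 - p) ^ (card F - card S) else 0)"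
    unfolding weight_def by (intro sum.cong) auto
  then show ?thesis using assms by simp
qed

lemma weight_all_closed:
  assumes "finite F"
  shows "weight p F (\<lambda>\<eta>. F \<inter> \<eta> = {}) = (1 - p) ^ card F"
proof -
  have "weight p F (\<lambda>\<eta>. F \<inter> \<eta> = {}) = (\<Sum>S\<in>Pow F. if S = {} then p ^ card S * (1 - p) ^ (card F - card S) else 0)"
    unfolding weight_def by (intro sum.cong) auto
  then show ?thesis using assms by simp
qed

lemma determined_by_open: "determined_by F (\<lambda>\<eta>. F \<subseteq> \<eta>)"
  by (rule determined_byI) auto

lemma determined_by_closed: "determined_by F (\<lambda>\<eta>. F \<inter> \<eta> = {})"
  by (rule determined_byI) auto

lemma perc_prob_all_open:
  assumes "finite F" "F \<subseteq> E" "p \<in> {0..1}"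
  shows "perc_prob p (\<lambda>\<eta>. F \<subseteq> \<eta>) = p ^ card F"
  using assms perc_prob_weight[OF _ _ _ determined_by_open] weight_all_open by simp

lemma perc_prob_all_closed:
  assumes "finite F" "F \<subseteq> E" "p \<in> {0..1}"
  shows "perc_prob p (\<lambda>\<eta>. F \<inter> \<eta> = {}) = (1 - p) ^ card F"
  using assms perc_prob_weight[OF _ _ _ determined_by_closed] weight_all_closed by simp

text \<open>Opening \<open>F\<close> is independent of the event that \<open>Q\<close> holds after
  \<open>F\<close> has been added, and for increasing \<open>Q\<close> the latter event contains
  \<open>Q\<close>.\<close>

lemma perc_prob_finite_energy:
  assumes Q: "cylinder Q" and inc: "\<And>\<eta> \<eta>'. \<eta> \<subseteq> \<eta>' \<Longrightarrow> \<eta>' \<subseteq> E \<Longrightarrow> Q \<eta> \<Longrightarrow> Q \<eta>'"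
    and p: "p \<in> {0..1}" and F: "finite F" "F \<subseteq> E"
  shows "p ^ card F * perc_prob p Q \<le> perc_prob p (\<lambda>\<eta>. F \<subseteq> \<eta> \<and> Q \<eta>)"
proof -
  obtain J where J: "finite J" "J \<subseteq> E" "determined_by J Q"
    using Q unfolding cylinder_def by blast
  have d: "determined_by (J - F) (\<lambda>\<eta>. Q (\<eta> \<union> F))"
  proof (rule determined_byI)
    fix \<eta> \<eta>' assume *: "\<eta> \<subseteq> E" "\<eta>' \<subseteq> E" "\<eta> \<inter> (J - F) = \<eta>' \<inter> (J - F)" "Q (\<eta> \<union> F)"
    have "Q (\<eta> \<union> F) = Q (\<eta>' \<union> F)"
      by (rule determined_byD[OF J(3)]) (use * F in auto)
    then show "Q (\<eta>' \<union> F)" using * by simp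
  qed
  have cyl: "cylinder (\<lambda>\<eta>. Q (\<eta> \<union> F))" using d J by (intro cylinderI[OF _ _ d]) auto
  have cylo: "cylinder (\<lambda>\<eta>. F \<subseteq> \<eta>)" by (rule cylinderI[OF F(2,1) determined_by_open])
  have "perc_prob p Q \<le> perc_prob p (\<lambda>\<eta>. Q (\<eta> \<union> F))"
    using inc[of _ "_ \<union> F"] F cyl by (intro perc_prob_mono cylinder_imp_perc_event) auto
  then have "p ^ card F * perc_prob p Q \<le> perc_prob p (\<lambda>\<eta>. F \<subseteq> \<eta>) * perc_prob p (\<lambda>\<eta>. Q (\<eta> \<union> F))"
    using p F by (simp add: perc_prob_all_open mult_left_mono)
  also have "\<dots> = perc_prob p (\<lambda>\<eta>. F \<subseteq> \<eta> \<and> Q (\<eta> \<union> F))"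
    by (rule perc_prob_indep[OF p cylo determined_by_open cyl d, symmetric]) auto
  also have "\<dots> = perc_prob p (\<lambda>\<eta>. F \<subseteq> \<eta> \<and> Q \<eta>)"
    by (intro perc_prob_cong) (metis sup.absorb1)
  finally show ?thesis .
qed

lemma perc_prob_decseq:
  assumes "\<And>n. cylinder (Q n)" "\<And>n \<eta>. \<eta> \<subseteq> E \<Longrightarrow> Q (Suc n) \<eta> \<Longrightarrow> Q n \<eta>"
  shows "(\<lambda>n. perc_prob p (Q n)) \<longlonglongrightarrow> perc_prob p (\<lambda>\<eta>. \<forall>n. Q n \<eta>)"
    and "perc_event (\<lambda>\<eta>. \<forall>n. Q n \<eta>)"
proof -
  interpret P: prob_space "bond_percolation E p" by (rule prob_space_bond_percolation)
  have ev: "perc_event (Q n)" for n using assms(1) by auto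
  show "perc_event (\<lambda>\<eta>. \<forall>n. Q n \<eta>)"
    using ev unfolding perc_event_def by (auto intro!: sets.sets_Collect_countable_All)
  let ?A = "\<lambda>n. {\<omega> \<in> space (bond_percolation E p). Q n (open_edges E \<omega>)}"
  have "(\<lambda>n. measure (bond_percolation E p) (?A n)) \<longlonglongrightarrow> measure (bond_percolation E p) (\<Inter>n. ?A n)"
    by (rule P.finite_Lim_measure_decseq)
      (use ev assms(2)[OF open_edges_subset] in \<open>auto simp: perc_event_def intro!: decseq_SucI\<close>)
  also have "(\<Inter>n. ?A n) = {\<omega> \<in> space (bond_percolation E p). \<forall>n. Q n (open_edges E \<omega>)}"
    by auto
  finally show "(\<lambda>n. perc_prob p (Q n)) \<longlonglongrightarrow> perc_prob p (\<lambda>\<eta>. \<forall>n. Q n \<eta>)"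
    unfolding perc_prob_def .
qed

section \<open>Graph distance\<close>

abbreviation gdist :: "'a \<Rightarrow> 'a \<Rightarrow> nat" where "gdist \<equiv> graph_dist V E"
abbreviation gball :: "'a \<Rightarrow> nat \<Rightarrow> 'a set" where "gball \<equiv> graph_ball V E"
abbreviation gsphere :: "'a \<Rightarrow> nat \<Rightarrow> 'a set" where "gsphere \<equiv> graph_sphere V E"

lemma edge_vertices: "{x, y} \<in> E \<Longrightarrow> x \<in> V \<and> y \<in> V \<and> x \<noteq> y"
  using edges[of "{x, y}"] by (auto simp: doubleton_eq_iff)

lemma joined_in_V: "x \<in> V \<Longrightarrow> y \<in> V \<Longrightarrow> joined_in E V x y"
  using connected unfolding connected_set_def by blast

lemma finite_neighbours: "finite {y. {x, y} \<in> E}"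
proof (cases "x \<in> V")
  case True
  then have "finite {y \<in> V. {x, y} \<in> E}" using bounded_degree by blast
  moreover have "{y. {x, y} \<in> E} = {y \<in> V. {x, y} \<in> E}" using edge_vertices by auto
  ultimately show ?thesis by simp
next
  case False
  then have "{y. {x, y} \<in> E} = {}" using edge_vertices by auto
  then show ?thesis by simp
qed

lemma gdist_props:
  assumes "x \<in> V" "y \<in> V"
  shows "\<exists>xs. walk_in E V xs \<and> hd xs = x \<and> last xs = y \<and> length xs = Suc (gdist x y)"
    and "\<And>xs. walk_in E V xs \<Longrightarrow> hd xs = x \<Longrightarrow> last xs = y \<Longrightarrow> gdist x y < length xs"
proof -
  let ?P = "\<lambda>n. \<exists>xs. walk_in E V xs \<and> hd xs = x \<and> last xs = y \<and> length xs = Suc n"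
  obtain xs where "walk_in E V xs" "hd xs = x" "last xs = y"
    using joined_in_V[OF assms] unfolding joined_in_def by blast
  moreover from this have "length xs = Suc (length xs - 1)" by (cases xs) (auto simp: walk_in_def)
  ultimately have "?P (length xs - 1)" by blast
  then show "?P (gdist x y)" unfolding graph_dist_def by (rule LeastI)
  fix ys assume ys: "walk_in E V ys" "hd ys = x" "last ys = y"
  then have "length ys = Suc (length ys - 1)" by (cases ys) (auto simp: walk_in_def)
  with ys have "?P (length ys - 1)" by blast
  then have "gdist x y \<le> length ys - 1" unfolding graph_dist_def by (rule Least_le)
  with \<open>length ys = Suc (length ys - 1)\<close> show "gdist x y < length ys" by linarith
qed

lemma gdist_0: "x \<in> V \<Longrightarrow> y \<in> V \<Longrightarrow> gdist x y = 0 \<longleftrightarrow> x = y"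
proof
  assume "x \<in> V" "y \<in> V" "gdist x y = 0"
  then obtain xs where "hd xs = x" "last xs = y" "length xs = Suc 0"
    using gdist_props(1)[of x y] by auto
  then show "x = y" by (cases xs) auto
next
  assume "x \<in> V" "y \<in> V" "x = y"
  then show "gdist x y = 0"
    using gdist_props(2)[of x y "[x]"] by (auto simp: walk_in_def)
qed

lemma gdist_edge:
  assumes "x \<in> V" "{y, z} \<in> E"
  shows "gdist x z \<le> Suc (gdist x y)"
proof -
  have yz: "y \<in> V" "z \<in> V" using edge_vertices assms by auto
  obtain xs where xs: "walk_in E V xs" "hd xs = x" "last xs = y" "length xs = Suc (gdist x y)"
    using gdist_props(1)[OF assms(1) yz(1)] by blast
  then have "walk_in E V (xs @ [z])"
    using yz assms(2) by (auto simp: walk_in_def successively_append_iff)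
  then show ?thesis
    using gdist_props(2)[OF assms(1) yz(2), of "xs @ [z]"] xs by (auto simp: walk_in_def)
qed

lemma gdist_pred:
  assumes "x \<in> V" "z \<in> V" "gdist x z = Suc n"
  shows "\<exists>y\<in>V. {y, z} \<in> E \<and> gdist x y = n"
proof -
  obtain xs where xs: "walk_in E V xs" "hd xs = x" "last xs = z" "length xs = Suc (Suc n)"
    using gdist_props(1)[OF assms(1,2)] assms(3) by auto
  then obtain ys where "xs = ys @ [z]" "length ys = Suc n"
    by (cases xs rule: rev_cases) auto
  then have ys: "xs = ys @ [z]" "ys \<noteq> []" "length ys = Suc n"
    by auto
  let ?y = "last ys"
  have y: "?y \<in> V" "{?y, z} \<in> E" "walk_in E V ys" "hd ys = x"
    using xs ys by (auto simp: walk_in_def successively_append_iff)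
  then have "gdist x ?y \<le> n" using gdist_props(2)[OF assms(1) y(1), of ys] ys by auto
  moreover have "Suc n \<le> Suc (gdist x ?y)" using gdist_edge[OF assms(1) y(2)] assms(3) by simp
  ultimately show ?thesis using y by auto
qed

lemma gdist_triangle:
  assumes "x \<in> V" "y \<in> V" "z \<in> V"
  shows "gdist x z \<le> gdist x y + gdist y z"
  using assms(3)
proof (induction "gdist y z" arbitrary: z)
  case 0
  then show ?case using gdist_0[OF assms(2)] by simp
next
  case (Suc n)
  then obtain u where u: "u \<in> V" "{u, z} \<in> E" "gdist y u = n"
    using gdist_pred[OF assms(2)] by metis
  then show ?case using Suc(1)[of u] gdist_edge[OF assms(1) u(2)] Suc(2) by linarith
qed

lemma in_gball: "x \<in> gball v k \<longleftrightarrow> x \<in> V \<and> gdist v x \<le> k"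
  by (simp add: graph_ball_def)

lemma in_gsphere: "x \<in> gsphere v k \<longleftrightarrow> x \<in> V \<and> gdist v x = k"
  by (simp add: graph_sphere_def)

lemma gball_subset_V: "gball v k \<subseteq> V"
  by (auto simp: in_gball)

lemma gball_mono: "k \<le> l \<Longrightarrow> gball v k \<subseteq> gball v l"
  by (auto simp: in_gball)

lemma finite_gball:
  assumes "v \<in> V"
  shows "finite (gball v k)"
proof (induction k)
  case 0
  have "gball v 0 \<subseteq> {v}" using gdist_0 assms by (auto simp: in_gball)
  then show ?case using finite_subset by blast
next
  case (Suc k)
  have "gball v (Suc k) \<subseteq> gball v k \<union> (\<Union>x\<in>gball v k. {y. {x, y} \<in> E})"
  proof
    fix x assume x: "x \<in> gball v (Suc k)"
    show "x \<in> gball v k \<union> (\<Union>x\<in>gball v k. {y. {x, y} \<in> E})"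
    proof (cases "gdist v x = Suc k")
      case True
      with x assms gdist_pred[of v x k] show ?thesis by (auto simp: in_gball)
    next
      case False
      with x show ?thesis by (auto simp: in_gball)
    qed
  qed
  then show ?case using Suc finite_neighbours by (meson finite_UN_I finite_Un finite_subset)
qed

lemma finite_gsphere: "v \<in> V \<Longrightarrow> finite (gsphere v k)"
  by (rule finite_subset[OF _ finite_gball[of v k]]) (auto simp: in_gball in_gsphere)

lemma joined_in_gball:
  assumes "v \<in> V" "x \<in> gball v k"
  shows "joined_in E (gball v k) v x"
  using assms(2)
proof (induction "gdist v x" arbitrary: x)
  case 0
  then show ?case using gdist_0[of v x] assms by (auto simp: in_gball)
next
  case (Suc n)
  then obtain y where y: "y \<in> V" "{y, x} \<in> E" "gdist v y = n"
    using gdist_pred[of v x n] assms by (auto simp: in_gball)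
  then show ?case using Suc(1)[of y] Suc(2,3) by (auto simp: in_gball intro: joined_in_step)
qed

lemma connected_gball: "v \<in> V \<Longrightarrow> connected_set E (gball v k)"
  by (rule connected_setI) (rule joined_in_gball)

lemma gdist_down:
  assumes "v \<in> V" "x \<in> V" "k \<le> gdist v x"
  shows "\<exists>y\<in>V. gdist v y = k"
  using assms(2,3)
proof (induction "gdist v x" arbitrary: x)
  case 0
  then show ?case by auto
next
  case (Suc n)
  show ?case
  proof (cases "k = Suc n")
    case True
    then show ?thesis using Suc by auto
  next
    case False
    obtain y where "y \<in> V" "gdist v y = n" using gdist_pred[OF assms(1) Suc(3)] Suc(2) by metis
    then show ?thesis using Suc(1)[of y] Suc(2,4) False by auto
  qed
qed

lemma unbounded_dist: "v \<in> V \<Longrightarrow> infinite K \<Longrightarrow> K \<subseteq> V \<Longrightarrow> \<exists>x\<in>K. k < gdist v x"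
proof (rule ccontr)
  assume *: "v \<in> V" "infinite K" "K \<subseteq> V" "\<not> (\<exists>x\<in>K. k < gdist v x)"
  then have "K \<subseteq> gball v k" by (auto simp: in_gball not_less)
  then show False using *(1,2) finite_gball finite_subset by blast
qed

lemma gsphere_nonempty: "v \<in> V \<Longrightarrow> gsphere v k \<noteq> {}"
  using unbounded_dist[OF _ infinite_vertices, of v k] gdist_down[of v _ k] by (fastforce simp: in_gsphere)

section \<open>Events determined by regions\<close>

definition inner_edges :: "'a set \<Rightarrow> 'a set set" where
  "inner_edges Z = {e \<in> E. e \<subseteq> Z}"

text \<open>Within \<open>E\<close> the complement of \<open>inner_edges (V - U)\<close>. This
  splitting of the edges is the source of most independence statements.\<close>

definition touching_edges :: "'a set \<Rightarrow> 'a set set" where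
  "touching_edges U = {e \<in> E. e \<inter> U \<noteq> {}}"

lemma finite_inner_edges: "finite Z \<Longrightarrow> finite (inner_edges Z)"
  by (rule finite_subset[of _ "Pow Z"]) (auto simp: inner_edges_def)

lemma finite_touching_edges: "finite U \<Longrightarrow> finite (touching_edges U)"
proof (rule finite_subset)
  show "touching_edges U \<subseteq> (\<Union>x\<in>U. (\<lambda>y. {x, y}) ` {y. {x, y} \<in> E})"
  proof
    fix e assume "e \<in> touching_edges U"
    then obtain x where x: "x \<in> U" "x \<in> e" "e \<in> E" by (auto simp: touching_edges_def)
    then obtain y where "e = {x, y}" using edges[OF x(3)] by auto
    with x show "e \<in> (\<Union>x\<in>U. (\<lambda>y. {x, y}) ` {y. {x, y} \<in> E})" by auto
  qed
qed (use finite_neighbours in auto)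

lemma determined_joined_in: "determined_by (inner_edges Z) (\<lambda>\<eta>. joined_in \<eta> Z x y)"
proof (rule determined_byI)
  fix \<eta> \<eta>' assume *: "\<eta> \<subseteq> E" "\<eta>' \<subseteq> E" "\<eta> \<inter> inner_edges Z = \<eta>' \<inter> inner_edges Z" "joined_in \<eta> Z x y"
  show "joined_in \<eta>' Z x y"
    by (rule joined_in_cong[OF *(4)]) (use * in \<open>auto simp: inner_edges_def set_eq_iff\<close>)
qed

lemma determined_connects: "determined_by (inner_edges Z) (connects Z X Y)"
  unfolding connects_def by (intro determined_by_bex determined_joined_in)

lemma cylinder_inner: "finite Z \<Longrightarrow> determined_by (inner_edges Z) Q \<Longrightarrow> cylinder Q"
  by (rule cylinderI[of "inner_edges Z"]) (auto simp: finite_inner_edges, auto simp: inner_edges_def)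

lemma cylinder_touching: "finite Z \<Longrightarrow> determined_by (touching_edges Z) Q \<Longrightarrow> cylinder Q"
  by (rule cylinderI[of "touching_edges Z"]) (auto simp: finite_touching_edges, auto simp: touching_edges_def)

lemma cylinder_connects: "finite Z \<Longrightarrow> cylinder (connects Z X Y)"
  by (rule cylinder_inner[OF _ determined_connects])

lemma determined_explored:
  "determined_by (touching_edges U) (\<lambda>\<eta>. explored Q A \<eta> = U)"
proof (rule determined_byI)
  fix \<eta> \<eta>' assume *: "\<eta> \<subseteq> E" "\<eta>' \<subseteq> E" "\<eta> \<inter> touching_edges U = \<eta>' \<inter> touching_edges U" "explored Q A \<eta> = U"
  show "explored Q A \<eta>' = U"
    by (rule explored_cong[OF *(4)]) (use *(1-3) in \<open>auto simp: touching_edges_def set_eq_iff\<close>)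
qed

text \<open>A support that does not vary with \<open>U\<close>, so the event is a cylinder event for
  every \<open>U\<close>, including values that are never taken.\<close>

lemma determined_explored_inner:
  "determined_by (inner_edges Q) (\<lambda>\<eta>. explored Q A \<eta> = U)"
proof (rule determined_byI)
  fix \<eta> \<eta>' assume *: "\<eta> \<subseteq> E" "\<eta>' \<subseteq> E" "\<eta> \<inter> inner_edges Q = \<eta>' \<inter> inner_edges Q" "explored Q A \<eta> = U"
  have "U \<subseteq> Q" using *(4) explored_subset by metis
  show "explored Q A \<eta>' = U"
    by (rule explored_cong[OF *(4)])
      (use *(1-3) \<open>U \<subseteq> Q\<close> in \<open>auto simp: inner_edges_def set_eq_iff subset_iff\<close>)
qed

section \<open>Leaving balls\<close>

text \<open>For a ball of radius \<open>k\<close> this amounts to reaching the sphere of radius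
  \<open>k + 1\<close>, phrased so that only edges touching the ball are read. The shift by one
  recurs throughout: a sphere of radius \<open>2 * m\<close> goes with
  \<open>Suc k = 2 * m\<close>.\<close>

definition exits :: "'a set \<Rightarrow> 'a \<Rightarrow> 'a set set \<Rightarrow> bool" where
  "exits Q x \<eta> \<longleftrightarrow> (\<exists>a\<in>Q. \<exists>b\<in>V - Q. joined_in \<eta> Q x a \<and> {a, b} \<in> \<eta>)"

definition inf_cluster :: "'a \<Rightarrow> 'a set set \<Rightarrow> bool" where
  "inf_cluster x \<eta> \<longleftrightarrow> infinite {y \<in> V. joined_in \<eta> V x y}"

definition split_exit :: "'a set \<Rightarrow> 'a \<Rightarrow> 'a \<Rightarrow> 'a set set \<Rightarrow> bool" where
  "split_exit Q x y \<eta> \<longleftrightarrow> exits Q x \<eta> \<and> exits Q y \<eta> \<and> \<not> joined_in \<eta> Q x y"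

lemma exitsI:
  assumes "joined_in \<eta> Z x y" "x \<in> Q" "y \<notin> Q" "Z \<subseteq> V"
  shows "exits Q x \<eta>"
proof -
  obtain a b where ab: "joined_in \<eta> (Z \<inter> Q) x a" "b \<in> Z - Q" "{a, b} \<in> \<eta>"
    using joined_in_first_exit[OF assms(1-3)] by metis
  have "joined_in \<eta> Q x a" by (rule joined_in_mono[OF ab(1)]) auto
  moreover have "a \<in> Q" using joined_in_mem[OF ab(1)] by simp
  ultimately show ?thesis using ab assms(4) unfolding exits_def by auto
qed

lemma exitsE:
  assumes "exits Q x \<eta>" "Q \<subseteq> V"
  obtains b where "b \<in> V - Q" "joined_in \<eta> V x b"
proof -
  obtain a b where ab: "a \<in> Q" "b \<in> V - Q" "joined_in \<eta> Q x a" "{a, b} \<in> \<eta>"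
    using assms(1) unfolding exits_def by blast
  have "joined_in \<eta> V x a" by (rule joined_in_mono[OF ab(3)]) (use assms in auto)
  then have "joined_in \<eta> V x b" using ab by (auto intro: joined_in_step)
  with ab(2) show ?thesis by (rule that)
qed

lemma exits_sphere:
  assumes "exits (gball v k) x \<eta>" "\<eta> \<subseteq> E" "v \<in> V"
  obtains a b where "b \<in> gsphere v (Suc k)" "joined_in \<eta> (gball v k) x a" "{a, b} \<in> \<eta>"
    "joined_in \<eta> (gball v (Suc k)) x b"
proof -
  obtain a b where ab: "a \<in> gball v k" "b \<in> V - gball v k" "joined_in \<eta> (gball v k) x a" "{a, b} \<in> \<eta>"
    using assms(1) unfolding exits_def by blast
  have "gdist v b \<le> Suc (gdist v a)" using ab(4) assms(2,3) by (intro gdist_edge) auto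
  then have b: "b \<in> gsphere v (Suc k)" using ab(1,2) by (auto simp: in_gball in_gsphere)
  have "joined_in \<eta> (gball v (Suc k)) x a"
    by (rule joined_in_mono[OF ab(3)]) (use gball_mono[of k "Suc k" v] in auto)
  then have "joined_in \<eta> (gball v (Suc k)) x b"
    by (rule joined_in_step) (use b ab in \<open>auto simp: in_gball in_gsphere\<close>)
  with b ab show ?thesis by (intro that)
qed

lemma exits_antimono:
  assumes "exits Q' x \<eta>" "Q \<subseteq> Q'" "Q' \<subseteq> V" "x \<in> Q"
  shows "exits Q x \<eta>"
proof -
  obtain b where "b \<in> V - Q'" "joined_in \<eta> V x b" using exitsE[OF assms(1,3)] .
  then show ?thesis using assms by (intro exitsI[of \<eta> V x b]) auto
qed

lemma exits_mono: "exits Q x \<eta> \<Longrightarrow> \<eta> \<subseteq> \<eta>' \<Longrightarrow> exits Q x \<eta>'"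
  unfolding exits_def by (meson joined_in_mono order_refl subsetD)

lemma touching_doubleton: "{a, b} \<in> E \<Longrightarrow> a \<in> U \<or> b \<in> U \<Longrightarrow> {a, b} \<in> touching_edges U"
  by (auto simp: touching_edges_def)

lemma inner_doubleton: "{a, b} \<in> E \<Longrightarrow> a \<in> U \<Longrightarrow> b \<in> U \<Longrightarrow> {a, b} \<in> inner_edges U"
  by (auto simp: inner_edges_def)

lemma determined_edge: "{a, b} \<in> E \<longrightarrow> {a, b} \<in> F \<Longrightarrow> determined_by F (\<lambda>\<eta>. {a, b} \<in> \<eta>)"
  by (rule determined_byI) (auto simp: set_eq_iff)

lemma determined_joined_touching:
  "determined_by (touching_edges Q) (\<lambda>\<eta>. joined_in \<eta> Q x y)"
proof (rule determined_by_mono[OF determined_joined_in])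
  show "inner_edges Q \<inter> E \<subseteq> touching_edges Q"
  proof
    fix e assume "e \<in> inner_edges Q \<inter> E"
    then show "e \<in> touching_edges Q"
      using edges[of e] by (auto simp: inner_edges_def touching_edges_def)
  qed
qed

lemma determined_exits: "determined_by (touching_edges Q) (exits Q x)"
  unfolding exits_def
  by (intro determined_by_bex determined_by_conj determined_joined_touching determined_edge)
    (auto intro: touching_doubleton)

lemma cylinder_exits: "finite Q \<Longrightarrow> cylinder (exits Q x)"
  by (rule cylinder_touching[OF _ determined_exits])

lemma determined_split_exit: "determined_by (touching_edges Q) (split_exit Q x y)"
  unfolding split_exit_def
  by (intro determined_by_conj determined_exits determined_by_not determined_joined_touching)

lemma cylinder_split_exit: "finite Q \<Longrightarrow> cylinder (split_exit Q x y)"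
  by (rule cylinder_touching[OF _ determined_split_exit])

lemma split_exit_antimono:
  assumes "split_exit Q' x y \<eta>" "Q \<subseteq> Q'" "Q' \<subseteq> V" "x \<in> Q" "y \<in> Q"
  shows "split_exit Q x y \<eta>"
  using assms exits_antimono joined_in_mono[OF _ order_refl assms(2)] unfolding split_exit_def by metis

text \<open>Exploring the cluster of \<open>x\<close> reveals nothing about the edges that a disjoint cluster of \<open>y\<close> may
  use; this replaces the van den Berg--Kesten inequality.\<close>

lemma split_exit_prob_le:
  assumes Q: "finite Q" "Q \<subseteq> V" "x \<in> Q" "y \<in> Q" and p: "p \<in> {0..1}"
  shows "perc_prob p (split_exit Q x y) \<le> perc_prob p (exits Q x) * perc_prob p (exits Q y)"
proof -
  let ?\<sigma> = "explored Q {x}"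
  define R1 where "R1 U \<eta> \<longleftrightarrow> ?\<sigma> \<eta> = U \<and> (\<exists>a\<in>U. \<exists>b\<in>V - Q. {a, b} \<in> \<eta>)" for U \<eta>
  define R2 where "R2 U \<eta> \<longleftrightarrow> (\<exists>a\<in>Q - U. \<exists>b\<in>V - Q. joined_in \<eta> (Q - U) y a \<and> {a, b} \<in> \<eta>)" for U \<eta>
  have finU: "finite U" if "U \<in> Pow Q" for U using that Q finite_subset by auto
  have d\<sigma>: "cylinder (\<lambda>\<eta>. ?\<sigma> \<eta> = U)" for U
    by (rule cylinder_inner[OF Q(1) determined_explored_inner])
  have d1: "determined_by (touching_edges U) (R1 U)" for U
    unfolding R1_def
    by (intro determined_by_conj determined_by_bex determined_explored determined_edge)
      (auto intro: touching_doubleton)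
  have c1: "cylinder (R1 U)" if "U \<in> Pow Q" for U
    by (rule cylinder_touching[OF finU[OF that] d1])
  have d2: "determined_by (inner_edges (V - U)) (R2 U)" if "U \<in> Pow Q" for U
    unfolding R2_def
  proof (intro determined_by_conj determined_by_bex)
    show "determined_by (inner_edges (V - U)) (\<lambda>\<eta>. joined_in \<eta> (Q - U) y a)" for a
      by (rule determined_by_mono[OF determined_joined_in]) (use Q in \<open>auto simp: inner_edges_def\<close>)
    show "determined_by (inner_edges (V - U)) (\<lambda>\<eta>. {a, b} \<in> \<eta>)" if "a \<in> Q - U" "b \<in> V - Q" for a b
      by (rule determined_edge) (use that \<open>U \<in> Pow Q\<close> Q in \<open>auto simp: inner_edges_def\<close>)
  qed
  have c2: "cylinder (R2 U)" if "U \<in> Pow Q" for U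
  proof (rule cylinder_touching[OF Q(1)])
    show "determined_by (touching_edges Q) (R2 U)"
      unfolding R2_def
    proof (intro determined_by_conj determined_by_bex)
      show "determined_by (touching_edges Q) (\<lambda>\<eta>. joined_in \<eta> (Q - U) y a)" for a
        by (rule determined_by_mono[OF determined_joined_touching]) (auto simp: touching_edges_def)
      show "determined_by (touching_edges Q) (\<lambda>\<eta>. {a, b} \<in> \<eta>)" if "a \<in> Q - U" "b \<in> V - Q" for a b
        by (rule determined_edge) (use that in \<open>auto intro: touching_doubleton\<close>)
    qed
  qed
  have ex1: "exits Q x \<eta> \<and> ?\<sigma> \<eta> = U \<longleftrightarrow> R1 U \<eta>" for \<eta> U
    unfolding R1_def exits_def explored_def using joined_in_mem[of \<eta> Q x] by blast
  have "perc_prob p (split_exit Q x y) = (\<Sum>U\<in>Pow Q. perc_prob p (\<lambda>\<eta>. split_exit Q x y \<eta> \<and> ?\<sigma> \<eta> = U))"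
    by (rule perc_prob_partition)
      (use Q explored_subset[of Q "{x}"] d\<sigma> cylinder_split_exit[OF Q(1)] in \<open>auto intro!: cylinder_imp_perc_event\<close>)
  also have "\<dots> \<le> (\<Sum>U\<in>Pow Q. perc_prob p (R1 U) * perc_prob p (exits Q y))"
  proof (rule sum_mono)
    fix U assume U: "U \<in> Pow Q"
    have "perc_prob p (\<lambda>\<eta>. split_exit Q x y \<eta> \<and> ?\<sigma> \<eta> = U) \<le> perc_prob p (\<lambda>\<eta>. R1 U \<eta> \<and> R2 U \<eta>)"
    proof (rule perc_prob_mono)
      show "perc_event (\<lambda>\<eta>. R1 U \<eta> \<and> R2 U \<eta>)" using c1[OF U] c2[OF U] by auto
      fix \<eta> assume \<eta>: "\<eta> \<subseteq> E" "split_exit Q x y \<eta> \<and> ?\<sigma> \<eta> = U"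
      then have R1: "R1 U \<eta>" using ex1 unfolding split_exit_def by blast
      from \<eta> obtain a b where ab: "a \<in> Q" "b \<in> V - Q" "joined_in \<eta> Q y a" "{a, b} \<in> \<eta>"
        unfolding split_exit_def exits_def by blast
      have "y \<notin> U" using \<eta> unfolding split_exit_def explored_def by auto
      have "joined_in \<eta> (Q \<inter> (Q - U)) y a"
      proof (rule joined_in_closed[OF ab(3)])
        show "y \<in> Q - U" using \<open>y \<in> Q\<close> \<open>y \<notin> U\<close> by simp
        fix c d assume cd: "c \<in> Q - U" "d \<in> Q - (Q - U)"
        then have "d \<in> explored Q {x} \<eta>" using \<eta> by auto
        then show "{c, d} \<notin> \<eta>"
          using explored_boundary[of d Q "{x}" \<eta> c] \<eta> cd by (auto simp: insert_commute)
      qed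
      then have "joined_in \<eta> (Q - U) y a" by (rule joined_in_mono) auto
      moreover from joined_in_mem[OF this] have "a \<in> Q - U" by simp
      ultimately have "R2 U \<eta>" unfolding R2_def using ab by blast
      with R1 show "R1 U \<eta> \<and> R2 U \<eta>" by simp
    qed
    also have "\<dots> = perc_prob p (R1 U) * perc_prob p (R2 U)"
      by (rule perc_prob_indep[OF p c1[OF U] d1 c2[OF U] d2[OF U]]) (auto simp: touching_edges_def inner_edges_def)
    also have "\<dots> \<le> perc_prob p (R1 U) * perc_prob p (exits Q y)"
    proof (intro mult_left_mono perc_prob_mono)
      fix \<eta> assume "R2 U \<eta>"
      then show "exits Q y \<eta>" unfolding R2_def exits_def by (meson DiffE Diff_subset joined_in_mono order_refl)
    qed (use cylinder_exits[OF Q(1)] in auto)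
    finally show "perc_prob p (\<lambda>\<eta>. split_exit Q x y \<eta> \<and> ?\<sigma> \<eta> = U) \<le> perc_prob p (R1 U) * perc_prob p (exits Q y)" .
  qed
  also have "\<dots> = (\<Sum>U\<in>Pow Q. perc_prob p (\<lambda>\<eta>. exits Q x \<eta> \<and> ?\<sigma> \<eta> = U)) * perc_prob p (exits Q y)"
    unfolding sum_distrib_right ex1 ..
  also have "(\<Sum>U\<in>Pow Q. perc_prob p (\<lambda>\<eta>. exits Q x \<eta> \<and> ?\<sigma> \<eta> = U)) = perc_prob p (exits Q x)"
    by (rule perc_prob_partition[symmetric])
      (use Q explored_subset[of Q "{x}"] d\<sigma> cylinder_exits[OF Q(1)] in \<open>auto intro!: cylinder_imp_perc_event\<close>)
  finally show ?thesis .
qed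

lemma inf_cluster_open_edges: "inf_cluster x (open_edges E \<omega>) \<longleftrightarrow> infinite (open_cluster V E \<omega> x)"
  by (simp add: inf_cluster_def open_cluster_def)

text \<open>Balls are finite, so a cluster is infinite exactly when it is unbounded. Radii start at
  \<open>m\<close> because \<open>exits\<close> is false for a ball that misses \<open>x\<close>,
  which would spoil the monotonicity in \<open>n\<close>.\<close>

lemma inf_cluster_iff_exits:
  assumes v: "v \<in> V" and x: "x \<in> gball v m"
  shows "inf_cluster x \<eta> \<longleftrightarrow> (\<forall>n. exits (gball v (n + m)) x \<eta>)"
proof
  assume inf: "inf_cluster x \<eta>"
  show "\<forall>n. exits (gball v (n + m)) x \<eta>"
  proof
    fix n
    obtain y where "y \<in> V" "joined_in \<eta> V x y" "n + m < gdist v y"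
      using unbounded_dist[OF v inf[unfolded inf_cluster_def]] by blast
    then show "exits (gball v (n + m)) x \<eta>"
      using x by (intro exitsI[of \<eta> V x y]) (auto simp: in_gball)
  qed
next
  assume ex: "\<forall>n. exits (gball v (n + m)) x \<eta>"
  show "inf_cluster x \<eta>"
    unfolding inf_cluster_def
  proof
    assume fin: "finite {y \<in> V. joined_in \<eta> V x y}"
    let ?n = "Max (insert 0 (gdist v ` {y \<in> V. joined_in \<eta> V x y}))"
    have le: "gdist v y \<le> ?n" if "y \<in> V" "joined_in \<eta> V x y" for y
      using fin that by (intro Max_ge) auto
    obtain b where "b \<in> V - gball v (?n + m)" "joined_in \<eta> V x b"
      using exitsE[OF ex[rule_format, of ?n] gball_subset_V] .
    with le[of b] show False by (auto simp: in_gball)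
  qed
qed

lemma exits_prob_tendsto:
  assumes v: "v \<in> V" and x: "x \<in> V"
  shows "(\<lambda>n. perc_prob p (exits (gball v n) x)) \<longlonglongrightarrow> perc_prob p (inf_cluster x)"
    and "perc_event (inf_cluster x)"
proof -
  define m where "m = gdist v x"
  have xm: "x \<in> gball v (n + m)" for n using x by (simp add: in_gball m_def)
  have eq: "inf_cluster x = (\<lambda>\<eta>. \<forall>n. exits (gball v (n + m)) x \<eta>)"
    using inf_cluster_iff_exits[OF v xm[of 0]] by auto
  have c: "cylinder (exits (gball v (n + m)) x)" for n by (rule cylinder_exits[OF finite_gball[OF v]])
  have d: "exits (gball v (n + m)) x \<eta>" if "exits (gball v (Suc n + m)) x \<eta>" for n \<eta>
    by (rule exits_antimono[OF that gball_mono gball_subset_V xm]) auto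
  have "(\<lambda>n. perc_prob p (exits (gball v (n + m)) x)) \<longlonglongrightarrow> perc_prob p (inf_cluster x)"
    unfolding eq by (rule perc_prob_decseq(1)[OF c d])
  then show "(\<lambda>n. perc_prob p (exits (gball v n) x)) \<longlonglongrightarrow> perc_prob p (inf_cluster x)"
    by (rule LIMSEQ_offset)
  show "perc_event (inf_cluster x)"
    unfolding eq by (rule perc_prob_decseq(2)[OF c d])
qed

text \<open>The events decrease, and their intersection puts \<open>x\<close> and \<open>y\<close>
  into two different infinite clusters.\<close>

lemma split_exit_prob_tendsto_0:
  assumes v: "v \<in> V" and xy: "x \<in> V" "y \<in> V" and uniq: "unique_infinite_cluster V E p"
  shows "(\<lambda>n. perc_prob p (split_exit (gball v n) x y)) \<longlonglongrightarrow> 0"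
proof -
  define m where "m = max (gdist v x) (gdist v y)"
  have xm: "x \<in> gball v (n + m)" "y \<in> gball v (n + m)" for n using xy by (auto simp: in_gball m_def)
  have c: "cylinder (split_exit (gball v (n + m)) x y)" for n by (rule cylinder_split_exit[OF finite_gball[OF v]])
  have d: "split_exit (gball v (n + m)) x y \<eta>" if "split_exit (gball v (Suc n + m)) x y \<eta>" for n \<eta>
    by (rule split_exit_antimono[OF that gball_mono gball_subset_V xm]) auto
  have lim: "(\<lambda>n. perc_prob p (split_exit (gball v (n + m)) x y)) \<longlonglongrightarrow> perc_prob p (\<lambda>\<eta>. \<forall>n. split_exit (gball v (n + m)) x y \<eta>)"
    by (rule perc_prob_decseq(1)[OF c d])
  have ev: "perc_event (\<lambda>\<eta>. \<forall>n. split_exit (gball v (n + m)) x y \<eta>)"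
    by (rule perc_prob_decseq(2)[OF c d])
  have no: "\<not> (\<forall>n. split_exit (gball v (n + m)) x y (open_edges E \<omega>))"
    if "\<exists>\<^sub>\<le>\<^sub>1 C. C \<in> open_cluster V E \<omega> ` V \<and> infinite C" for \<omega>
  proof
    assume bad: "\<forall>n. split_exit (gball v (n + m)) x y (open_edges E \<omega>)"
    let ?\<eta> = "open_edges E \<omega>"
    have "inf_cluster x ?\<eta>" "inf_cluster y ?\<eta>"
      using bad inf_cluster_iff_exits[OF v xm(1)[of 0]] inf_cluster_iff_exits[OF v xm(2)[of 0]]
      unfolding split_exit_def by simp_all
    then have "infinite (open_cluster V E \<omega> x)" "infinite (open_cluster V E \<omega> y)"
      unfolding inf_cluster_open_edges .
    then have "open_cluster V E \<omega> x = open_cluster V E \<omega> y"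
      using that xy unfolding Uniq_def by blast
    moreover have "y \<in> open_cluster V E \<omega> y" using xy by (simp add: open_cluster_def)
    ultimately have "y \<in> open_cluster V E \<omega> x" by (simp only:)
    then have j: "joined_in ?\<eta> V x y" by (simp add: open_cluster_def)
    \<comment> \<open>A single open path from \<open>x\<close> to \<open>y\<close> is finite, hence
      contained in one of the balls.\<close>
    then obtain xs where xs: "walk_in ?\<eta> V xs" "hd xs = x" "last xs = y" unfolding joined_in_def by blast
    define n where "n = Max (gdist v ` set xs)"
    have "set xs \<noteq> {}" "set xs \<subseteq> V" using xs(1) by (auto simp: walk_in_def)
    then have "set xs \<subseteq> gball v (n + m)" by (force simp: n_def in_gball intro: trans_le_add1)
    then have "walk_in ?\<eta> (gball v (n + m)) xs" using xs(1) by (auto simp: walk_in_def)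
    then have "joined_in ?\<eta> (gball v (n + m)) x y" using xs unfolding joined_in_def by blast
    with bad show False unfolding split_exit_def by blast
  qed
  interpret P: prob_space "bond_percolation E p" by (rule prob_space_bond_percolation)
  have AE: "AE \<omega> in bond_percolation E p. \<not> (\<forall>n. split_exit (gball v (n + m)) x y (open_edges E \<omega>))"
    using uniq unfolding unique_infinite_cluster_def by (rule AE_mp) (use no in auto)
  have "perc_prob p (\<lambda>\<eta>. \<forall>n. split_exit (gball v (n + m)) x y \<eta>) = 0"
    unfolding perc_prob_def
    using P.prob_Collect_eq_0[OF ev[unfolded perc_event_def, rule_format]] by (rule iffD2) (rule AE)
  with lim have "(\<lambda>n. perc_prob p (split_exit (gball v (n + m)) x y)) \<longlonglongrightarrow> 0" by simp
  then show ?thesis by (rule LIMSEQ_offset)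
qed

lemma joined_in_restrict_inner:
  assumes "joined_in E Z x y" "inner_edges Z \<subseteq> \<eta>"
  shows "joined_in \<eta> Z x y"
  by (rule joined_in_cong[OF assms(1)]) (use assms(2) inner_doubleton in blast)

text \<open>Opening all edges of the small ball joins \<open>x\<close> to \<open>y\<close>, at a
  price that does not depend on \<open>k\<close>.\<close>

lemma exits_prob_compare:
  assumes v: "v \<in> V" and p: "p \<in> {0..1}" and xy: "x \<in> gball v m" "y \<in> gball v m" and k: "m \<le> k"
  shows "p ^ card (inner_edges (gball v m)) * perc_prob p (exits (gball v k) y) \<le> perc_prob p (exits (gball v k) x)"
proof -
  let ?F = "inner_edges (gball v m)"
  have cyl: "cylinder (exits (gball v k) z)" for z by (rule cylinder_exits[OF finite_gball[OF v]])
  have "p ^ card ?F * perc_prob p (exits (gball v k) y) \<le> perc_prob p (\<lambda>\<eta>. ?F \<subseteq> \<eta> \<and> exits (gball v k) y \<eta>)"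
    by (rule perc_prob_finite_energy[OF cyl _ p finite_inner_edges[OF finite_gball[OF v]]])
      (auto intro: exits_mono simp: inner_edges_def)
  also have "\<dots> \<le> perc_prob p (exits (gball v k) x)"
  proof (rule perc_prob_mono)
    fix \<eta> assume \<eta>: "?F \<subseteq> \<eta> \<and> exits (gball v k) y \<eta>"
    have "joined_in E (gball v m) x y" using connected_gball[OF v] xy unfolding connected_set_def by blast
    then have "joined_in \<eta> (gball v m) x y" by (rule joined_in_restrict_inner) (use \<eta> in simp)
    then have "joined_in \<eta> (gball v k) x y" by (rule joined_in_mono) (use gball_mono[OF k] in auto)
    with \<eta> show "exits (gball v k) x \<eta>" unfolding exits_def by (meson joined_in_trans)
  qed (use cyl in auto)
  finally show ?thesis .
qed

lemma exits_prob_ge: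
  assumes v: "v \<in> V" and p: "p \<in> {0..1}" and x: "x \<in> gball v k"
  shows "p ^ card (touching_edges (gball v k)) \<le> perc_prob p (exits (gball v k) x)"
proof -
  let ?F = "touching_edges (gball v k)"
  have fin: "finite ?F" by (rule finite_touching_edges[OF finite_gball[OF v]])
  have "p ^ card ?F = perc_prob p (\<lambda>\<eta>. ?F \<subseteq> \<eta>)"
    using perc_prob_all_open[OF fin _ p] by (auto simp: touching_edges_def)
  also have "\<dots> \<le> perc_prob p (exits (gball v k) x)"
  proof (rule perc_prob_mono)
    fix \<eta> assume \<eta>: "?F \<subseteq> \<eta>"
    obtain z where z: "z \<in> V" "gdist v z = Suc k"
      using gsphere_nonempty[OF v, of "Suc k"] by (auto simp: in_gsphere)
    then obtain y where y: "y \<in> V" "{y, z} \<in> E" "gdist v y = k"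
      using gdist_pred[OF v] by blast
    have yB: "y \<in> gball v k" using y by (simp add: in_gball)
    have "joined_in E (gball v k) x y" using connected_gball[OF v] x yB unfolding connected_set_def by blast
    then have "joined_in \<eta> (gball v k) x y"
      by (rule joined_in_cong) (use \<eta> touching_doubleton in blast)
    moreover have "{y, z} \<in> \<eta>" using \<eta> touching_doubleton[OF y(2)] yB by blast
    ultimately show "exits (gball v k) x \<eta>" using yB z unfolding exits_def by (intro bexI[of _ y] bexI[of _ z]) (auto simp: in_gball)
  qed (use cylinder_exits[OF finite_gball[OF v]] in auto)
  finally show ?thesis .
qed

lemma exits_prob_pos:
  assumes "v \<in> V" "0 < p" "p \<le> 1" "x \<in> gball v k"
  shows "perc_prob p (exits (gball v k) x) > 0"
  by (rule less_le_trans[OF _ exits_prob_ge]) (use assms in auto)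

text \<open>The bound is relative to the exit probability of \<open>w\<close> at the same scale,
  which may itself tend to 0; this relative form is what survives conditioning on a connection. The
  cases are whether the limit of the exit probabilities vanishes.\<close>

lemma split_exit_negligible:
  assumes v: "v \<in> V" and w: "w \<in> V" and p: "0 < p" "p \<le> 1" and uniq: "unique_infinite_cluster V E p"
    and \<epsilon>: "\<epsilon> > 0"
  shows "\<forall>\<^sub>F k in sequentially. perc_prob p (\<lambda>\<eta>. \<exists>y\<in>gball v r. split_exit (gball v k) w y \<eta>)
    < \<epsilon> * perc_prob p (exits (gball v k) w)"
proof -
  define e where "e k = perc_prob p (exits (gball v k) w)" for k
  define B where "B k = (\<Sum>y\<in>gball v r. perc_prob p (split_exit (gball v k) w y))" for k
  have pI: "p \<in> {0..1}" using p by simp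
  have finB: "finite (gball v k)" for k by (rule finite_gball[OF v])
  have union: "perc_prob p (\<lambda>\<eta>. \<exists>y\<in>gball v r. split_exit (gball v k) w y \<eta>) \<le> B k" for k
    unfolding B_def by (rule perc_prob_Bex_le[OF finB cylinder_split_exit[OF finB]])
  have elim: "e \<longlonglongrightarrow> perc_prob p (inf_cluster w)"
    unfolding e_def by (rule exits_prob_tendsto(1)[OF v w])
  define m where "m = max r (gdist v w)"
  have wm: "w \<in> gball v m" using w by (simp add: in_gball m_def)
  have ym: "y \<in> gball v m" if "y \<in> gball v r" for y using that by (auto simp: in_gball m_def)
  have epos: "e k > 0" if "k \<ge> m" for k
    unfolding e_def using exits_prob_pos[OF v p] wm gball_mono[OF that] by blast
  show ?thesis
  proof (cases "perc_prob p (inf_cluster w) = 0")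
    case False
    then have \<theta>: "perc_prob p (inf_cluster w) > 0" using perc_prob_nonneg[of p "inf_cluster w"] by linarith
    have "B \<longlonglongrightarrow> (\<Sum>y\<in>gball v r. 0)"
      unfolding B_def by (intro tendsto_sum split_exit_prob_tendsto_0[OF v w _ uniq]) (simp add: in_gball)
    then have "(\<lambda>k. \<epsilon> * e k - B k) \<longlonglongrightarrow> \<epsilon> * perc_prob p (inf_cluster w) - 0"
      by (intro tendsto_intros elim) simp
    from order_tendstoD(1)[OF this, of 0]
    have "\<forall>\<^sub>F k in sequentially. 0 < \<epsilon> * e k - B k"
      using \<theta> \<epsilon> by simp
    then show ?thesis by eventually_elim (use union in \<open>fastforce simp: e_def intro: le_less_trans\<close>)
  next
    case True
    with elim have e0: "e \<longlonglongrightarrow> 0" by simp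
    define C where "C = p ^ card (inner_edges (gball v m))"
    have C: "C > 0" unfolding C_def using p by simp
    have bnd: "perc_prob p (exits (gball v k) y) \<le> e k / C" if "y \<in> gball v r" "k \<ge> m" for k y
      using exits_prob_compare[OF v pI wm ym[OF that(1)] that(2)] C
      by (simp add: field_simps C_def e_def)
    \<comment> \<open>Exits from \<open>y\<close> are comparable to exits from \<open>w\<close>, so
      a split exit costs a second factor \<open>e k\<close>, up to the constant
      \<open>C\<close>.\<close>
    have Bk: "B k \<le> e k * (real (card (gball v r)) * (e k / C))" if "k \<ge> m" for k
    proof -
      have "B k \<le> (\<Sum>y\<in>gball v r. e k * (e k / C))"
        unfolding B_def
      proof (rule sum_mono)
        fix y assume y: "y \<in> gball v r"
        have "perc_prob p (split_exit (gball v k) w y) \<le> e k * perc_prob p (exits (gball v k) y)"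
          unfolding e_def using wm ym[OF y] gball_mono[OF that]
          by (intro split_exit_prob_le[OF finB gball_subset_V _ _ pI]) auto
        also have "\<dots> \<le> e k * (e k / C)"
          using bnd[OF y that] by (intro mult_left_mono) (auto simp: e_def)
        finally show "perc_prob p (split_exit (gball v k) w y) \<le> e k * (e k / C)" .
      qed
      then show ?thesis by (simp add: algebra_simps)
    qed
    have "(\<lambda>k. real (card (gball v r)) * (e k / C)) \<longlonglongrightarrow> real (card (gball v r)) * (0 / C)"
      by (intro tendsto_intros e0) (use C in simp)
    from order_tendstoD(2)[OF this, of \<epsilon>]
    have "\<forall>\<^sub>F k in sequentially. real (card (gball v r)) * (e k / C) < \<epsilon>"
      using \<epsilon> by simp
    then show ?thesis using eventually_ge_at_top[of m]
    proof eventually_elim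
      case (elim k)
      have "B k < e k * \<epsilon>"
        using Bk[OF elim(2)] mult_strict_left_mono[OF elim(1) epos[OF elim(2)]] by linarith
      with union[of k] show ?case by (simp add: e_def mult.commute)
    qed
  qed
qed

section \<open>Path counting and the critical threshold\<close>

lemma connects_prob_le_power:
  assumes D: "\<And>x. x \<in> V \<Longrightarrow> real (card {y. {x, y} \<in> E}) \<le> D" and p: "p \<in> {0..1}"
    and Z: "finite Z" "Z \<subseteq> V" and L: "L \<subseteq> V" "\<And>l. l \<in> L \<Longrightarrow> n \<le> gdist x l" and x: "x \<in> V"
  shows "perc_prob p (connects Z {x} L) \<le> (D * p) ^ n"
  using Z L(2) x
proof (induction n arbitrary: Z x)
  case 0
  then show ?case by simp
next
  case (Suc n)
  let ?N = "{y. {x, y} \<in> E}"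
  let ?R = "\<lambda>y \<eta>. {{x, y}} \<subseteq> \<eta> \<and> connects (Z - {x}) {y} L \<eta>"
  have "x \<notin> L"
  proof
    assume "x \<in> L"
    from Suc.prems(3)[OF this] show False using gdist_0[of x x] \<open>x \<in> V\<close> by simp
  qed
  have D0: "D \<ge> 0" using D[OF \<open>x \<in> V\<close>] by (meson of_nat_0_le_iff order_trans)
  have cyl: "cylinder (connects (Z - {x}) {y} L)" for y by (rule cylinder_connects) (use Suc in auto)
  have cylo: "cylinder (\<lambda>\<eta>. {{x, y}} \<subseteq> \<eta>)" if "y \<in> ?N" for y
    by (rule cylinderI[of "{{x, y}}", OF _ _ determined_by_open]) (use that in auto)
  have "perc_prob p (connects Z {x} L) \<le> perc_prob p (\<lambda>\<eta>. \<exists>y\<in>?N. ?R y \<eta>)"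
  proof (rule perc_prob_mono)
    show "perc_event (\<lambda>\<eta>. \<exists>y\<in>?N. ?R y \<eta>)"
      by (intro cylinder_imp_perc_event cylinder_bex cylinder_conj cyl cylo finite_neighbours)
    fix \<eta> assume \<eta>: "\<eta> \<subseteq> E" "connects Z {x} L \<eta>"
    then obtain l where l: "l \<in> L" "joined_in \<eta> Z x l" by (auto elim: connectsE)
    have "l \<notin> {x}" using l \<open>x \<notin> L\<close> by auto
    \<comment> \<open>After the last visit to \<open>x\<close> the path avoids \<open>x\<close>, so
      the remaining connection is independent of the edge by which \<open>x\<close> was
      left.\<close>
    obtain a b where ab: "a \<in> Z \<inter> {x}" "b \<in> Z - {x}" "{a, b} \<in> \<eta>" "joined_in \<eta> (Z - {x}) b l"
      using joined_in_last_exit[OF l(2) _ \<open>l \<notin> {x}\<close>] by blast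
    then have "connects (Z - {x}) {b} L \<eta>" using l by (intro connectsI) auto
    with ab \<eta> show "\<exists>y\<in>?N. ?R y \<eta>" by (intro bexI[of _ b]) auto
  qed
  also have "\<dots> \<le> (\<Sum>y\<in>?N. perc_prob p (?R y))"
    by (intro perc_prob_Bex_le cylinder_conj cyl cylo finite_neighbours)
  also have "\<dots> \<le> (\<Sum>y\<in>?N. p * (D * p) ^ n)"
  proof (rule sum_mono)
    fix y assume y: "y \<in> ?N"
    have "perc_prob p (?R y) = perc_prob p (\<lambda>\<eta>. {{x, y}} \<subseteq> \<eta>) * perc_prob p (connects (Z - {x}) {y} L)"
      by (rule perc_prob_indep[OF p cylo[OF y] determined_by_open cyl determined_connects])
        (auto simp: inner_edges_def)
    also have "perc_prob p (\<lambda>\<eta>. {{x, y}} \<subseteq> \<eta>) = p"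
      using perc_prob_all_open[of "{{x, y}}" p] y p by simp
    also have "perc_prob p (connects (Z - {x}) {y} L) \<le> (D * p) ^ n"
    proof (rule Suc.IH)
      fix l assume "l \<in> L"
      have xy: "x \<in> V" "y \<in> V" using edge_vertices y by auto
      have "gdist x l \<le> gdist x y + gdist y l" using xy L(1) \<open>l \<in> L\<close> by (intro gdist_triangle) auto
      moreover have "gdist x y \<le> Suc (gdist x x)" using xy y by (intro gdist_edge) auto
      ultimately show "n \<le> gdist y l"
        using Suc.prems(3)[OF \<open>l \<in> L\<close>] gdist_0[OF xy(1) xy(1)] by simp
    qed (use Suc edge_vertices y in auto)
    finally show "perc_prob p (?R y) \<le> p * (D * p) ^ n" using p by (simp add: mult_left_mono)
  qed
  also have "\<dots> = real (card ?N) * (p * (D * p) ^ n)" by simp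
  also have "\<dots> \<le> D * (p * (D * p) ^ n)"
    using D[OF \<open>x \<in> V\<close>] D0 p by (intro mult_right_mono) auto
  finally show ?case by (simp add: mult.assoc)
qed

lemma critical_threshold_eq:
  "critical_threshold V E v = Inf {p \<in> {0..1}. perc_prob p (inf_cluster v) > 0}"
  by (simp add: critical_threshold_def perc_prob_def inf_cluster_open_edges)

lemma inf_cluster_prob_1:
  assumes "v \<in> V"
  shows "perc_prob 1 (inf_cluster v) = 1"
proof -
  have "v \<in> gball v k" for k using assms gdist_0[of v v] by (simp add: in_gball)
  then have "perc_prob 1 (exits (gball v k) v) = 1" for k
    using exits_prob_ge[of v 1 v k] assms perc_prob_le_1[of 1 "exits (gball v k) v"] by auto
  with exits_prob_tendsto(1)[OF assms assms, of 1] show ?thesis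
    by (simp add: LIMSEQ_const_iff)
qed

text \<open>Path counting with a degree bound \<open>D\<close> shows that the threshold is at least
  \<open>1 / D\<close>. Positivity is what makes it possible to force finitely many edges open at
  the critical parameter.\<close>

lemma critical_threshold_bounds:
  assumes v: "v \<in> V"
  shows "0 < critical_threshold V E v" "critical_threshold V E v \<le> 1"
proof -
  let ?S = "{p \<in> {0..1}. perc_prob p (inf_cluster v) > 0}"
  have one: "1 \<in> ?S" using inf_cluster_prob_1[OF v] by simp
  have bdd: "bdd_below ?S" by (rule bdd_belowI[of _ 0]) auto
  show "critical_threshold V E v \<le> 1"
    unfolding critical_threshold_eq by (rule cInf_lower[OF one bdd])
  obtain d where d: "\<And>x. x \<in> V \<Longrightarrow> card {y \<in> V. {x, y} \<in> E} \<le> d" using bounded_degree by blast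
  define D where "D = max 1 (real d)"
  have D: "real (card {y. {x, y} \<in> E}) \<le> D" if "x \<in> V" for x
  proof -
    have "{y. {x, y} \<in> E} = {y \<in> V. {x, y} \<in> E}" using edge_vertices by auto
    with d[OF that] show ?thesis by (simp add: D_def)
  qed
  have "1 / D \<le> p" if "p \<in> ?S" for p
  proof (rule ccontr)
    assume "\<not> 1 / D \<le> p"
    then have lt: "D * p < 1" using D_def by (simp add: field_simps)
    have p: "p \<in> {0..1}" using that by simp
    have bound: "perc_prob p (exits (gball v k) v) \<le> (D * p) ^ Suc k" for k
    proof -
      have "perc_prob p (exits (gball v k) v) \<le> perc_prob p (connects (gball v (Suc k)) {v} (gsphere v (Suc k)))"
      proof (rule perc_prob_mono)
        fix \<eta> assume "\<eta> \<subseteq> E" "exits (gball v k) v \<eta>"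
        then show "connects (gball v (Suc k)) {v} (gsphere v (Suc k)) \<eta>"
          using exits_sphere[OF _ _ v] by (metis connectsI insertI1)
      qed (use cylinder_connects[OF finite_gball[OF v]] in auto)
      also have "\<dots> \<le> (D * p) ^ Suc k"
        by (rule connects_prob_le_power[OF D p finite_gball[OF v] gball_subset_V]) (use v in \<open>auto simp: in_gsphere\<close>)
      finally show ?thesis .
    qed
    have "(\<lambda>k. (D * p) ^ Suc k) \<longlonglongrightarrow> 0"
      using lt p D_def by (intro LIMSEQ_Suc LIMSEQ_realpow_zero) auto
    then have "perc_prob p (inf_cluster v) \<le> 0"
      by (rule LIMSEQ_le[OF exits_prob_tendsto(1)[OF v v]]) (use bound in blast)
    with that show False by simp
  qed
  then have "1 / D \<le> critical_threshold V E v"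
    unfolding critical_threshold_eq using one by (intro cInf_greatest) auto
  moreover have "1 / D > 0" by (simp add: D_def)
  ultimately show "0 < critical_threshold V E v" by linarith
qed

text \<open>Some parameter below \<open>p\<close> already percolates from \<open>v\<close>.
  Monotonicity in the parameter and the passage from \<open>v\<close> to \<open>w\<close> are
  carried out for exits, which are cylinder events, and then taken to the limit.\<close>

lemma inf_cluster_prob_pos:
  assumes v: "v \<in> V" and w: "w \<in> V" and p: "critical_threshold V E v < p" "p \<le> 1"
  shows "perc_prob p (inf_cluster w) > 0"
proof -
  let ?S = "{p \<in> {0..1}. perc_prob p (inf_cluster v) > 0}"
  have one: "1 \<in> ?S" using inf_cluster_prob_1[OF v] by simp
  have bdd: "bdd_below ?S" by (rule bdd_belowI[of _ 0]) auto
  obtain q where q: "q \<in> ?S" "q < p"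
    using p(1) cInf_lessD[of ?S p] one unfolding critical_threshold_eq by blast
  have "critical_threshold V E v \<le> q"
    unfolding critical_threshold_eq by (rule cInf_lower[OF q(1) bdd])
  then have q0: "q > 0" using critical_threshold_bounds(1)[OF v] by linarith
  define m where "m = max (gdist v v) (gdist v w)"
  define C where "C = q ^ card (inner_edges (gball v m))"
  have C: "C > 0" unfolding C_def using q0 by simp
  have ge: "C * perc_prob q (exits (gball v k) v) \<le> perc_prob p (exits (gball v k) w)" if "k \<ge> m" for k
  proof -
    have "C * perc_prob q (exits (gball v k) v) \<le> perc_prob q (exits (gball v k) w)"
      unfolding C_def using q that v w by (intro exits_prob_compare[OF v]) (auto simp: in_gball m_def)
    also have "\<dots> \<le> perc_prob p (exits (gball v k) w)"
      using q q0 p by (intro perc_prob_mono_param cylinder_exits finite_gball v) (auto intro: exits_mono)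
    finally show ?thesis .
  qed
  have "C * perc_prob q (inf_cluster v) \<le> perc_prob p (inf_cluster w)"
    by (rule LIMSEQ_le[OF tendsto_mult_left[OF exits_prob_tendsto(1)[OF v v]] exits_prob_tendsto(1)[OF v w]])
      (use ge in blast)
  moreover have "C * perc_prob q (inf_cluster v) > 0" using C q by simp
  ultimately show ?thesis by linarith
qed

section \<open>Quasi-multiplicativity\<close>

lemma quasi_multiplicativeD:
  assumes "quasi_multiplicative V E v c p" "m > 0" "Z \<subseteq> V" "finite Z" "connected_set E Z"
    "graph_annulus V E v m (4 * m) \<subseteq> Z" "X \<subseteq> Z \<inter> gball v m" "Y \<subseteq> Z - gball v (4 * m)"
  shows "c * perc_prob p (connects Z X (gsphere v (2 * m))) * perc_prob p (connects Z Y (gsphere v (2 * m)))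
    \<le> perc_prob p (connects Z X Y)"
  using assms unfolding quasi_multiplicative_def perc_prob_def open_connection_eq by blast

lemma sphere_subset_annulus: "m > 0 \<Longrightarrow> gsphere v (2 * m) \<subseteq> graph_annulus V E v m (4 * m)"
  by (auto simp: graph_annulus_def in_gball in_gsphere)

text \<open>Only the component of \<open>Z\<close> containing the annulus matters, so \<open>Z\<close> itself need not be connected.\<close>

lemma quasi_multiplicative_component:
  assumes qm: "quasi_multiplicative V E v c p" and m: "m > 0" and v: "v \<in> V"
    and Z: "Z \<subseteq> V" "finite Z" "graph_annulus V E v m (4 * m) \<subseteq> Z"
    and ann: "\<And>x y. x \<in> graph_annulus V E v m (4 * m) \<Longrightarrow> y \<in> graph_annulus V E v m (4 * m) \<Longrightarrow> joined_in E Z x y"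
    and X: "X \<subseteq> Z \<inter> gball v m" and Y: "Y \<subseteq> Z - gball v (4 * m)"
    and Yann: "\<And>y. y \<in> Y \<Longrightarrow> \<exists>a\<in>graph_annulus V E v m (4 * m). joined_in E Z a y"
  shows "c * perc_prob p (connects Z X (gsphere v (2 * m))) * perc_prob p (connects Z Y (gsphere v (2 * m)))
    \<le> perc_prob p (connects Z X Y)"
proof -
  let ?A = "graph_annulus V E v m (4 * m)" and ?S = "gsphere v (2 * m)"
  obtain a where a: "a \<in> ?S" using gsphere_nonempty[OF v] by blast
  have SA: "?S \<subseteq> ?A" by (rule sphere_subset_annulus[OF m])
  define Z' where "Z' = explored Z {a} E"
  have Z'Z: "Z' \<subseteq> Z" unfolding Z'_def by (rule explored_subset)
  have AZ': "?A \<subseteq> Z'" unfolding Z'_def explored_def using ann a SA by blast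
  have YZ': "Y \<subseteq> Z'"
  proof
    fix y assume "y \<in> Y"
    then obtain b where "b \<in> ?A" "joined_in E Z b y" using Yann by blast
    moreover from this have "joined_in E Z a b" using ann a SA by blast
    ultimately show "y \<in> Z'" unfolding Z'_def explored_def by (auto intro: joined_in_trans)
  qed
  have aZ: "a \<in> Z'" using AZ' SA a by blast
  have conn: "connected_set E Z'"
  proof (rule connected_setI)
    fix x assume "x \<in> Z'"
    then have "joined_in E Z a x" by (simp add: Z'_def explored_def)
    then show "joined_in E Z' a x" using aZ unfolding Z'_def by (rule joined_in_explored)
  qed
  have restrict: "joined_in \<eta> Z' x y" if "\<eta> \<subseteq> E" "joined_in \<eta> Z x y" "x \<in> Z'" for \<eta> x y
    using joined_in_component[OF that(2,1)] that(3) unfolding Z'_def .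
  have finZ': "finite Z'" using Z(2) Z'Z finite_subset by blast
  have ev: "perc_event (connects W X' Y')" if "finite W" for W X' Y'
    by (rule cylinder_imp_perc_event[OF cylinder_connects[OF that]])
  have "perc_prob p (connects Z X ?S) \<le> perc_prob p (connects Z' (X \<inter> Z') ?S)"
  proof (rule perc_prob_mono[OF ev[OF finZ']])
    fix \<eta> assume \<eta>: "\<eta> \<subseteq> E" "connects Z X ?S \<eta>"
    then obtain x s where xs: "x \<in> X" "s \<in> ?S" "joined_in \<eta> Z x s" by (auto elim: connectsE)
    then have "joined_in \<eta> Z' s x" using SA AZ' by (intro restrict[OF \<eta>(1) joined_in_sym[OF xs(3)]]) auto
    then show "connects Z' (X \<inter> Z') ?S \<eta>"
      using xs joined_in_mem[of \<eta> Z' s x] by (intro connectsI[OF joined_in_sym]) auto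
  qed
  moreover have "perc_prob p (connects Z Y ?S) \<le> perc_prob p (connects Z' Y ?S)"
  proof (rule perc_prob_mono[OF ev[OF finZ']])
    fix \<eta> assume \<eta>: "\<eta> \<subseteq> E" "connects Z Y ?S \<eta>"
    then obtain x s where xs: "x \<in> Y" "s \<in> ?S" "joined_in \<eta> Z x s" by (auto elim: connectsE)
    then have "joined_in \<eta> Z' x s" using YZ' by (intro restrict[OF \<eta>(1) xs(3)]) auto
    then show "connects Z' Y ?S \<eta>" using xs by (intro connectsI) auto
  qed
  moreover have "c * perc_prob p (connects Z' (X \<inter> Z') ?S) * perc_prob p (connects Z' Y ?S)
      \<le> perc_prob p (connects Z' (X \<inter> Z') Y)"
    by (rule quasi_multiplicativeD[OF qm m _ finZ' conn AZ']) (use X Y YZ' Z'Z Z in auto)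
  moreover have "perc_prob p (connects Z' (X \<inter> Z') Y) \<le> perc_prob p (connects Z X Y)"
    by (rule perc_prob_mono[OF ev[OF Z(2)]]) (erule connects_mono, use Z'Z in auto)
  ultimately show ?thesis
  proof (cases "c \<ge> 0")
    case True
    note le = \<open>perc_prob p (connects Z X ?S) \<le> _\<close> \<open>perc_prob p (connects Z Y ?S) \<le> _\<close>
    have "c * perc_prob p (connects Z X ?S) * perc_prob p (connects Z Y ?S)
        \<le> c * perc_prob p (connects Z' (X \<inter> Z') ?S) * perc_prob p (connects Z' Y ?S)"
      using le True by (intro mult_mono mult_left_mono) auto
    then show ?thesis
      using \<open>c * perc_prob p (connects Z' (X \<inter> Z') ?S) * _ \<le> _\<close> \<open>perc_prob p (connects Z' (X \<inter> Z') Y) \<le> _\<close>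
      by linarith
  next
    case False
    then have "c * perc_prob p (connects Z X ?S) * perc_prob p (connects Z Y ?S) \<le> 0"
      by (intro mult_nonpos_nonneg) auto
    then show ?thesis using perc_prob_nonneg[of p "connects Z X Y"] by linarith
  qed
qed

text \<open>Distances change by at most one along an edge, so a path coming from outside lands on
  the sphere of radius \<open>Suc k\<close> before it can touch the ball of radius
  \<open>k\<close>.\<close>

lemma joined_to_sphere:
  assumes v: "v \<in> V" and \<eta>: "\<eta> \<subseteq> E" and j: "joined_in \<eta> Z y x"
    and y: "y \<in> V - gball v k" and x: "x \<in> gball v (Suc k)"
  obtains s where "s \<in> gsphere v (Suc k)" "joined_in \<eta> (Z - gball v k) y s"
proof (cases "y \<in> gball v (Suc k)")
  case True
  then have "y \<in> gsphere v (Suc k)" using y by (auto simp: in_gball in_gsphere)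
  moreover have "joined_in \<eta> (Z - gball v k) y y" using y joined_in_mem[OF j] by auto
  ultimately show ?thesis by (rule that)
next
  case False
  have "y \<in> - gball v (Suc k)" "x \<notin> - gball v (Suc k)" using False x by auto
  then obtain a b where ab: "joined_in \<eta> (Z \<inter> - gball v (Suc k)) y a" "b \<in> Z - - gball v (Suc k)" "{a, b} \<in> \<eta>"
    using joined_in_first_exit[OF j] by metis
  have ab': "a \<in> V" "b \<in> V" using ab(3) \<eta> edge_vertices by auto
  have a: "a \<notin> gball v (Suc k)" using joined_in_mem[OF ab(1)] by simp
  have "{b, a} \<in> E" using ab(3) \<eta> by (auto simp: insert_commute)
  then have "gdist v a \<le> Suc (gdist v b)" by (rule gdist_edge[OF v])
  then have b: "b \<in> gsphere v (Suc k)" using a ab(2) ab' by (auto simp: in_gball in_gsphere)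
  have "joined_in \<eta> (Z - gball v k) y a"
    by (rule joined_in_mono[OF ab(1)]) (use gball_mono[of k "Suc k" v] in auto)
  then have "joined_in \<eta> (Z - gball v k) y b"
    by (rule joined_in_step) (use ab b in \<open>auto simp: in_gball in_gsphere\<close>)
  with b show ?thesis by (rule that)
qed

lemma connects_sphere_iff_exits:
  assumes v: "v \<in> V" and \<eta>: "\<eta> \<subseteq> E" and Z: "gball v (Suc k) \<subseteq> Z" "Z \<subseteq> V" and w: "w \<in> gball v k"
  shows "connects Z {w} (gsphere v (Suc k)) \<eta> \<longleftrightarrow> exits (gball v k) w \<eta>"
proof
  assume "connects Z {w} (gsphere v (Suc k)) \<eta>"
  then obtain s where "s \<in> gsphere v (Suc k)" "joined_in \<eta> Z w s" by (auto elim: connectsE)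
  then show "exits (gball v k) w \<eta>" using w Z by (intro exitsI[of \<eta> Z w s]) (auto simp: in_gball in_gsphere)
next
  assume "exits (gball v k) w \<eta>"
  then obtain b where "b \<in> gsphere v (Suc k)" "joined_in \<eta> (gball v (Suc k)) w b"
    using exits_sphere[OF _ \<eta> v] by metis
  then show "connects Z {w} (gsphere v (Suc k)) \<eta>"
    using joined_in_mono[OF _ order_refl Z(1)] by (intro connectsI) auto
qed

text \<open>The part of a connection to \<open>Y\<close> that runs outside the ball of radius
  \<open>k\<close>. It uses no edge touching that ball, hence is independent of everything read from
  such edges.\<close>

definition outer :: "'a \<Rightarrow> nat \<Rightarrow> 'a set \<Rightarrow> 'a set \<Rightarrow> 'a set set \<Rightarrow> bool" where
  "outer v k Z Y = connects (Z - gball v k) Y (gsphere v (Suc k))"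

lemma determined_outer:
  assumes "Z \<subseteq> V"
  shows "determined_by (inner_edges (V - gball v k)) (outer v k Z Y)"
  unfolding outer_def
  by (rule determined_by_mono[OF determined_connects]) (use assms in \<open>auto simp: inner_edges_def\<close>)

lemma cylinder_outer: "finite Z \<Longrightarrow> cylinder (outer v k Z Y)"
  unfolding outer_def by (rule cylinder_connects) auto

lemma connects_imp_outer:
  assumes "v \<in> V" "\<eta> \<subseteq> E" "connects Z X Y \<eta>" "X \<subseteq> gball v (Suc k)" "Y \<subseteq> V - gball v k"
  shows "outer v k Z Y \<eta>"
proof -
  obtain x y where xy: "x \<in> X" "y \<in> Y" "joined_in \<eta> Z x y" using assms(3) by (auto elim: connectsE)
  obtain s where "s \<in> gsphere v (Suc k)" "joined_in \<eta> (Z - gball v k) y s"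
    by (rule joined_to_sphere[OF assms(1,2) joined_in_sym[OF xy(3)]]) (use xy assms in auto)
  then show ?thesis unfolding outer_def using xy by (intro connectsI) auto
qed

lemma connects_sphere_iff_outer:
  assumes "v \<in> V" "\<eta> \<subseteq> E" "Y \<subseteq> V - gball v k"
  shows "connects Z Y (gsphere v (Suc k)) \<eta> \<longleftrightarrow> outer v k Z Y \<eta>"
proof
  assume "connects Z Y (gsphere v (Suc k)) \<eta>"
  then have "connects Z (gsphere v (Suc k)) Y \<eta>" by (simp add: connects_sym)
  then show "outer v k Z Y \<eta>"
    by (rule connects_imp_outer[OF assms(1,2)]) (use assms in \<open>auto simp: in_gball in_gsphere\<close>)
next
  assume "outer v k Z Y \<eta>"
  then show "connects Z Y (gsphere v (Suc k)) \<eta>" unfolding outer_def by (rule connects_mono) auto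
qed

lemma touching_inner_disjoint: "touching_edges U \<inter> inner_edges (V - U) \<inter> E = {}"
  by (auto simp: touching_edges_def inner_edges_def)

text \<open>\<open>B\<close> and \<open>outer\<close> are independent, while quasi-multiplicativity
  bounds the probability of the connection below by \<open>c\<close> times exit probability times
  probability of \<open>outer\<close>. Thus an event small relative to the exit is small given the
  connection, at the price of \<open>1 / c\<close>, uniformly in the target.\<close>

lemma negligible_given_connection:
  assumes qm: "quasi_multiplicative V E v c p" and c: "c > 0" and p: "p \<in> {0..1}" and v: "v \<in> V"
    and m: "m > 0" "Suc k = 2 * m" and w: "w \<in> gball v m"
    and Z: "finite Z" "Z \<subseteq> V" "connected_set E Z" "gball v (4 * m) \<subseteq> Z" and Y: "Y \<subseteq> Z - gball v (4 * m)"
    and B: "cylinder B" "determined_by (touching_edges (gball v k)) B"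
    and small: "perc_prob p B \<le> \<epsilon> * perc_prob p (exits (gball v k) w)"
  shows "perc_prob p (\<lambda>\<eta>. B \<eta> \<and> outer v k Z Y \<eta>) \<le> \<epsilon> / c * perc_prob p (connects Z {w} Y)"
proof -
  have wk: "w \<in> gball v k" using w m by (auto simp: in_gball)
  have Yk: "Y \<subseteq> V - gball v k" using Y Z m by (auto simp: in_gball)
  have Zk: "gball v (Suc k) \<subseteq> Z" using Z(4) gball_mono[of "Suc k" "4 * m" v] m by auto
  have e1: "perc_prob p (connects Z {w} (gsphere v (2 * m))) = perc_prob p (exits (gball v k) w)"
    using connects_sphere_iff_exits[OF v _ Zk Z(2) wk] m by (intro perc_prob_cong) auto
  have e2: "perc_prob p (connects Z Y (gsphere v (2 * m))) = perc_prob p (outer v k Z Y)"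
    using connects_sphere_iff_outer[OF v _ Yk] m by (intro perc_prob_cong) auto
  have qm': "c * perc_prob p (exits (gball v k) w) * perc_prob p (outer v k Z Y) \<le> perc_prob p (connects Z {w} Y)"
    unfolding e1[symmetric] e2[symmetric]
  proof (rule quasi_multiplicativeD[OF qm m(1) Z(2,1,3)])
    show "graph_annulus V E v m (4 * m) \<subseteq> Z" using Z by (auto simp: graph_annulus_def)
    show "{w} \<subseteq> Z \<inter> gball v m" using w Z(4) gball_mono[of m "4 * m" v] by auto
  qed (rule Y)
  have "perc_prob p (\<lambda>\<eta>. B \<eta> \<and> outer v k Z Y \<eta>) = perc_prob p B * perc_prob p (outer v k Z Y)"
    by (rule perc_prob_indep[OF p B cylinder_outer[OF Z(1)] determined_outer[OF Z(2)] touching_inner_disjoint])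
  also have "\<dots> \<le> \<epsilon> * perc_prob p (exits (gball v k) w) * perc_prob p (outer v k Z Y)"
    using small by (intro mult_right_mono) auto
  finally have le: "perc_prob p (\<lambda>\<eta>. B \<eta> \<and> outer v k Z Y \<eta>) \<le> \<epsilon> * (perc_prob p (exits (gball v k) w) * perc_prob p (outer v k Z Y))"
    by (simp add: mult.assoc)
  show ?thesis
  proof (cases "\<epsilon> \<ge> 0")
    case True
    have "perc_prob p (exits (gball v k) w) * perc_prob p (outer v k Z Y) \<le> perc_prob p (connects Z {w} Y) / c"
      using qm' c by (simp add: field_simps)
    from mult_left_mono[OF this True] le show ?thesis by simp
  next
    case False
    \<comment> \<open>A negative \<epsilon> forces the exit probability, and with it the probability
      of the connection, to be 0; both sides then vanish.\<close>
    then have "\<epsilon> * perc_prob p (exits (gball v k) w) \<ge> 0"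
      using small perc_prob_nonneg[of p B] by linarith
    with False have "perc_prob p (exits (gball v k) w) \<le> 0" by (simp add: zero_le_mult_iff)
    then have "perc_prob p B \<le> 0" "perc_prob p (exits (gball v k) w) = 0"
      using small perc_prob_nonneg[of p "exits (gball v k) w"] by auto
    moreover have "perc_prob p (connects Z {w} Y) \<le> perc_prob p (exits (gball v k) w)"
    proof (rule perc_prob_mono)
      fix \<eta> assume "connects Z {w} Y \<eta>"
      then obtain y where "y \<in> Y" "joined_in \<eta> Z w y" by (auto elim: connectsE)
      then show "exits (gball v k) w \<eta>" using wk Yk Z by (intro exitsI[of \<eta> Z w y]) auto
    qed (use cylinder_exits[OF finite_gball[OF v]] in auto)
    ultimately show ?thesis
      using le perc_prob_nonneg[of p "connects Z {w} Y"] by simp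
  qed
qed

section \<open>One-endedness\<close>

text \<open>Disjoint sets \<open>K\<close> have disjoint sets of such edges, which makes crossings
  of different ends independent.\<close>

definition end_edges :: "'a \<Rightarrow> 'a set \<Rightarrow> nat \<Rightarrow> 'a set set" where
  "end_edges v K k = {e \<in> E. e \<subseteq> K \<and> e \<inter> gball v k \<noteq> {}}"

definition end_crossing :: "'a \<Rightarrow> nat \<Rightarrow> 'a set \<Rightarrow> nat \<Rightarrow> 'a set set \<Rightarrow> bool" where
  "end_crossing v R K k \<eta> \<longleftrightarrow> (\<exists>s\<in>K \<inter> gsphere v (Suc R). \<exists>a\<in>K \<inter> gball v k. \<exists>b\<in>K - gball v k.
     joined_in \<eta> (K \<inter> gball v k) s a \<and> {a, b} \<in> \<eta>)"

definition end_annulus :: "'a \<Rightarrow> 'a set \<Rightarrow> nat \<Rightarrow> nat \<Rightarrow> 'a set set \<Rightarrow> bool" where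
  "end_annulus v K k l = connects (K \<inter> gball v (Suc l) - gball v k) (gsphere v (Suc k)) (gsphere v (Suc l))"

text \<open>An infinite union of components of the complement of the ball. Connectedness is not
  asked for: the arguments use that an edge can leave \<open>K\<close> only into the ball.\<close>

definition end_component :: "'a \<Rightarrow> nat \<Rightarrow> 'a set \<Rightarrow> bool" where
  "end_component v R K \<longleftrightarrow> infinite K \<and> K \<subseteq> V - gball v R \<and>
     (\<forall>a\<in>K. \<forall>b. {a, b} \<in> E \<longrightarrow> b \<in> K \<or> b \<in> gball v R)"

lemma determined_end_crossing: "determined_by (end_edges v K k) (end_crossing v R K k)"
  unfolding end_crossing_def
proof (intro determined_by_bex determined_by_conj)
  show "determined_by (end_edges v K k) (\<lambda>\<eta>. joined_in \<eta> (K \<inter> gball v k) s a)" for s a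
  proof (rule determined_by_mono[OF determined_joined_in])
    show "inner_edges (K \<inter> gball v k) \<inter> E \<subseteq> end_edges v K k"
    proof
      fix e assume "e \<in> inner_edges (K \<inter> gball v k) \<inter> E"
      then show "e \<in> end_edges v K k"
        using edges[of e] by (auto simp: inner_edges_def end_edges_def)
    qed
  qed
  show "determined_by (end_edges v K k) (\<lambda>\<eta>. {a, b} \<in> \<eta>)" if "a \<in> K \<inter> gball v k" "b \<in> K - gball v k" for a b
    by (rule determined_edge) (use that in \<open>auto simp: end_edges_def\<close>)
qed

lemma cylinder_end_crossing:
  assumes v: "v \<in> V"
  shows "cylinder (end_crossing v R K k)"
  by (rule cylinder_touching[OF finite_gball[OF v, of k] determined_by_mono[OF determined_end_crossing]])
    (auto simp: end_edges_def touching_edges_def)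

lemma cylinder_end_annulus:
  assumes v: "v \<in> V"
  shows "cylinder (end_annulus v K k l)"
  unfolding end_annulus_def by (rule cylinder_connects) (use finite_gball[OF v] in auto)

lemma end_crossingI:
  assumes "joined_in \<eta> K s x" "s \<in> gsphere v (Suc R)" "x \<notin> gball v k" "Suc R \<le> k"
  shows "end_crossing v R K k \<eta>"
proof -
  have s: "s \<in> gball v k" using assms by (auto simp: in_gball in_gsphere)
  obtain a b where ab: "joined_in \<eta> (K \<inter> gball v k) s a" "b \<in> K - gball v k" "{a, b} \<in> \<eta>"
    using joined_in_first_exit[OF assms(1) s assms(3)] by metis
  with assms joined_in_mem[OF ab(1)] show ?thesis unfolding end_crossing_def by blast
qed

text \<open>The piece up to the first exit from the ball of radius \<open>k\<close> and the piece
  after the last exit use disjoint sets of edges, so the two conclusions are independent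
  events.\<close>

lemma end_crossing_split:
  assumes v: "v \<in> V" and K: "end_component v R K" and \<eta>: "\<eta> \<subseteq> E" and kl: "Suc R \<le> k" "k < l"
    and cr: "end_crossing v R K l \<eta>"
  shows "end_crossing v R K k \<eta>" "end_annulus v K k l \<eta>"
proof -
  obtain s a0 b0 where sab: "s \<in> K \<inter> gsphere v (Suc R)" "a0 \<in> K \<inter> gball v l" "b0 \<in> K - gball v l"
    "joined_in \<eta> (K \<inter> gball v l) s a0" "{a0, b0} \<in> \<eta>"
    using cr unfolding end_crossing_def by blast
  have "gdist v b0 \<le> Suc (gdist v a0)" using sab \<eta> by (intro gdist_edge[OF v]) auto
  then have b0: "b0 \<in> gsphere v (Suc l)" using sab K by (auto simp: in_gball in_gsphere end_component_def)
  have "joined_in \<eta> (K \<inter> gball v (Suc l)) s a0"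
    by (rule joined_in_mono[OF sab(4)]) (use gball_mono[of l "Suc l" v] in auto)
  then have j: "joined_in \<eta> (K \<inter> gball v (Suc l)) s b0"
    by (rule joined_in_step) (use sab b0 in \<open>auto simp: in_gball in_gsphere\<close>)
  then have "joined_in \<eta> K s b0" by (rule joined_in_mono) auto
  moreover have b0k: "b0 \<notin> gball v k" using b0 kl by (auto simp: in_gball in_gsphere)
  ultimately show "end_crossing v R K k \<eta>" using sab kl by (intro end_crossingI[of \<eta> K s b0]) auto
  have s: "s \<in> gball v k" using sab kl by (auto simp: in_gball in_gsphere)
  obtain a b where ab: "a \<in> (K \<inter> gball v (Suc l)) \<inter> gball v k" "b \<in> K \<inter> gball v (Suc l) - gball v k" "{a, b} \<in> \<eta>"
    "joined_in \<eta> (K \<inter> gball v (Suc l) - gball v k) b b0"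
    using joined_in_last_exit[OF j s b0k] by metis
  have "gdist v b \<le> Suc (gdist v a)" using ab \<eta> by (intro gdist_edge[OF v]) auto
  then have "b \<in> gsphere v (Suc k)" using ab by (auto simp: in_gball in_gsphere)
  with ab b0 show "end_annulus v K k l \<eta>" unfolding end_annulus_def by (intro connectsI) auto
qed

lemma end_crossing_prob_split:
  assumes v: "v \<in> V" and K: "end_component v R K" and p: "p \<in> {0..1}" and kl: "Suc R \<le> k" "k < l"
  shows "perc_prob p (end_crossing v R K l) \<le> perc_prob p (end_crossing v R K k) * perc_prob p (end_annulus v K k l)"
proof -
  have "perc_prob p (end_crossing v R K l) \<le> perc_prob p (\<lambda>\<eta>. end_crossing v R K k \<eta> \<and> end_annulus v K k l \<eta>)"
    using end_crossing_split[OF v K _ kl]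
    by (intro perc_prob_mono cylinder_imp_perc_event cylinder_conj cylinder_end_crossing cylinder_end_annulus v) auto
  also have "\<dots> = perc_prob p (end_crossing v R K k) * perc_prob p (end_annulus v K k l)"
  proof (rule perc_prob_indep[OF p cylinder_end_crossing[OF v] determined_end_crossing cylinder_end_annulus[OF v]])
    show "determined_by (inner_edges (V - gball v k)) (end_annulus v K k l)"
      unfolding end_annulus_def
      by (rule determined_by_mono[OF determined_connects]) (use K in \<open>auto simp: inner_edges_def end_component_def\<close>)
  qed (auto simp: end_edges_def inner_edges_def)
  finally show ?thesis .
qed

text \<open>Walking from \<open>x\<close> back along a geodesic towards \<open>v\<close> stays in
  \<open>K\<close> down to the sphere of radius \<open>Suc R\<close>, since \<open>K\<close> can be
  left only into the ball.\<close>

lemma end_component_descend: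
  assumes v: "v \<in> V" and K: "end_component v R K"
  shows "x \<in> K \<Longrightarrow> gdist v x = Suc R + n \<Longrightarrow>
    \<exists>F\<subseteq>E. finite F \<and> card F \<le> n \<and> (\<exists>s\<in>K \<inter> gsphere v (Suc R). \<forall>\<eta>. F \<subseteq> \<eta> \<longrightarrow> joined_in \<eta> K s x)"
proof (induction n arbitrary: x)
  case 0
  then show ?case using K by (intro exI[of _ "{}"] conjI bexI[of _ x]) (auto simp: end_component_def in_gsphere)
next
  case (Suc n)
  have "x \<in> V" using Suc K by (auto simp: end_component_def)
  then obtain y where y: "y \<in> V" "{y, x} \<in> E" "gdist v y = Suc R + n"
    using gdist_pred[OF v, of x "Suc R + n"] Suc by auto
  have "{x, y} \<in> E" using y(2) by (simp add: insert_commute)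
  then have "y \<in> K \<or> y \<in> gball v R"
    using K Suc.prems(1) unfolding end_component_def by blast
  then have "y \<in> K" using y by (auto simp: in_gball)
  then obtain F s where F: "F \<subseteq> E" "finite F" "card F \<le> n" "s \<in> K \<inter> gsphere v (Suc R)"
    "\<And>\<eta>. F \<subseteq> \<eta> \<Longrightarrow> joined_in \<eta> K s y"
    using Suc.IH[OF _ y(3)] by metis
  have "joined_in \<eta> K s x" if "insert {y, x} F \<subseteq> \<eta>" for \<eta>
    using F(5)[of \<eta>] that Suc.prems(1) by (auto intro: joined_in_step)
  then show ?case
    using F y card_insert_le_m1[of "Suc n" F "{y, x}"]
    by (intro exI[of _ "insert {y, x} F"]) auto
qed

lemma end_component_sphere:
  assumes v: "v \<in> V" and K: "end_component v R K" and n: "Suc R \<le> n"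
  shows "\<exists>x\<in>K. gdist v x = n"
proof -
  have "\<exists>y\<in>K. gdist v y = n" if "x \<in> K" "n \<le> gdist v x" for x
    using that
  proof (induction "gdist v x" arbitrary: x)
    case 0
    then show ?case using n by simp
  next
    case (Suc d)
    show ?case
    proof (cases "n = Suc d")
      case True
      then show ?thesis using Suc by auto
    next
      case False
      have "x \<in> V" using Suc K by (auto simp: end_component_def)
      then obtain y where y: "y \<in> V" "{y, x} \<in> E" "gdist v y = d"
        using gdist_pred[OF v, of x d] Suc by auto
      have "n \<le> d" using False Suc by simp
      have "{x, y} \<in> E" using y(2) by (simp add: insert_commute)
      then have "y \<in> K \<or> y \<in> gball v R"
        using K Suc.prems(1) unfolding end_component_def by blast
      then have "y \<in> K" using \<open>n \<le> d\<close> n y by (auto simp: in_gball)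
      then show ?thesis using Suc(1)[of y] y \<open>n \<le> d\<close> by auto
    qed
  qed
  moreover obtain x where "x \<in> K" "n < gdist v x"
    using unbounded_dist[OF v, of K n] K by (auto simp: end_component_def)
  ultimately show ?thesis by auto
qed

text \<open>It suffices to open one geodesic. This merely exponential lower bound is what faster
  decay will contradict.\<close>

lemma end_crossing_prob_ge:
  assumes v: "v \<in> V" and K: "end_component v R K" and p: "p \<in> {0..1}" and k: "Suc R \<le> k"
  shows "p ^ Suc k \<le> perc_prob p (end_crossing v R K k)"
proof -
  obtain x where x: "x \<in> K" "gdist v x = Suc k" using end_component_sphere[OF v K, of "Suc k"] k by auto
  then obtain F s where F: "F \<subseteq> E" "finite F" "card F \<le> k - R" "s \<in> K \<inter> gsphere v (Suc R)"
    "\<And>\<eta>. F \<subseteq> \<eta> \<Longrightarrow> joined_in \<eta> K s x"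
    using end_component_descend[OF v K x(1), of "k - R"] k by auto
  have "p ^ Suc k \<le> p ^ card F" using F(3) p by (intro power_decreasing) auto
  also have "\<dots> = perc_prob p (\<lambda>\<eta>. F \<subseteq> \<eta>)" using perc_prob_all_open[OF F(2,1) p] by simp
  also have "\<dots> \<le> perc_prob p (end_crossing v R K k)"
    by (intro perc_prob_mono cylinder_imp_perc_event cylinder_end_crossing v end_crossingI[OF F(5)])
      (use F x k in \<open>auto simp: in_gball\<close>)
  finally show ?thesis .
qed

text \<open>Quasi-multiplicativity is applied to \<open>X\<close> in one end at radius
  \<open>m\<close> and \<open>Y\<close> in the other end beyond \<open>4 * m\<close>. A path between
  them passes through the ball of radius \<open>R\<close>, so it crosses both ends inside radius
  \<open>k\<close>, and it also links the sphere of radius \<open>2 * m\<close> to \<open>Y\<close>.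
  The probability of that link appears on both sides and cancels.\<close>

lemma end_annulus_prob_le:
  assumes v: "v \<in> V" and p: "0 < p" "p \<le> 1" and qm: "quasi_multiplicative V E v c p" and c: "c > 0"
    and K: "end_component v R K1" "end_component v R K2" "K1 \<inter> K2 = {}"
    and m: "R + 2 \<le> m" "Suc k = m" "Suc l = 2 * m"
  shows "c * perc_prob p (end_annulus v K1 k l) \<le> perc_prob p (end_crossing v R K1 k) * perc_prob p (end_crossing v R K2 k)"
proof -
  have pI: "p \<in> {0..1}" using p by simp
  \<comment> \<open>One more than \<open>4 * m\<close>, because \<open>Y\<close> must lie outside
    the ball of radius \<open>4 * m\<close>.\<close>
  define Z where "Z = gball v (Suc (4 * m))"
  define X where "X = K1 \<inter> gsphere v m"
  define Y where "Y = K2 \<inter> gsphere v (Suc (4 * m))"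
  have Z: "finite Z" "Z \<subseteq> V" "connected_set E Z"
    unfolding Z_def by (rule finite_gball[OF v] gball_subset_V connected_gball[OF v])+
  have XZ: "X \<subseteq> Z \<inter> gball v m" and YZ: "Y \<subseteq> Z - gball v (4 * m)"
    by (auto simp: X_def Y_def Z_def in_gball in_gsphere)
  have AZ: "graph_annulus V E v m (4 * m) \<subseteq> Z" by (auto simp: graph_annulus_def Z_def in_gball)
  have Yl: "Y \<subseteq> V - gball v l" using m by (auto simp: Y_def in_gball in_gsphere)
  have Xl: "X \<subseteq> gball v (Suc l)" using m by (auto simp: X_def in_gball in_gsphere)
  let ?o = "outer v l Z Y"
  let ?g = "\<lambda>K. end_crossing v R K k"
  \<comment> \<open>The path leaves \<open>K\<close> for the first time from a vertex of the sphere
    of radius \<open>Suc R\<close>; the piece up to there, reversed, is a crossing.\<close>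
  have cross: "?g K \<eta>" if K: "end_component v R K" and \<eta>: "\<eta> \<subseteq> E" and j: "joined_in \<eta> Z x y"
    and x: "x \<in> K" "x \<notin> gball v k" and y: "y \<notin> K" for K \<eta> x y
  proof -
    obtain a b where ab: "joined_in \<eta> (Z \<inter> K) x a" "b \<in> Z - K" "{a, b} \<in> \<eta>"
      using joined_in_first_exit[OF j x(1) y] by metis
    have a: "a \<in> K" using joined_in_mem[OF ab(1)] by simp
    have "b \<in> gball v R" using K ab a \<eta> by (auto simp: end_component_def)
    moreover have "gdist v a \<le> Suc (gdist v b)" using ab \<eta> by (intro gdist_edge[OF v]) (auto simp: insert_commute)
    ultimately have "a \<in> gsphere v (Suc R)" using a K by (auto simp: end_component_def in_gball in_gsphere)
    moreover have "joined_in \<eta> K a x" using joined_in_sym[OF ab(1)] by (rule joined_in_mono) auto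
    ultimately show ?thesis using x m by (intro end_crossingI[of \<eta> K a x]) auto
  qed
  have "perc_prob p (connects Z X Y) \<le> perc_prob p (\<lambda>\<eta>. (?g K1 \<eta> \<and> ?g K2 \<eta>) \<and> ?o \<eta>)"
  proof (rule perc_prob_mono)
    show "perc_event (\<lambda>\<eta>. (?g K1 \<eta> \<and> ?g K2 \<eta>) \<and> ?o \<eta>)"
      by (intro cylinder_imp_perc_event cylinder_conj cylinder_end_crossing cylinder_outer v Z)
    fix \<eta> assume \<eta>: "\<eta> \<subseteq> E" "connects Z X Y \<eta>"
    then obtain x y where xy: "x \<in> X" "y \<in> Y" "joined_in \<eta> Z x y" by (auto elim: connectsE)
    have "?g K1 \<eta>" by (rule cross[OF K(1) \<eta>(1) xy(3)]) (use xy m K(3) in \<open>auto simp: X_def Y_def in_gball in_gsphere\<close>)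
    moreover have "?g K2 \<eta>"
      by (rule cross[OF K(2) \<eta>(1) joined_in_sym[OF xy(3)]]) (use xy m K(3) in \<open>auto simp: X_def Y_def in_gball in_gsphere\<close>)
    moreover have "?o \<eta>" by (rule connects_imp_outer[OF v \<eta> Xl Yl])
    ultimately show "(?g K1 \<eta> \<and> ?g K2 \<eta>) \<and> ?o \<eta>" by simp
  qed
  also have "\<dots> = perc_prob p (\<lambda>\<eta>. ?g K1 \<eta> \<and> ?g K2 \<eta>) * perc_prob p ?o"
  proof (rule perc_prob_indep[OF pI _ _ cylinder_outer[OF Z(1)] determined_outer[OF Z(2)] touching_inner_disjoint])
    show "determined_by (touching_edges (gball v l)) (\<lambda>\<eta>. ?g K1 \<eta> \<and> ?g K2 \<eta>)"
      by (intro determined_by_conj determined_by_mono[OF determined_end_crossing])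
        (use gball_mono[of k l v] m in \<open>auto simp: end_edges_def touching_edges_def\<close>)
    show "cylinder (\<lambda>\<eta>. ?g K1 \<eta> \<and> ?g K2 \<eta>)"
      by (intro cylinder_conj cylinder_end_crossing v)
  qed
  also have "perc_prob p (\<lambda>\<eta>. ?g K1 \<eta> \<and> ?g K2 \<eta>) = perc_prob p (?g K1) * perc_prob p (?g K2)"
  proof (rule perc_prob_indep[OF pI cylinder_end_crossing[OF v] determined_end_crossing
        cylinder_end_crossing[OF v] determined_end_crossing])
    show "end_edges v K1 k \<inter> end_edges v K2 k \<inter> E = {}"
      using K(3) by (auto simp: end_edges_def)
  qed
  finally have upper: "perc_prob p (connects Z X Y) \<le> perc_prob p (?g K1) * perc_prob p (?g K2) * perc_prob p ?o" .
  have lower: "c * perc_prob p (connects Z X (gsphere v (2 * m))) * perc_prob p (connects Z Y (gsphere v (2 * m)))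
      \<le> perc_prob p (connects Z X Y)"
    by (rule quasi_multiplicativeD[OF qm _ Z(2,1,3) AZ XZ YZ]) (use m in simp)
  have eq: "perc_prob p (connects Z Y (gsphere v (2 * m))) = perc_prob p ?o"
    using connects_sphere_iff_outer[OF v _ Yl] m by (intro perc_prob_cong) auto
  have "perc_prob p (end_annulus v K1 k l) \<le> perc_prob p (connects Z X (gsphere v (2 * m)))"
  proof (rule perc_prob_mono)
    fix \<eta> assume "end_annulus v K1 k l \<eta>"
    then obtain x y where xy: "x \<in> gsphere v m" "y \<in> gsphere v (2 * m)" "joined_in \<eta> (K1 \<inter> gball v (Suc l) - gball v k) x y"
      unfolding end_annulus_def m by (auto elim: connectsE)
    have "joined_in \<eta> Z x y"
      by (rule joined_in_mono[OF xy(3)]) (use m gball_mono[of "Suc l" "Suc (4 * m)" v] in \<open>auto simp: Z_def\<close>)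
    then show "connects Z X (gsphere v (2 * m)) \<eta>"
      using xy joined_in_mem[OF xy(3)] by (intro connectsI) (auto simp: X_def)
  qed (use cylinder_connects[OF Z(1)] in auto)
  then have "c * perc_prob p (end_annulus v K1 k l) * perc_prob p ?o
      \<le> c * perc_prob p (connects Z X (gsphere v (2 * m))) * perc_prob p ?o"
    using c by (intro mult_right_mono mult_left_mono) auto
  also have "\<dots> \<le> perc_prob p (?g K1) * perc_prob p (?g K2) * perc_prob p ?o"
    using lower upper eq by simp
  finally have main: "c * perc_prob p (end_annulus v K1 k l) * perc_prob p ?o
      \<le> perc_prob p (?g K1) * perc_prob p (?g K2) * perc_prob p ?o" .
  \<comment> \<open>The common factor has to be positive before it can be cancelled; with all edges
    of \<open>Z\<close> open the link exists.\<close>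
  have "0 < p ^ card (inner_edges Z)" using p by simp
  also have "\<dots> = perc_prob p (\<lambda>\<eta>. inner_edges Z \<subseteq> \<eta>)"
    using perc_prob_all_open[OF finite_inner_edges[OF Z(1)] _ pI] by (auto simp: inner_edges_def)
  also have "\<dots> \<le> perc_prob p ?o"
  proof (rule perc_prob_mono)
    fix \<eta> assume \<eta>: "\<eta> \<subseteq> E" "inner_edges Z \<subseteq> \<eta>"
    obtain y where y: "y \<in> Y"
      using end_component_sphere[OF v K(2), of "Suc (4 * m)"] m K(2)
      by (auto simp: Y_def in_gsphere end_component_def)
    have "v \<in> Z" "y \<in> Z" using v y YZ gdist_0[OF v v] by (auto simp: Z_def in_gball)
    then have "joined_in E Z v y" using Z(3) by (auto simp: connected_set_def)
    then have "joined_in \<eta> Z v y" using \<eta>(2) by (rule joined_in_restrict_inner)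
    then have "connects Z {v} Y \<eta>" using y by (intro connectsI) auto
    then show "?o \<eta>"
      by (rule connects_imp_outer[OF v \<eta>(1)]) (use v gdist_0[OF v v] Yl in \<open>auto simp: in_gball\<close>)
  qed (use cylinder_outer[OF Z(1)] in auto)
  finally show ?thesis using main by (rule mult_right_le_imp_le[rotated])
qed

text \<open>If \<open>q m < 1\<close>, doubling \<open>j\<close> times gives at most
  \<open>q m ^ (3 ^ j)\<close>, whereas the lower bound is only exponential in \<open>2 ^ j\<close>.
  The quotient \<open>3 ^ j / 2 ^ j\<close> is unbounded, so the two collide.\<close>

lemma cubic_decay_bound:
  fixes q :: "nat \<Rightarrow> real"
  assumes rec: "\<And>m. m0 \<le> m \<Longrightarrow> q (2 * m) \<le> q m ^ 3" and low: "\<And>m. m0 \<le> m \<Longrightarrow> u ^ m \<le> C * q m"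
    and u: "0 < u" "u \<le> 1" and C: "C > 0" and m: "m0 \<le> m"
  shows "q m \<ge> 1"
proof (rule ccontr)
  assume "\<not> q m \<ge> 1"
  then have lt: "q m < 1" by simp
  have pos: "q n > 0" if "m0 \<le> n" for n
    using low[OF that] u C zero_less_power[of u n] by (metis less_le_trans zero_less_mult_pos)
  have iter: "q (2 ^ j * m) \<le> q m ^ (3 ^ j)" for j
  proof (induction j)
    case (Suc j)
    have ge: "m0 \<le> 2 ^ j * m" by (rule le_trans[OF m]) simp
    have "q (2 ^ Suc j * m) \<le> q (2 ^ j * m) ^ 3" using rec[OF ge] by (simp add: mult.assoc)
    also have "\<dots> \<le> (q m ^ (3 ^ j)) ^ 3" using Suc pos[OF ge] by (intro power_mono) auto
    finally show ?case by (simp add: power_mult[symmetric] mult.commute)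
  qed simp
  \<comment> \<open>Chosen so that \<open>C * \<delta> ^ (2 ^ j)\<close> is at most half of
    \<open>u ^ (2 ^ j * m)\<close> for every \<open>j\<close>.\<close>
  define \<delta> where "\<delta> = min 1 (1 / C) * u ^ m / 2"
  have um: "0 < u ^ m" using u by simp
  have \<delta>: "\<delta> > 0" using C um by (simp add: \<delta>_def)
  obtain M where M: "q m ^ M < \<delta>" using real_arch_pow_inv[OF \<delta> lt] by blast
  obtain j where "real M < (3 / 2) ^ j" using real_arch_pow[of "3/2" "real M"] by auto
  then have "real M * 2 ^ j < 3 ^ j" by (simp add: field_simps)
  then have "real (M * 2 ^ j) < real (3 ^ j)" by simp
  then have Mj: "M * 2 ^ j \<le> 3 ^ j" by linarith
  have ge: "m0 \<le> 2 ^ j * m" by (rule le_trans[OF m]) simp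
  have "u ^ (2 ^ j * m) \<le> C * q (2 ^ j * m)" by (rule low[OF ge])
  also have "\<dots> \<le> C * q m ^ (3 ^ j)" using iter[of j] C by simp
  also have "\<dots> \<le> C * q m ^ (M * 2 ^ j)"
    using Mj lt pos[OF m] C by (intro mult_left_mono power_decreasing) auto
  also have "\<dots> = C * (q m ^ M) ^ (2 ^ j)" by (simp add: power_mult)
  also have "\<dots> \<le> C * \<delta> ^ (2 ^ j)" using M C pos[OF m] by (intro mult_left_mono power_mono) auto
  also have "\<delta> ^ (2 ^ j) = (min 1 (1 / C) / 2) ^ (2 ^ j) * (u ^ m) ^ (2 ^ j)"
    by (simp add: \<delta>_def power_mult_distrib[symmetric])
  also have "(min 1 (1 / C) / 2) ^ (2 ^ j) \<le> (min 1 (1 / C) / 2) ^ 1"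
    using C by (intro power_decreasing) auto
  also have "(min 1 (1 / C) / 2) ^ 1 \<le> 1 / (2 * C)" by (simp add: min_def)
  finally have "u ^ (2 ^ j * m) \<le> C * (1 / (2 * C) * (u ^ m) ^ (2 ^ j))"
    using C um by (simp add: mult_left_mono mult_right_mono)
  also have "\<dots> = u ^ (2 ^ j * m) / 2" using C by (simp add: power_mult[symmetric] mult.commute)
  finally show False using u zero_less_power[of u "2 ^ j * m"] by linarith
qed

text \<open>The product \<open>H\<close> satisfies
  \<open>H (2 * n) \<le> H n * (H n / c)\<^sup>2\<close>: both annulus factors gained on doubling
  are at most \<open>H n / c\<close>. Hence \<open>H / c\<close> is at most cubed, and the preceding
  lemma leaves only \<open>H / c \<ge> 1\<close>.\<close>

lemma end_crossing_prob_bounded_below: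
  assumes v: "v \<in> V" and p: "0 < p" "p \<le> 1" and qm: "quasi_multiplicative V E v c p" and c: "c > 0"
    and K: "end_component v R K1" "end_component v R K2" "K1 \<inter> K2 = {}"
    and m: "R + 2 \<le> m"
  shows "c \<le> perc_prob p (end_crossing v R K1 (m - 1)) * perc_prob p (end_crossing v R K2 (m - 1))"
proof -
  have pI: "p \<in> {0..1}" using p by simp
  define H where "H m = perc_prob p (end_crossing v R K1 (m - 1)) * perc_prob p (end_crossing v R K2 (m - 1))" for m
  have "H m / c \<ge> 1"
  proof (rule cubic_decay_bound[where q = "\<lambda>m. H m / c" and u = "p\<^sup>2" and C = c])
    show "R + 2 \<le> m" by (rule m)
    fix n assume n: "R + 2 \<le> n"
    let ?g = "\<lambda>K. perc_prob p (end_crossing v R K (n - 1))"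
    let ?g' = "\<lambda>K. perc_prob p (end_crossing v R K (2 * n - 1))"
    let ?a = "\<lambda>K. perc_prob p (end_annulus v K (n - 1) (2 * n - 1))"
    have s: "?g' K \<le> ?g K * ?a K" if "end_component v R K" for K
      by (rule end_crossing_prob_split[OF v that pI]) (use n in auto)
    have a1: "?a K1 \<le> H n / c"
      using end_annulus_prob_le[OF v p qm c K n, of "n - 1" "2 * n - 1"] n c
      by (simp add: H_def field_simps)
    have a2: "?a K2 \<le> H n / c"
      using end_annulus_prob_le[OF v p qm c K(2,1) _ n, of "n - 1" "2 * n - 1"] n c K(3)
      by (simp add: H_def field_simps Int_commute)
    have "H (2 * n) \<le> (?g K1 * ?a K1) * (?g K2 * ?a K2)"
      unfolding H_def using s K by (intro mult_mono) auto
    also have "\<dots> = H n * (?a K1 * ?a K2)" by (simp add: H_def)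
    also have "\<dots> \<le> H n * ((H n / c) * (H n / c))"
      using a1 a2 c by (intro mult_left_mono mult_mono) (auto simp: H_def)
    finally have "H (2 * n) / c \<le> H n * ((H n / c) * (H n / c)) / c"
      using c by (intro divide_right_mono) auto
    also have "H n * ((H n / c) * (H n / c)) / c = (H n / c) ^ 3" by (simp add: power3_eq_cube)
    finally show "H (2 * n) / c \<le> (H n / c) ^ 3" .
    have "p ^ n \<le> ?g K" if "end_component v R K" for K
      using end_crossing_prob_ge[OF v that pI, of "n - 1"] n by simp
    then have "p ^ n * p ^ n \<le> H n" unfolding H_def using K p by (intro mult_mono) auto
    then show "(p\<^sup>2) ^ n \<le> c * (H n / c)"
      using c by (simp add: power2_eq_square power_mult_distrib)
  qed (use p c in \<open>auto simp: power_le_one\<close>)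
  then show ?thesis using c by (simp add: H_def)
qed

text \<open>Closing the finitely many edges that touch the ball of radius \<open>R\<close> has a
  fixed positive price for \<open>p < 1\<close> and separates the two ends. Their crossings then are
  exits of two different clusters, with probability at least \<open>b\<close> at every scale,
  against uniqueness.\<close>

lemma end_components_meet:
  assumes v: "v \<in> V" and p: "0 < p" "p < 1" and qm: "quasi_multiplicative V E v c p" and c: "c > 0"
    and uniq: "unique_infinite_cluster V E p"
    and K: "end_component v R K1" "end_component v R K2"
  shows "K1 \<inter> K2 \<noteq> {}"
proof
  assume dis: "K1 \<inter> K2 = {}"
  have pI: "p \<in> {0..1}" using p by simp
  let ?T = "touching_edges (gball v R)" and ?S = "gsphere v (Suc R)"
  define b where "b = (1 - p) ^ card ?T * c"
  have bpos: "b > 0" unfolding b_def using p c by simp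
  have finT: "finite ?T" by (rule finite_touching_edges[OF finite_gball[OF v]])
  have TE: "?T \<subseteq> E" by (auto simp: touching_edges_def)
  have bound: "b \<le> (\<Sum>x\<in>?S. \<Sum>y\<in>?S. perc_prob p (split_exit (gball v k) x y))" if k: "Suc R \<le> k" for k
  proof -
    let ?g = "\<lambda>K. end_crossing v R K k"
    have cT: "cylinder (\<lambda>\<eta>. ?T \<inter> \<eta> = {})" by (rule cylinderI[OF TE finT determined_by_closed])
    have "c \<le> perc_prob p (?g K1) * perc_prob p (?g K2)"
      using end_crossing_prob_bounded_below[OF v p(1) _ qm c K dis, of "Suc k"] p k by simp
    then have "b \<le> (1 - p) ^ card ?T * (perc_prob p (?g K1) * perc_prob p (?g K2))"
      unfolding b_def using p by (intro mult_left_mono) auto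
    also have "perc_prob p (?g K1) * perc_prob p (?g K2) = perc_prob p (\<lambda>\<eta>. ?g K1 \<eta> \<and> ?g K2 \<eta>)"
    proof (rule perc_prob_indep[OF pI cylinder_end_crossing[OF v] determined_end_crossing
          cylinder_end_crossing[OF v] determined_end_crossing, symmetric])
      show "end_edges v K1 k \<inter> end_edges v K2 k \<inter> E = {}"
        using dis by (auto simp: end_edges_def)
    qed
    also have "(1 - p) ^ card ?T = perc_prob p (\<lambda>\<eta>. ?T \<inter> \<eta> = {})"
      by (rule perc_prob_all_closed[OF finT TE pI, symmetric])
    also have "perc_prob p (\<lambda>\<eta>. ?T \<inter> \<eta> = {}) * perc_prob p (\<lambda>\<eta>. ?g K1 \<eta> \<and> ?g K2 \<eta>)
        = perc_prob p (\<lambda>\<eta>. ?T \<inter> \<eta> = {} \<and> (?g K1 \<eta> \<and> ?g K2 \<eta>))"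
    proof (rule perc_prob_indep[OF pI cT determined_by_closed _ _ touching_inner_disjoint, symmetric])
      show "determined_by (inner_edges (V - gball v R)) (\<lambda>\<eta>. ?g K1 \<eta> \<and> ?g K2 \<eta>)"
        by (intro determined_by_conj determined_by_mono[OF determined_end_crossing])
          (use K in \<open>auto simp: end_edges_def inner_edges_def end_component_def\<close>)
      show "cylinder (\<lambda>\<eta>. ?g K1 \<eta> \<and> ?g K2 \<eta>)"
        by (intro cylinder_conj cylinder_end_crossing v)
    qed
    also have "\<dots> \<le> perc_prob p (\<lambda>\<eta>. \<exists>x\<in>?S. \<exists>y\<in>?S. split_exit (gball v k) x y \<eta>)"
    proof (rule perc_prob_mono)
      show "perc_event (\<lambda>\<eta>. \<exists>x\<in>?S. \<exists>y\<in>?S. split_exit (gball v k) x y \<eta>)"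
        by (intro cylinder_imp_perc_event cylinder_bex cylinder_split_exit finite_gsphere finite_gball v)
      fix \<eta> assume \<eta>: "\<eta> \<subseteq> E" "?T \<inter> \<eta> = {} \<and> (?g K1 \<eta> \<and> ?g K2 \<eta>)"
      have ex: "\<exists>s\<in>K \<inter> ?S. exits (gball v k) s \<eta>" if gK: "?g K \<eta>" and endK: "end_component v R K" for K
      proof -
        obtain s a b where sab: "s \<in> K \<inter> ?S" "a \<in> K \<inter> gball v k" "b \<in> K - gball v k"
          "joined_in \<eta> (K \<inter> gball v k) s a" "{a, b} \<in> \<eta>"
          using gK unfolding end_crossing_def by blast
        have "joined_in \<eta> (gball v k) s a" by (rule joined_in_mono[OF sab(4)]) auto
        then have "exits (gball v k) s \<eta>"
          unfolding exits_def using sab endK by (intro bexI[of _ a] bexI[of _ b]) (auto simp: end_component_def)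
        with sab show ?thesis by blast
      qed
      obtain x where x: "x \<in> K1" "x \<in> ?S" "exits (gball v k) x \<eta>" using ex[OF _ K(1)] \<eta>(2) by blast
      obtain y where y: "y \<in> K2" "y \<in> ?S" "exits (gball v k) y \<eta>" using ex[OF _ K(2)] \<eta>(2) by blast
      have "\<not> joined_in \<eta> (gball v k) x y"
      proof
        assume "joined_in \<eta> (gball v k) x y"
        moreover have "y \<notin> K1" using y dis by auto
        ultimately obtain a b where ab: "joined_in \<eta> (gball v k \<inter> K1) x a" "b \<in> gball v k - K1" "{a, b} \<in> \<eta>"
          using joined_in_first_exit[OF _ x(1)] by metis
        have "a \<in> K1" using joined_in_mem[OF ab(1)] by simp
        moreover have "{a, b} \<in> E" using ab(3) \<eta>(1) by blast
        ultimately have "b \<in> gball v R" using ab(2) K(1) unfolding end_component_def by blast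
        then have "{a, b} \<in> ?T" using ab \<eta> by (intro touching_doubleton) auto
        then show False using ab \<eta>(2) by blast
      qed
      with x y show "\<exists>x\<in>?S. \<exists>y\<in>?S. split_exit (gball v k) x y \<eta>" unfolding split_exit_def by blast
    qed
    also have "\<dots> \<le> (\<Sum>x\<in>?S. perc_prob p (\<lambda>\<eta>. \<exists>y\<in>?S. split_exit (gball v k) x y \<eta>))"
      by (intro perc_prob_Bex_le cylinder_bex cylinder_split_exit finite_gsphere finite_gball v)
    also have "\<dots> \<le> (\<Sum>x\<in>?S. \<Sum>y\<in>?S. perc_prob p (split_exit (gball v k) x y))"
      by (intro sum_mono perc_prob_Bex_le cylinder_split_exit finite_gsphere finite_gball v)
    finally show ?thesis .
  qed
  have "(\<lambda>k. \<Sum>x\<in>?S. \<Sum>y\<in>?S. perc_prob p (split_exit (gball v k) x y)) \<longlonglongrightarrow> (\<Sum>x\<in>?S. \<Sum>y\<in>?S. 0)"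
    by (intro tendsto_sum split_exit_prob_tendsto_0[OF v _ _ uniq]) (auto simp: in_gsphere)
  then have "b \<le> (\<Sum>x\<in>?S. \<Sum>y\<in>?S. 0::real)"
    by (rule LIMSEQ_le_const) (use bound in blast)
  then show False using bpos by simp
qed

lemma joined_in_eventually_gball:
  assumes "joined_in \<eta> Z x y" "Z \<subseteq> V"
  shows "\<forall>\<^sub>F N in sequentially. joined_in \<eta> (Z \<inter> gball v N) x y"
  using assms(1)
proof (induction rule: joined_in_induct)
  case refl
  have "x \<in> Z" using joined_in_mem[OF assms(1)] by simp
  then show ?case
    using assms(2) eventually_ge_at_top[of "gdist v x"] by (auto simp: in_gball elim!: eventually_mono)
next
  case (step y z)
  from step.IH eventually_ge_at_top[of "gdist v z"] show ?case
  proof eventually_elim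
    case (elim N)
    then show ?case using step.hyps assms(2) by (intro joined_in_step[OF elim(1)]) (auto simp: in_gball)
  qed
qed

text \<open>Infinite components of the complement of the ball meet, hence coincide. With
  \<open>m\<close> beyond all finite components the annulus lies in the infinite one, and joining
  its finitely many pairs takes only a bounded region. The conclusion is about the graph alone, so
  it may be used at other parameters.\<close>

lemma annulus_joined_outside_ball:
  assumes v: "v \<in> V" and p: "0 < p" "p < 1" and qm: "quasi_multiplicative V E v c p" and c: "c > 0"
    and uniq: "unique_infinite_cluster V E p"
  shows "\<exists>m>R. \<exists>N. \<forall>x\<in>graph_annulus V E v m (4 * m). \<forall>y\<in>graph_annulus V E v m (4 * m).
    joined_in E (gball v N - gball v R) x y"
proof -
  let ?W = "V - gball v R" and ?S = "gsphere v (Suc R)"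
  \<comment> \<open>Every component outside the ball meets the sphere of radius
    \<open>Suc R\<close>, so these finitely many \<open>K s\<close> exhaust them.\<close>
  define K where "K s = {y. joined_in E ?W s y}" for s
  have Kend: "end_component v R (K s)" if "infinite (K s)" for s
    unfolding end_component_def
  proof (intro conjI ballI allI impI)
    show "K s \<subseteq> ?W" unfolding K_def using joined_in_mem[of E ?W s] by auto
    fix a b assume "a \<in> K s" "{a, b} \<in> E"
    then show "b \<in> K s \<or> b \<in> gball v R"
      using edge_vertices[of a b] by (auto simp: K_def intro: joined_in_step)
  qed (rule that)
  have "\<forall>\<^sub>F m in sequentially. \<forall>s\<in>?S. finite (K s) \<longrightarrow> (\<forall>y\<in>K s. gdist v y < m)"
  proof (rule eventually_ball_finite[OF finite_gsphere[OF v]], rule ballI)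
    fix s
    show "\<forall>\<^sub>F m in sequentially. finite (K s) \<longrightarrow> (\<forall>y\<in>K s. gdist v y < m)"
    proof (cases "finite (K s)")
      case True
      then have "\<forall>\<^sub>F m in sequentially. \<forall>y\<in>K s. gdist v y < m"
        by (intro eventually_ball_finite ballI eventually_gt_at_top)
      then show ?thesis by (rule eventually_mono) simp
    qed simp
  qed
  then have "\<forall>\<^sub>F m in sequentially. (\<forall>s\<in>?S. finite (K s) \<longrightarrow> (\<forall>y\<in>K s. gdist v y < m)) \<and> R < m"
    by (intro eventually_conj eventually_gt_at_top)
  then obtain m where m: "R < m" "\<And>s y. s \<in> ?S \<Longrightarrow> finite (K s) \<Longrightarrow> y \<in> K s \<Longrightarrow> gdist v y < m"
    using eventually_happens'[OF sequentially_bot] by blast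
  let ?A = "graph_annulus V E v m (4 * m)"
  have A: "x \<in> V" "m \<le> gdist v x" if "x \<in> ?A" for x
    using that m by (auto simp: graph_annulus_def in_gball)
  have inf: "\<exists>s\<in>?S. x \<in> K s \<and> infinite (K s)" if xA: "x \<in> ?A" for x
  proof -
    have xW: "x \<in> ?W" using A[OF xA] m by (auto simp: in_gball)
    obtain s where s: "s \<in> ?S" "joined_in E (V - gball v R) x s"
      by (rule joined_to_sphere[OF v order_refl joined_in_V[OF _ v, of x] xW])
        (use A[OF xA] v gdist_0[OF v v] in \<open>auto simp: in_gball\<close>)
    then have "x \<in> K s" by (simp add: K_def joined_in_sym)
    with s m(2)[of s x] A[OF xA] show ?thesis by (intro bexI[of _ s]) auto
  qed
  have joined: "joined_in E ?W x y" if xy: "x \<in> ?A" "y \<in> ?A" for x y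
  proof -
    obtain s t where st: "x \<in> K s" "infinite (K s)" "y \<in> K t" "infinite (K t)"
      using inf xy by meson
    have "K s \<inter> K t \<noteq> {}"
      by (rule end_components_meet[OF v p qm c uniq Kend Kend]) (use st in auto)
    then obtain z where "z \<in> K s" "z \<in> K t" by blast
    with st show ?thesis unfolding K_def by (metis mem_Collect_eq joined_in_sym joined_in_trans)
  qed
  have finA: "finite ?A" using finite_gball[OF v] by (auto simp: graph_annulus_def)
  have "\<forall>\<^sub>F N in sequentially. \<forall>x\<in>?A. \<forall>y\<in>?A. joined_in E (?W \<inter> gball v N) x y"
    by (intro eventually_ball_finite finA ballI joined_in_eventually_gball joined) auto
  then obtain N where "\<forall>x\<in>?A. \<forall>y\<in>?A. joined_in E (?W \<inter> gball v N) x y"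
    using eventually_happens'[OF sequentially_bot] by blast
  moreover have "joined_in E (?W \<inter> gball v N) x y \<Longrightarrow> joined_in E (gball v N - gball v R) x y" for x y
    by (rule joined_in_mono) auto
  ultimately show ?thesis using m(1) by blast
qed

section \<open>A common minorant of the conditional laws\<close>

definition target :: "'a \<Rightarrow> nat \<Rightarrow> 'a set \<Rightarrow> 'a set \<Rightarrow> bool" where
  "target v r Z Y \<longleftrightarrow> finite Z \<and> Z \<subseteq> V \<and> connected_set E Z \<and> gball v r \<subseteq> Z \<and> Y \<subseteq> Z - gball v r \<and> Y \<noteq> {}"

text \<open>A connection from \<open>X\<close> to the sphere of radius \<open>Suc k\<close> that
  avoids the explored set \<open>U\<close>, written so that it reads only edges touching the ball
  and is independent of \<open>outer\<close>.\<close>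

definition inner_reach :: "'a \<Rightarrow> nat \<Rightarrow> 'a set \<Rightarrow> 'a set \<Rightarrow> 'a set set \<Rightarrow> bool" where
  "inner_reach v k U X \<eta> \<longleftrightarrow> (\<exists>x\<in>X. \<exists>a\<in>gball v k - U. \<exists>b\<in>gsphere v (Suc k).
     joined_in \<eta> (gball v k - U) x a \<and> {a, b} \<in> \<eta>)"

lemma target_gball: "v \<in> V \<Longrightarrow> target v r (gball v (Suc r)) (gsphere v (Suc r))"
  using finite_gball[of v "Suc r"] connected_gball[of v "Suc r"] gsphere_nonempty[of v "Suc r"] gball_mono[of r "Suc r" v]
  by (auto simp: target_def in_gball in_gsphere)

lemma cylinder_target: "target v r Z Y \<Longrightarrow> cylinder (connects Z {w} Y)"
  unfolding target_def by (auto intro: cylinder_connects)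

lemma target_prob_pos:
  assumes T: "target v r Z Y" and w: "w \<in> Z" and p: "0 < p" "p \<le> 1"
  shows "perc_prob p (connects Z {w} Y) > 0"
proof -
  have Z: "finite Z" "Z \<subseteq> V" "connected_set E Z" "Y \<subseteq> Z" "Y \<noteq> {}" using T by (auto simp: target_def)
  obtain y where y: "y \<in> Y" using Z by blast
  have "0 < p ^ card (inner_edges Z)" using p by simp
  also have "\<dots> = perc_prob p (\<lambda>\<eta>. inner_edges Z \<subseteq> \<eta>)"
    using perc_prob_all_open[OF finite_inner_edges[OF Z(1)], of p] p by (auto simp: inner_edges_def)
  also have "\<dots> \<le> perc_prob p (connects Z {w} Y)"
  proof (rule perc_prob_mono)
    fix \<eta> assume "inner_edges Z \<subseteq> \<eta>"
    moreover have "joined_in E Z w y" using Z w y by (auto simp: connected_set_def)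
    ultimately have "joined_in \<eta> Z w y" using joined_in_restrict_inner by blast
    then show "connects Z {w} Y \<eta>" using y by (intro connectsI) auto
  qed (use cylinder_target[OF T] in auto)
  finally show ?thesis .
qed

lemma determined_inner_reach:
  "determined_by (touching_edges (gball v k)) (inner_reach v k U X)"
  unfolding inner_reach_def
proof (intro determined_by_bex determined_by_conj)
  show "determined_by (touching_edges (gball v k)) (\<lambda>\<eta>. joined_in \<eta> (gball v k - U) x a)" for x a
    by (rule determined_by_mono[OF determined_joined_touching]) (auto simp: touching_edges_def)
  show "determined_by (touching_edges (gball v k)) (\<lambda>\<eta>. {a, b} \<in> \<eta>)" if "a \<in> gball v k - U" for a b
    by (rule determined_edge) (use that in \<open>auto intro: touching_doubleton\<close>)
qed

lemma connects_sphere_iff_inner_reach: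
  assumes v: "v \<in> V" and \<eta>: "\<eta> \<subseteq> E" and Z: "gball v (Suc k) \<subseteq> Z" "Z \<subseteq> V" and U: "U \<subseteq> gball v k"
    and X: "X \<subseteq> gball v k"
  shows "connects (Z - U) X (gsphere v (Suc k)) \<eta> \<longleftrightarrow> inner_reach v k U X \<eta>"
proof
  assume "connects (Z - U) X (gsphere v (Suc k)) \<eta>"
  then obtain x s where xs: "x \<in> X" "s \<in> gsphere v (Suc k)" "joined_in \<eta> (Z - U) x s" by (auto elim: connectsE)
  have x: "x \<in> gball v k" "s \<notin> gball v k" using xs X by (auto simp: in_gball in_gsphere)
  obtain a b where ab: "joined_in \<eta> ((Z - U) \<inter> gball v k) x a" "b \<in> Z - U - gball v k" "{a, b} \<in> \<eta>"
    using joined_in_first_exit[OF xs(3) x] by metis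
  have a: "a \<in> gball v k - U" using joined_in_mem[OF ab(1)] by simp
  have "joined_in \<eta> (gball v k - U) x a" by (rule joined_in_mono[OF ab(1)]) auto
  moreover have "gdist v b \<le> Suc (gdist v a)" using ab \<eta> by (intro gdist_edge[OF v]) auto
  then have "b \<in> gsphere v (Suc k)" using a ab(2) Z by (auto simp: in_gball in_gsphere)
  ultimately show "inner_reach v k U X \<eta>" unfolding inner_reach_def using xs a ab(3) by blast
next
  assume "inner_reach v k U X \<eta>"
  then obtain x a b where xab: "x \<in> X" "a \<in> gball v k - U" "b \<in> gsphere v (Suc k)"
    "joined_in \<eta> (gball v k - U) x a" "{a, b} \<in> \<eta>"
    unfolding inner_reach_def by blast
  have "joined_in \<eta> (Z - U) x a"
    by (rule joined_in_mono[OF xab(4)]) (use Z gball_mono[of k "Suc k" v] in auto)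
  then have "joined_in \<eta> (Z - U) x b"
    by (rule joined_in_step) (use xab Z U in \<open>auto simp: in_gball in_gsphere subset_iff\<close>)
  with xab show "connects (Z - U) X (gsphere v (Suc k)) \<eta>" by (intro connectsI) auto
qed

text \<open>\<open>U\<close> is an explored set and \<open>X\<close> the vertices at which it is
  left. The upper bound is independence across the sphere of radius \<open>2 * m2\<close>, the lower
  bound is quasi-multiplicativity in \<open>Z - U\<close>. The point is the separation of variables:
  the first factor does not involve the target, the second does not involve the explored
  set.\<close>

lemma outside_connection_factorises:
  assumes v: "v \<in> V" and p: "p \<in> {0..1}" and qm: "quasi_multiplicative V E v c p"
    and l: "Suc l = 2 * m2" and k: "Suc k \<le> m2" and T: "target v r' Z Y" "N \<le> r'" "4 * m2 \<le> r'"
    and ann: "\<And>x y. x \<in> graph_annulus V E v m2 (4 * m2) \<Longrightarrow> y \<in> graph_annulus V E v m2 (4 * m2) \<Longrightarrow>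
      joined_in E (gball v N - gball v k) x y"
    and U: "U \<subseteq> gball v k" and X: "X \<subseteq> gsphere v (Suc k)"
  shows "perc_prob p (connects (Z - U) X Y) \<le> perc_prob p (inner_reach v l U X) * perc_prob p (outer v l Z Y)"
    and "c * perc_prob p (inner_reach v l U X) * perc_prob p (outer v l Z Y) \<le> perc_prob p (connects (Z - U) X Y)"
proof -
  have Z: "finite Z" "Z \<subseteq> V" "connected_set E Z" "gball v r' \<subseteq> Z" "Y \<subseteq> Z - gball v r'"
    using T by (auto simp: target_def)
  have ZN: "gball v N \<subseteq> Z" and Z4: "gball v (4 * m2) \<subseteq> Z" and Zl: "gball v (Suc l) \<subseteq> Z"
    using Z(4) gball_mono[of N r' v] gball_mono[of "4 * m2" r' v] gball_mono[of "Suc l" r' v] T l by auto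
  have Y4: "Y \<subseteq> Z - gball v (4 * m2)" using Z(5) gball_mono[of "4 * m2" r' v] T by auto
  have Yl: "Y \<subseteq> V - gball v l" using Y4 Z l by (auto simp: in_gball)
  have Ul: "U \<subseteq> gball v l" using U gball_mono[of k l v] l k by auto
  have Xl: "X \<subseteq> gball v l" using X l k by (auto simp: in_gball in_gsphere)
  have out: "outer v l (Z - U) Y = outer v l Z Y"
  proof -
    have "Z - U - gball v l = Z - gball v l" using Ul by auto
    then show ?thesis by (simp add: outer_def)
  qed
  have ZU: "finite (Z - U)" "Z - U \<subseteq> V" using Z by auto
  have cr: "cylinder (inner_reach v l U X)" by (rule cylinder_touching[OF finite_gball[OF v] determined_inner_reach])
  have co: "cylinder (outer v l Z Y)" by (rule cylinder_outer[OF Z(1)])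
  have "perc_prob p (connects (Z - U) X Y) \<le> perc_prob p (\<lambda>\<eta>. inner_reach v l U X \<eta> \<and> outer v l Z Y \<eta>)"
  proof (rule perc_prob_mono)
    show "perc_event (\<lambda>\<eta>. inner_reach v l U X \<eta> \<and> outer v l Z Y \<eta>)" using cr co by auto
    fix \<eta> assume \<eta>: "\<eta> \<subseteq> E" "connects (Z - U) X Y \<eta>"
    have "outer v l (Z - U) Y \<eta>"
      by (rule connects_imp_outer[OF v \<eta> _ Yl]) (use Xl gball_mono[of l "Suc l" v] in auto)
    moreover obtain x y where xy: "x \<in> X" "y \<in> Y" "joined_in \<eta> (Z - U) x y" using \<eta>(2) by (auto elim: connectsE)
    have "x \<in> gball v l" "y \<notin> gball v l" using xy Xl Yl by auto
    then obtain a b where ab: "joined_in \<eta> ((Z - U) \<inter> gball v l) x a" "b \<in> Z - U - gball v l" "{a, b} \<in> \<eta>"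
      using joined_in_first_exit[OF xy(3)] by metis
    have a: "a \<in> gball v l - U" using joined_in_mem[OF ab(1)] by simp
    have "joined_in \<eta> (gball v l - U) x a" by (rule joined_in_mono[OF ab(1)]) auto
    moreover have "gdist v b \<le> Suc (gdist v a)" using ab \<eta> by (intro gdist_edge[OF v]) auto
    then have "b \<in> gsphere v (Suc l)" using a ab(2) Z by (auto simp: in_gball in_gsphere)
    ultimately show "inner_reach v l U X \<eta> \<and> outer v l Z Y \<eta>"
      unfolding inner_reach_def out using xy a ab(3) by blast
  qed
  also have "\<dots> = perc_prob p (inner_reach v l U X) * perc_prob p (outer v l Z Y)"
    by (rule perc_prob_indep[OF p cr determined_inner_reach co determined_outer[OF Z(2)] touching_inner_disjoint])
  finally show "perc_prob p (connects (Z - U) X Y) \<le> perc_prob p (inner_reach v l U X) * perc_prob p (outer v l Z Y)" .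
  have annZ: "graph_annulus V E v m2 (4 * m2) \<subseteq> Z - U"
    using Z4 U k by (fastforce simp: graph_annulus_def in_gball)
  have "c * perc_prob p (connects (Z - U) X (gsphere v (2 * m2))) * perc_prob p (connects (Z - U) Y (gsphere v (2 * m2)))
      \<le> perc_prob p (connects (Z - U) X Y)"
  proof (rule quasi_multiplicative_component[OF qm _ v ZU(2,1) annZ])
    show "0 < m2" using k by simp
    show "joined_in E (Z - U) x y" if "x \<in> graph_annulus V E v m2 (4 * m2)" "y \<in> graph_annulus V E v m2 (4 * m2)" for x y
      by (rule joined_in_mono[OF ann[OF that]]) (use ZN U in auto)
    show "X \<subseteq> (Z - U) \<inter> gball v m2"
      using X U k Z4 by (fastforce simp: in_gball in_gsphere)
    show "Y \<subseteq> Z - U - gball v (4 * m2)" using Y4 Ul Yl by auto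
    \<comment> \<open>\<open>Z\<close> is connected, so a graph path from \<open>y\<close> towards
      \<open>v\<close> reaches the sphere of radius \<open>2 * m2\<close> before it can meet
      \<open>U\<close>.\<close>
    fix y assume y: "y \<in> Y"
    have "v \<in> gball v (Suc l)" using v gdist_0[OF v v] by (simp add: in_gball)
    then have "joined_in E Z y v" using Z(3) y Z(5) Zl by (auto simp: connected_set_def)
    then obtain s where s: "s \<in> gsphere v (Suc l)" "joined_in E (Z - gball v l) y s"
      by (rule joined_to_sphere[OF v order_refl _ _ \<open>v \<in> gball v (Suc l)\<close>]) (use y Yl in auto)
    have "joined_in E (Z - U) s y" by (rule joined_in_mono[OF joined_in_sym[OF s(2)]]) (use Ul in auto)
    then show "\<exists>a\<in>graph_annulus V E v m2 (4 * m2). joined_in E (Z - U) a y"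
      using s(1) l sphere_subset_annulus[of m2 v] k by auto
  qed
  also have "perc_prob p (connects (Z - U) X (gsphere v (2 * m2))) = perc_prob p (inner_reach v l U X)"
    using connects_sphere_iff_inner_reach[OF v _ Zl Z(2) Ul Xl] l by (intro perc_prob_cong) auto
  also have "perc_prob p (connects (Z - U) Y (gsphere v (2 * m2))) = perc_prob p (outer v l Z Y)"
    using connects_sphere_iff_outer[OF v _ Yl] l out by (intro perc_prob_cong) auto
  finally show "c * perc_prob p (inner_reach v l U X) * perc_prob p (outer v l Z Y) \<le> perc_prob p (connects (Z - U) X Y)" .
qed

section \<open>Exploring outwards from a ball\<close>

definition ball_boundary :: "'a set \<Rightarrow> 'a set \<Rightarrow> 'a set set \<Rightarrow> 'a set" where
  "ball_boundary Q C \<eta> = {z \<in> V - Q. \<exists>a\<in>C. {a, z} \<in> \<eta>}"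

text \<open>The outer endpoints of open edges are recorded along with the explored clusters, because
  the continuation towards the target starts at these endpoints.\<close>

definition ball_state :: "'a \<Rightarrow> nat \<Rightarrow> nat \<Rightarrow> 'a set set \<Rightarrow> 'a set \<times> 'a set" where
  "ball_state v r k \<eta> = (explored (gball v k) (gball v r) \<eta>, ball_boundary (gball v k) (explored (gball v k) (gball v r) \<eta>) \<eta>)"

text \<open>Every open edge leaving the explored set starts in the cluster of \<open>w\<close>. Then
  a continuation from any boundary vertex is a continuation for \<open>w\<close>, and the state
  separates inside from outside.\<close>

definition good_state :: "'a \<Rightarrow> nat \<Rightarrow> nat \<Rightarrow> 'a \<Rightarrow> 'a set \<times> 'a set \<Rightarrow> 'a set set \<Rightarrow> bool" where
  "good_state v r k w i \<eta> \<longleftrightarrow> ball_state v r k \<eta> = i \<and> (\<forall>x\<in>snd i. \<exists>a\<in>fst i. joined_in \<eta> (fst i) w a \<and> {a, x} \<in> \<eta>)"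

lemma determined_ball_boundary:
  assumes "C \<subseteq> Q" "Q \<subseteq> V"
  shows "determined_by (touching_edges C) (\<lambda>\<eta>. ball_boundary Q C \<eta> = X)"
proof (rule determined_byI)
  fix \<eta> \<eta>' assume *: "\<eta> \<subseteq> E" "\<eta>' \<subseteq> E" "\<eta> \<inter> touching_edges C = \<eta>' \<inter> touching_edges C" "ball_boundary Q C \<eta> = X"
  have "{a, z} \<in> \<eta> \<longleftrightarrow> {a, z} \<in> \<eta>'" if "a \<in> C" for a z
    using *(1-3) touching_doubleton[of a z C] that by blast
  then show "ball_boundary Q C \<eta>' = X" using *(4) unfolding ball_boundary_def by auto
qed

lemma determined_good_state:
  assumes "fst i \<subseteq> gball v k"
  shows "determined_by (touching_edges (fst i)) (good_state v r k w i)"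
proof -
  have eq: "good_state v r k w i = (\<lambda>\<eta>. (explored (gball v k) (gball v r) \<eta> = fst i \<and> ball_boundary (gball v k) (fst i) \<eta> = snd i)
      \<and> (\<forall>x\<in>snd i. \<exists>a\<in>fst i. joined_in \<eta> (fst i) w a \<and> {a, x} \<in> \<eta>))"
    by (cases i) (auto simp: good_state_def ball_state_def fun_eq_iff)
  show ?thesis
    unfolding eq
    by (intro determined_by_conj determined_by_ball determined_by_bex determined_explored
        determined_ball_boundary assms gball_subset_V determined_joined_touching determined_edge)
      (auto intro: touching_doubleton)
qed

lemma cylinder_ball_state:
  assumes v: "v \<in> V"
  shows "cylinder (\<lambda>\<eta>. ball_state v r k \<eta> = i)"
proof (cases "fst i \<subseteq> gball v k")
  case True
  have eq: "(\<lambda>\<eta>. ball_state v r k \<eta> = i) = (\<lambda>\<eta>. explored (gball v k) (gball v r) \<eta> = fst i \<and> ball_boundary (gball v k) (fst i) \<eta> = snd i)"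
    by (cases i) (auto simp: ball_state_def fun_eq_iff)
  have "determined_by (touching_edges (fst i)) (\<lambda>\<eta>. ball_state v r k \<eta> = i)"
    unfolding eq by (intro determined_by_conj determined_explored determined_ball_boundary True gball_subset_V)
  moreover have "finite (fst i)" using True finite_gball[OF v] finite_subset by blast
  ultimately show ?thesis by (rule cylinder_touching[rotated])
next
  case False
  then have "ball_state v r k \<eta> \<noteq> i" for \<eta>
    using explored_subset[of "gball v k" "gball v r" \<eta>] by (auto simp: ball_state_def)
  then have "(\<lambda>\<eta>. ball_state v r k \<eta> = i) = (\<lambda>_. False)" by (simp add: fun_eq_iff)
  then show ?thesis by simp
qed

lemma ball_state_mem:
  assumes v: "v \<in> V" and \<eta>: "\<eta> \<subseteq> E"
  shows "ball_state v r k \<eta> \<in> Pow (gball v k) \<times> Pow (gsphere v (Suc k))"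
proof -
  let ?C = "explored (gball v k) (gball v r) \<eta>"
  have "ball_boundary (gball v k) ?C \<eta> \<subseteq> gsphere v (Suc k)"
  proof
    fix z assume "z \<in> ball_boundary (gball v k) ?C \<eta>"
    then obtain a where a: "z \<in> V - gball v k" "a \<in> ?C" "{a, z} \<in> \<eta>" by (auto simp: ball_boundary_def)
    have "a \<in> gball v k" by (rule subsetD[OF explored_subset a(2)])
    moreover have "gdist v z \<le> Suc (gdist v a)" using a \<eta> by (intro gdist_edge[OF v]) auto
    ultimately show "z \<in> gsphere v (Suc k)" using a(1) by (auto simp: in_gball in_gsphere)
  qed
  then show ?thesis by (simp add: ball_state_def explored_subset)
qed

lemma good_state_imp_connects:
  assumes "good_state v r k w i \<eta>" "connects (Z - fst i) (snd i) Y \<eta>" "fst i \<subseteq> Z"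
  shows "connects Z {w} Y \<eta>"
proof -
  obtain x y where xy: "x \<in> snd i" "y \<in> Y" "joined_in \<eta> (Z - fst i) x y" using assms(2) by (auto elim: connectsE)
  obtain a where a: "joined_in \<eta> (fst i) w a" "{a, x} \<in> \<eta>" using assms(1) xy(1) unfolding good_state_def by blast
  have "joined_in \<eta> Z w a" by (rule joined_in_mono[OF a(1)]) (use assms in auto)
  then have "joined_in \<eta> Z w x" by (rule joined_in_step) (use joined_in_mem[OF xy(3)] a in auto)
  moreover have "joined_in \<eta> Z x y" by (rule joined_in_mono[OF xy(3)]) auto
  ultimately have "joined_in \<eta> Z w y" by (rule joined_in_trans)
  with xy show ?thesis by (intro connectsI) auto
qed

text \<open>A boundary vertex is reached from some \<open>u\<close> in the small ball whose cluster
  exits. Since \<open>w\<close> exits too, the absence of a split exit puts \<open>u\<close> and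
  \<open>w\<close> into one cluster.\<close>

lemma connects_imp_good_state:
  assumes v: "v \<in> V" and \<eta>: "\<eta> \<subseteq> E" and Z: "Z \<subseteq> V" and w: "w \<in> gball v r" and r: "r \<le> k"
    and Y: "Y \<inter> gball v k = {}" and con: "connects Z {w} Y \<eta>"
    and no: "\<not> (\<exists>y\<in>gball v r. split_exit (gball v k) w y \<eta>)" and i: "ball_state v r k \<eta> = i"
  shows "good_state v r k w i \<eta> \<and> connects (Z - fst i) (snd i) Y \<eta>"
proof -
  let ?C = "explored (gball v k) (gball v r) \<eta>"
  have i': "fst i = ?C" "snd i = ball_boundary (gball v k) ?C \<eta>" using i by (auto simp: ball_state_def)
  obtain y where y: "y \<in> Y" "joined_in \<eta> Z w y" using con by (auto elim: connectsE)
  have wk: "w \<in> gball v k" using w r gball_mono by blast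
  have wC: "w \<in> ?C" by (rule explored_seed[OF w wk])
  have yC: "y \<notin> ?C" using y Y explored_subset[of "gball v k" "gball v r" \<eta>] by blast
  have exw: "exits (gball v k) w \<eta>" using y Y Z wk by (intro exitsI[of \<eta> Z w y]) auto
  obtain a b where ab: "a \<in> Z \<inter> ?C" "b \<in> Z - ?C" "{a, b} \<in> \<eta>" "joined_in \<eta> (Z - ?C) b y"
    using joined_in_last_exit[OF y(2) wC yC] by metis
  have "b \<notin> gball v k" using ab explored_boundary[of a "gball v k" "gball v r" \<eta> b] by blast
  then have "b \<in> snd i" using ab Z unfolding i' ball_boundary_def by auto
  then have con': "connects (Z - fst i) (snd i) Y \<eta>" using ab y unfolding i'(1) by (intro connectsI) auto
  have "\<exists>a\<in>fst i. joined_in \<eta> (fst i) w a \<and> {a, x} \<in> \<eta>" if x: "x \<in> snd i" for x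
  proof -
    obtain a where a: "a \<in> ?C" "{a, x} \<in> \<eta>" "x \<in> V - gball v k" using x unfolding i' ball_boundary_def by blast
    obtain u where u: "u \<in> gball v r" "joined_in \<eta> (gball v k) u a" using a(1) by (auto simp: explored_def)
    have "exits (gball v k) u \<eta>" unfolding exits_def
      using a u joined_in_mem[OF u(2)] by blast
    then have "joined_in \<eta> (gball v k) w u" using no u exw unfolding split_exit_def by blast
    then have "joined_in \<eta> (gball v k) w a" using u(2) by (rule joined_in_trans)
    from joined_in_explored[OF this wC] a show ?thesis unfolding i'(1) by blast
  qed
  then show ?thesis using con' i unfolding good_state_def by blast
qed

lemma touching_diff_disjoint: "U \<subseteq> V \<Longrightarrow> touching_edges U \<inter> inner_edges (Z - U) \<inter> E = {}"
  by (auto simp: touching_edges_def inner_edges_def)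

text \<open>Write \<open>o\<close> for the probability of \<open>outer\<close>. An event
  \<open>F\<close> together with the connection has probability at least \<open>c * o * G F\<close>.
  The connection itself has probability at most \<open>2 * o * G (\<lambda>_. True)\<close>, the 2
  because the two-cluster event carries at most the share \<open>(c / 2) / c\<close> of it.
  \<open>G\<close> does not involve the target, so normalising it gives the law
  \<open>\<nu>\<close>.\<close>

lemma conditional_minorization:
  assumes v: "v \<in> V" and p: "0 < p" "p \<le> 1" and qm: "quasi_multiplicative V E v c p" and c: "c > 0"
    and w: "w \<in> gball v r" and m: "r \<le> m" "0 < m" "Suc k = 2 * m"
    and small: "perc_prob p (\<lambda>\<eta>. \<exists>y\<in>gball v r. split_exit (gball v k) w y \<eta>) \<le> c / 2 * perc_prob p (exits (gball v k) w)"
    and m2: "k < m2"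
    and ann: "\<And>x y. x \<in> graph_annulus V E v m2 (4 * m2) \<Longrightarrow> y \<in> graph_annulus V E v m2 (4 * m2) \<Longrightarrow>
      joined_in E (gball v N - gball v k) x y"
    and r': "N \<le> r'" "4 * m2 \<le> r'"
    and S: "finite S" "\<And>\<eta>. \<eta> \<subseteq> E \<Longrightarrow> \<sigma> \<eta> \<in> S"
    and \<sigma>: "\<And>s. s \<in> S \<Longrightarrow> cylinder (\<lambda>\<eta>. \<sigma> \<eta> = s)" "\<And>s. s \<in> S \<Longrightarrow> determined_by (inner_edges (gball v r)) (\<lambda>\<eta>. \<sigma> \<eta> = s)"
  obtains \<nu> where "\<And>s. s \<in> S \<Longrightarrow> \<nu> s \<ge> 0" "sum \<nu> S = 1"
    "\<And>Z Y s. target v r' Z Y \<Longrightarrow> s \<in> S \<Longrightarrow>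
      c / 2 * \<nu> s * perc_prob p (connects Z {w} Y) \<le> perc_prob p (\<lambda>\<eta>. \<sigma> \<eta> = s \<and> connects Z {w} Y \<eta>)"
proof -
  have pI: "p \<in> {0..1}" using p by simp
  define l where "l = 2 * m2 - 1"
  have l: "Suc l = 2 * m2" using m2 by (simp add: l_def)
  have k2: "Suc k \<le> m2" using m2 by simp
  have rk: "r \<le> k" using m by linarith
  define I where "I = Pow (gball v k) \<times> Pow (gsphere v (Suc k))"
  have finI: "finite I" unfolding I_def using finite_gball[OF v] finite_gsphere[OF v] by auto
  define St where "St = good_state v r k w"
  define h where "h i = perc_prob p (inner_reach v l (fst i) (snd i))" for i :: "'a set \<times> 'a set"
  have h0: "h i \<ge> 0" for i by (simp add: h_def)
  have Ii: "fst i \<subseteq> gball v k" "snd i \<subseteq> gsphere v (Suc k)" if "i \<in> I" for i using that by (auto simp: I_def)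
  have finfst: "finite (fst i)" if "i \<in> I" for i using Ii(1)[OF that] finite_gball[OF v] finite_subset by blast
  have dSt: "determined_by (touching_edges (fst i)) (St i)" if "i \<in> I" for i
    unfolding St_def by (rule determined_good_state[OF Ii(1)[OF that]])
  have cSt: "cylinder (St i)" if "i \<in> I" for i by (rule cylinder_touching[OF finfst[OF that] dSt[OF that]])
  have StC: "gball v r \<subseteq> fst i" if "St i \<eta>" for i \<eta>
  proof
    fix x assume "x \<in> gball v r"
    then have "x \<in> explored (gball v k) (gball v r) \<eta>" using gball_mono[OF rk, of v] by (intro explored_seed) auto
    then show "x \<in> fst i" using that by (auto simp: St_def good_state_def ball_state_def)
  qed
  define G where "G F = (\<Sum>i\<in>I. perc_prob p (\<lambda>\<eta>. F \<eta> \<and> St i \<eta>) * h i)" for F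
  have main: "c * perc_prob p (outer v l Z Y) * G F \<le> perc_prob p (\<lambda>\<eta>. F \<eta> \<and> connects Z {w} Y \<eta>)"
    if T: "target v r' Z Y" and F: "cylinder F" "determined_by (inner_edges (gball v r)) F" for Z Y F
  proof -
    have Z: "finite Z" "Z \<subseteq> V" "gball v r' \<subseteq> Z" using T by (auto simp: target_def)
    have Zk: "gball v k \<subseteq> Z" using Z(3) gball_mono[of k r' v] r' m2 by auto
    let ?R = "\<lambda>\<eta>. F \<eta> \<and> connects Z {w} Y \<eta>"
    have cR: "cylinder ?R" by (intro cylinder_conj F cylinder_target[OF T])
    have "c * perc_prob p (outer v l Z Y) * G F = (\<Sum>i\<in>I. perc_prob p (\<lambda>\<eta>. F \<eta> \<and> St i \<eta>) * (c * h i * perc_prob p (outer v l Z Y)))"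
      unfolding G_def sum_distrib_left by (intro sum.cong) auto
    also have "\<dots> \<le> (\<Sum>i\<in>I. perc_prob p (\<lambda>\<eta>. ?R \<eta> \<and> ball_state v r k \<eta> = i))"
    proof (rule sum_mono)
      fix i assume i: "i \<in> I"
      let ?D = "connects (Z - fst i) (snd i) Y"
      let ?FS = "\<lambda>\<eta>. F \<eta> \<and> St i \<eta>"
      have cD: "cylinder ?D" by (rule cylinder_connects) (use Z in auto)
      \<comment> \<open>A good state contains the ball of radius \<open>r\<close> and thereby
        touches every edge that \<open>F\<close> reads; for other values of \<open>i\<close> the
        event is empty.\<close>
      have dFS: "determined_by (touching_edges (fst i)) ?FS"
      proof (cases "gball v r \<subseteq> fst i")
        case True
        have "determined_by (touching_edges (fst i)) F"
        proof (rule determined_by_mono[OF F(2)])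
          show "inner_edges (gball v r) \<inter> E \<subseteq> touching_edges (fst i)"
          proof
            fix e assume "e \<in> inner_edges (gball v r) \<inter> E"
            then show "e \<in> touching_edges (fst i)"
              using edges[of e] True by (auto simp: inner_edges_def touching_edges_def)
          qed
        qed
        then show ?thesis using dSt[OF i] by (rule determined_by_conj)
      next
        case False
        then have "\<not> St i \<eta>" for \<eta> using StC[of i \<eta>] by blast
        then have "?FS = (\<lambda>_. False)" by (simp add: fun_eq_iff)
        then show ?thesis by simp
      qed
      have cFS: "cylinder ?FS" by (intro cylinder_conj F cSt i)
      have "c * h i * perc_prob p (outer v l Z Y) \<le> perc_prob p ?D"
        unfolding h_def by (rule outside_connection_factorises(2)[OF v pI qm l k2 T r' ann Ii(1,2)[OF i]])
      then have "perc_prob p ?FS * (c * h i * perc_prob p (outer v l Z Y)) \<le> perc_prob p ?FS * perc_prob p ?D"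
        by (intro mult_left_mono) auto
      also have "\<dots> = perc_prob p (\<lambda>\<eta>. ?FS \<eta> \<and> ?D \<eta>)"
        by (rule perc_prob_indep[OF pI cFS dFS cD determined_connects touching_diff_disjoint, symmetric])
          (use Ii(1)[OF i] gball_subset_V[of v k] in auto)
      also have "\<dots> \<le> perc_prob p (\<lambda>\<eta>. ?R \<eta> \<and> ball_state v r k \<eta> = i)"
      proof (rule perc_prob_mono)
        show "perc_event (\<lambda>\<eta>. ?R \<eta> \<and> ball_state v r k \<eta> = i)"
          by (intro cylinder_imp_perc_event cylinder_conj[OF cR] cylinder_ball_state v)
        fix \<eta> assume *: "?FS \<eta> \<and> ?D \<eta>"
        have "connects Z {w} Y \<eta>"
          by (rule good_state_imp_connects[of v r k w i]) (use * Ii(1)[OF i] Zk in \<open>auto simp: St_def\<close>)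
        then show "?R \<eta> \<and> ball_state v r k \<eta> = i" using * by (auto simp: St_def good_state_def)
      qed
      finally show "perc_prob p ?FS * (c * h i * perc_prob p (outer v l Z Y)) \<le> perc_prob p (\<lambda>\<eta>. ?R \<eta> \<and> ball_state v r k \<eta> = i)" .
    qed
    also have "\<dots> = perc_prob p ?R"
    proof (rule perc_prob_partition[OF finI, symmetric])
      show "ball_state v r k \<eta> \<in> I" if "\<eta> \<subseteq> E" for \<eta> unfolding I_def by (rule ball_state_mem[OF v that])
      show "perc_event (\<lambda>\<eta>. ?R \<eta> \<and> ball_state v r k \<eta> = i)" for i
        by (intro cylinder_imp_perc_event cylinder_conj[OF cR] cylinder_ball_state v)
    qed
    finally show ?thesis .
  qed
  have upper: "perc_prob p (connects Z {w} Y) / 2 \<le> perc_prob p (outer v l Z Y) * G (\<lambda>_. True)"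
    if T: "target v r' Z Y" for Z Y
  proof -
    have Z: "finite Z" "Z \<subseteq> V" "connected_set E Z" "gball v r' \<subseteq> Z" "Y \<subseteq> Z - gball v r'"
      using T by (auto simp: target_def)
    let ?B = "\<lambda>\<eta>. \<exists>y\<in>gball v r. split_exit (gball v k) w y \<eta>"
    let ?D = "\<lambda>i. connects (Z - fst i) (snd i) Y"
    have cB: "cylinder ?B" by (intro cylinder_bex cylinder_split_exit finite_gball v)
    have dB: "determined_by (touching_edges (gball v k)) ?B" by (intro determined_by_bex determined_split_exit)
    have cD: "cylinder (?D i)" for i by (rule cylinder_connects) (use Z in auto)
    have r4: "gball v (4 * m) \<subseteq> gball v r'" using m m2 r' by (intro gball_mono) linarith
    have neg: "perc_prob p (\<lambda>\<eta>. ?B \<eta> \<and> outer v k Z Y \<eta>) \<le> (c / 2) / c * perc_prob p (connects Z {w} Y)"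
      by (rule negligible_given_connection[OF qm c pI v m(2,3) _ Z(1,2,3) _ _ cB dB small])
        (use w gball_mono[OF m(1), of v] r4 Z in auto)
    have Yk: "Y \<subseteq> V - gball v k" using Z gball_mono[of k r' v] m2 r' by auto
    have "perc_prob p (connects Z {w} Y)
        \<le> perc_prob p (\<lambda>\<eta>. (\<exists>i\<in>I. St i \<eta> \<and> ?D i \<eta>) \<or> (?B \<eta> \<and> outer v k Z Y \<eta>))"
    proof (rule perc_prob_mono)
      have "cylinder (\<lambda>\<eta>. \<not> (\<not> (\<exists>i\<in>I. St i \<eta> \<and> ?D i \<eta>) \<and> \<not> (?B \<eta> \<and> outer v k Z Y \<eta>)))"
        by (intro cylinder_not cylinder_conj cylinder_bex[OF finI] cSt cD cB cylinder_outer Z)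
      then show "perc_event (\<lambda>\<eta>. (\<exists>i\<in>I. St i \<eta> \<and> ?D i \<eta>) \<or> (?B \<eta> \<and> outer v k Z Y \<eta>))"
        by (intro cylinder_imp_perc_event) simp
      fix \<eta> assume \<eta>: "\<eta> \<subseteq> E" "connects Z {w} Y \<eta>"
      show "(\<exists>i\<in>I. St i \<eta> \<and> ?D i \<eta>) \<or> (?B \<eta> \<and> outer v k Z Y \<eta>)"
      proof (cases "?B \<eta>")
        case True
        have "outer v k Z Y \<eta>"
          by (rule connects_imp_outer[OF v \<eta> _ Yk]) (use w gball_mono[of r "Suc k" v] rk in auto)
        with True show ?thesis by simp
      next
        case False
        have "good_state v r k w (ball_state v r k \<eta>) \<eta> \<and> ?D (ball_state v r k \<eta>) \<eta>"
          by (rule connects_imp_good_state[OF v \<eta>(1) Z(2) w rk _ \<eta>(2) False refl]) (use Yk in auto)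
        moreover have "ball_state v r k \<eta> \<in> I" unfolding I_def by (rule ball_state_mem[OF v \<eta>(1)])
        ultimately show ?thesis unfolding St_def by blast
      qed
    qed
    also have "\<dots> \<le> perc_prob p (\<lambda>\<eta>. \<exists>i\<in>I. St i \<eta> \<and> ?D i \<eta>) + perc_prob p (\<lambda>\<eta>. ?B \<eta> \<and> outer v k Z Y \<eta>)"
      by (intro perc_prob_disj_le cylinder_imp_perc_event cylinder_conj cylinder_bex[OF finI] cSt cD cB cylinder_outer Z)
    also have "perc_prob p (\<lambda>\<eta>. \<exists>i\<in>I. St i \<eta> \<and> ?D i \<eta>) \<le> (\<Sum>i\<in>I. perc_prob p (\<lambda>\<eta>. St i \<eta> \<and> ?D i \<eta>))"
      by (intro perc_prob_Bex_le finI cylinder_conj cSt cD)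
    also have "\<dots> \<le> (\<Sum>i\<in>I. perc_prob p (\<lambda>\<eta>. True \<and> St i \<eta>) * h i * perc_prob p (outer v l Z Y))"
    proof (rule sum_mono)
      fix i assume i: "i \<in> I"
      have "perc_prob p (\<lambda>\<eta>. St i \<eta> \<and> ?D i \<eta>) = perc_prob p (St i) * perc_prob p (?D i)"
        by (rule perc_prob_indep[OF pI cSt[OF i] dSt[OF i] cD determined_connects touching_diff_disjoint])
          (use Ii(1)[OF i] gball_subset_V[of v k] in auto)
      also have "\<dots> \<le> perc_prob p (St i) * (h i * perc_prob p (outer v l Z Y))"
        unfolding h_def
        by (intro mult_left_mono outside_connection_factorises(1)[OF v pI qm l k2 T r' ann Ii(1,2)[OF i]]) auto
      finally show "perc_prob p (\<lambda>\<eta>. St i \<eta> \<and> ?D i \<eta>) \<le> perc_prob p (\<lambda>\<eta>. True \<and> St i \<eta>) * h i * perc_prob p (outer v l Z Y)"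
        by (simp add: mult.assoc)
    qed
    also have "\<dots> = perc_prob p (outer v l Z Y) * G (\<lambda>_. True)"
      unfolding G_def sum_distrib_left by (intro sum.cong) auto
    finally show ?thesis using neg c by simp
  qed
  let ?G = "G (\<lambda>_. True)"
  have G0: "G F \<ge> 0" for F unfolding G_def by (intro sum_nonneg mult_nonneg_nonneg h0) auto
  \<comment> \<open>A single target certifies that the normalising constant is positive.\<close>
  have T0: "target v r' (gball v (Suc r')) (gsphere v (Suc r'))" by (rule target_gball[OF v])
  have wT: "w \<in> gball v (Suc r')" using w m m2 r' by (auto simp: in_gball)
  have "?G \<noteq> 0" using upper[OF T0] target_prob_pos[OF T0 wT p] by auto
  then have Gpos: "?G > 0" using G0[of "\<lambda>_. True"] by linarith
  define \<nu> where "\<nu> s = G (\<lambda>\<eta>. \<sigma> \<eta> = s) / ?G" for s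
  show thesis
  proof (rule that[of \<nu>])
    show "\<nu> s \<ge> 0" for s unfolding \<nu>_def using G0 Gpos by simp
    have "(\<Sum>s\<in>S. G (\<lambda>\<eta>. \<sigma> \<eta> = s)) = (\<Sum>i\<in>I. (\<Sum>s\<in>S. perc_prob p (\<lambda>\<eta>. \<sigma> \<eta> = s \<and> St i \<eta>)) * h i)"
      unfolding G_def sum_distrib_right by (rule sum.swap)
    also have "\<dots> = ?G"
      unfolding G_def
    proof (intro sum.cong refl, goal_cases)
      case (1 i)
      have "perc_prob p (St i) = (\<Sum>s\<in>S. perc_prob p (\<lambda>\<eta>. St i \<eta> \<and> \<sigma> \<eta> = s))"
        by (rule perc_prob_partition[OF S]) (auto intro!: cylinder_imp_perc_event cylinder_conj cSt[OF 1] \<sigma>(1))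
      then show ?case by (simp add: conj_commute)
    qed
    finally show "sum \<nu> S = 1" using Gpos by (simp add: \<nu>_def sum_divide_distrib[symmetric])
    fix Z Y s assume T: "target v r' Z Y" and s: "s \<in> S"
    let ?o = "perc_prob p (outer v l Z Y)"
    have "c / 2 * \<nu> s * perc_prob p (connects Z {w} Y) = c * \<nu> s * (perc_prob p (connects Z {w} Y) / 2)" by simp
    also have "\<dots> \<le> c * \<nu> s * (?o * ?G)"
      using upper[OF T] c G0 Gpos by (intro mult_left_mono) (auto simp: \<nu>_def)
    also have "\<dots> = c * ?o * G (\<lambda>\<eta>. \<sigma> \<eta> = s)" using Gpos by (simp add: \<nu>_def)
    also have "\<dots> \<le> perc_prob p (\<lambda>\<eta>. \<sigma> \<eta> = s \<and> connects Z {w} Y \<eta>)"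
      by (rule main[OF T \<sigma>(1)[OF s] \<sigma>(2)[OF s]])
    finally show "c / 2 * \<nu> s * perc_prob p (connects Z {w} Y) \<le> perc_prob p (\<lambda>\<eta>. \<sigma> \<eta> = s \<and> connects Z {w} Y \<eta>)" .
  qed
qed

section \<open>Contraction of the oscillation\<close>

text \<open>The conditional probability of \<open>A\<close> given the connection, with value 0 if
  the connection has probability 0.\<close>

definition conn_ratio :: "real \<Rightarrow> ('a set set \<Rightarrow> bool) \<Rightarrow> 'a \<Rightarrow> 'a set \<Rightarrow> 'a set \<Rightarrow> real" where
  "conn_ratio p A w Z Y = perc_prob p (\<lambda>\<eta>. A \<eta> \<and> connects Z {w} Y \<eta>) / perc_prob p (connects Z {w} Y)"

definition nearly_constant :: "real \<Rightarrow> ('a set set \<Rightarrow> bool) \<Rightarrow> 'a \<Rightarrow> 'a \<Rightarrow> nat \<Rightarrow> real \<Rightarrow> bool" where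
  "nearly_constant p A w v r \<theta> \<longleftrightarrow>
     (\<exists>lo. \<forall>Z Y. target v r Z Y \<longrightarrow> lo \<le> conn_ratio p A w Z Y \<and> conn_ratio p A w Z Y \<le> lo + \<theta>)"

text \<open>The clusters of the outer sphere inside the ring, with the vertices of the inner ball at
  which they arrive. The ring ends at radius \<open>Suc r\<close> so that the arrival points, which
  lie on that sphere, form a target for radius \<open>r\<close>.\<close>

definition ring_state :: "'a \<Rightarrow> nat \<Rightarrow> nat \<Rightarrow> 'a set set \<Rightarrow> 'a set \<times> 'a set" where
  "ring_state v r k \<eta> = (let C = explored (gball v (Suc k) - gball v (Suc r)) (gsphere v (Suc k)) \<eta>
     in (C, {y \<in> gball v (Suc r). \<exists>a\<in>C. {y, a} \<in> \<eta>}))"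

text \<open>The part of a connection to \<open>Y\<close> after its last visit to the unexplored
  region \<open>gball v (Suc k) - fst i\<close>.\<close>

definition ring_link :: "'a \<Rightarrow> nat \<Rightarrow> 'a set \<Rightarrow> 'a set \<Rightarrow> 'a set \<times> 'a set \<Rightarrow> 'a set set \<Rightarrow> bool" where
  "ring_link v k Z Y i \<eta> \<longleftrightarrow> (\<exists>a\<in>snd i. \<exists>b\<in>fst i. \<exists>y\<in>Y. {a, b} \<in> \<eta> \<and> joined_in \<eta> (Z - (gball v (Suc k) - fst i)) b y)"

lemma conn_ratio_bounds:
  assumes "cylinder (connects Z {w} Y)"
  shows "0 \<le> conn_ratio p A w Z Y" "conn_ratio p A w Z Y \<le> 1"
proof -
  have "perc_prob p (\<lambda>\<eta>. A \<eta> \<and> connects Z {w} Y \<eta>) \<le> perc_prob p (connects Z {w} Y)"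
    by (rule perc_prob_mono) (use assms in auto)
  then show "conn_ratio p A w Z Y \<le> 1"
    unfolding conn_ratio_def
    by (cases "perc_prob p (connects Z {w} Y) = 0") (auto simp: divide_le_eq less_le)
qed (simp add: conn_ratio_def)

lemma conn_ratio_times:
  assumes "cylinder (connects Z {w} Y)"
  shows "conn_ratio p A w Z Y * perc_prob p (connects Z {w} Y) = perc_prob p (\<lambda>\<eta>. A \<eta> \<and> connects Z {w} Y \<eta>)"
proof (cases "perc_prob p (connects Z {w} Y) = 0")
  case True
  have "perc_prob p (\<lambda>\<eta>. A \<eta> \<and> connects Z {w} Y \<eta>) \<le> perc_prob p (connects Z {w} Y)"
    by (rule perc_prob_mono) (use assms in auto)
  then show ?thesis using True perc_prob_nonneg[of p "\<lambda>\<eta>. A \<eta> \<and> connects Z {w} Y \<eta>"] by simp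
qed (simp add: conn_ratio_def)

section \<open>Exploring inwards from a sphere\<close>

lemma ring_state_eq:
  "ring_state v r k \<eta> = i \<longleftrightarrow> explored (gball v (Suc k) - gball v (Suc r)) (gsphere v (Suc k)) \<eta> = fst i \<and>
     {y \<in> gball v (Suc r). \<exists>a\<in>fst i. {y, a} \<in> \<eta>} = snd i"
  by (cases i) (auto simp: ring_state_def Let_def)

lemma ring_state_mem:
  assumes v: "v \<in> V" and \<eta>: "\<eta> \<subseteq> E"
  shows "ring_state v r k \<eta> \<in> Pow (gball v (Suc k) - gball v (Suc r)) \<times> Pow (gsphere v (Suc r))"
proof -
  let ?C = "explored (gball v (Suc k) - gball v (Suc r)) (gsphere v (Suc k)) \<eta>"
  have C: "?C \<subseteq> gball v (Suc k) - gball v (Suc r)" by (rule explored_subset)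
  have "{y \<in> gball v (Suc r). \<exists>a\<in>?C. {y, a} \<in> \<eta>} \<subseteq> gsphere v (Suc r)"
  proof
    fix y assume "y \<in> {y \<in> gball v (Suc r). \<exists>a\<in>?C. {y, a} \<in> \<eta>}"
    then obtain a where a: "y \<in> gball v (Suc r)" "a \<in> ?C" "{y, a} \<in> \<eta>" by blast
    have "gdist v a \<le> Suc (gdist v y)" using a \<eta> by (intro gdist_edge[OF v]) auto
    moreover have "a \<in> V" "a \<notin> gball v (Suc r)" using a C gball_subset_V by auto
    ultimately show "y \<in> gsphere v (Suc r)" using a(1) by (auto simp: in_gball in_gsphere)
  qed
  with C show ?thesis by (simp add: ring_state_def Let_def)
qed

lemma determined_ring_state:
  "determined_by (touching_edges (fst i)) (\<lambda>\<eta>. ring_state v r k \<eta> = i)"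
  "r \<le> k \<Longrightarrow> determined_by (inner_edges (gball v (Suc k))) (\<lambda>\<eta>. ring_state v r k \<eta> = i)"
proof -
  have D: "determined_by F (\<lambda>\<eta>. {y \<in> B. \<exists>a\<in>C. {y, a} \<in> \<eta>} = W)"
    if "\<And>y a. y \<in> B \<Longrightarrow> a \<in> C \<Longrightarrow> {y, a} \<in> E \<Longrightarrow> {y, a} \<in> F" for F B C W
  proof (rule determined_byI)
    fix \<eta> \<eta>' assume *: "\<eta> \<subseteq> E" "\<eta>' \<subseteq> E" "\<eta> \<inter> F = \<eta>' \<inter> F" "{y \<in> B. \<exists>a\<in>C. {y, a} \<in> \<eta>} = W"
    have "{y, a} \<in> \<eta> \<longleftrightarrow> {y, a} \<in> \<eta>'" if "y \<in> B" "a \<in> C" for y a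
      using *(1-3) \<open>\<And>y a. y \<in> B \<Longrightarrow> a \<in> C \<Longrightarrow> {y, a} \<in> E \<Longrightarrow> {y, a} \<in> F\<close>[OF that] by blast
    then show "{y \<in> B. \<exists>a\<in>C. {y, a} \<in> \<eta>'} = W" using *(4) by blast
  qed
  show "determined_by (touching_edges (fst i)) (\<lambda>\<eta>. ring_state v r k \<eta> = i)"
    unfolding ring_state_eq
    by (intro determined_by_conj determined_explored D) (auto intro: touching_doubleton)
  assume rk: "r \<le> k"
  show "determined_by (inner_edges (gball v (Suc k))) (\<lambda>\<eta>. ring_state v r k \<eta> = i)"
  proof (cases "fst i \<subseteq> gball v (Suc k)")
    case True
    show ?thesis
      unfolding ring_state_eq
    proof (intro determined_by_conj D)
      show "determined_by (inner_edges (gball v (Suc k)))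
          (\<lambda>\<eta>. explored (gball v (Suc k) - gball v (Suc r)) (gsphere v (Suc k)) \<eta> = fst i)"
        by (rule determined_by_mono[OF determined_explored_inner]) (auto simp: inner_edges_def)
      show "{y, a} \<in> inner_edges (gball v (Suc k))" if "y \<in> gball v (Suc r)" "a \<in> fst i" "{y, a} \<in> E" for y a
        using that True gball_mono[of "Suc r" "Suc k" v] rk by (auto simp: inner_edges_def)
    qed
  next
    case False
    have "ring_state v r k \<eta> \<noteq> i" for \<eta>
      using False explored_subset[of "gball v (Suc k) - gball v (Suc r)" "gsphere v (Suc k)" \<eta>]
      unfolding ring_state_eq by auto
    then show ?thesis by simp
  qed
qed

text \<open>The unexplored region can be left only from an arrival point into the explored set: the
  whole sphere of radius \<open>Suc k\<close> is explored, which blocks the way outwards, and an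
  unexplored ring vertex with an open edge to the explored set would itself be explored.\<close>

lemma ring_boundary_edge:
  assumes v: "v \<in> V" and \<eta>: "\<eta> \<subseteq> E" and i: "ring_state v r k \<eta> = i" and rk: "r < k"
    and ab: "a \<in> gball v (Suc k) - fst i" "b \<notin> gball v (Suc k) - fst i" "{a, b} \<in> \<eta>"
  shows "a \<in> snd i" "b \<in> fst i"
proof -
  let ?Q = "gball v (Suc k) - gball v (Suc r)"
  have i': "explored ?Q (gsphere v (Suc k)) \<eta> = fst i" "{y \<in> gball v (Suc r). \<exists>a\<in>fst i. {y, a} \<in> \<eta>} = snd i"
    using i by (simp_all add: ring_state_eq)
  have S: "gsphere v (Suc k) \<subseteq> fst i"
  proof
    fix x assume "x \<in> gsphere v (Suc k)"
    then show "x \<in> fst i"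
      unfolding i'(1)[symmetric] using rk by (intro explored_seed) (auto simp: in_gball in_gsphere)
  qed
  have "a \<notin> gsphere v (Suc k)" using S ab(1) by auto
  then have "a \<in> gball v k" using ab(1) by (auto simp: in_gball in_gsphere)
  moreover have "gdist v b \<le> Suc (gdist v a)" using ab \<eta> by (intro gdist_edge[OF v]) auto
  moreover have "b \<in> V" using ab(3) \<eta> edge_vertices by blast
  ultimately have "b \<in> gball v (Suc k)" by (auto simp: in_gball)
  then show b: "b \<in> fst i" using ab(2) by simp
  have "a \<in> gball v (Suc r)"
  proof (rule ccontr)
    assume "a \<notin> gball v (Suc r)"
    then have "a \<in> explored ?Q (gsphere v (Suc k)) \<eta>"
      using explored_boundary[of b ?Q "gsphere v (Suc k)" \<eta> a] b ab i'(1) by (auto simp: insert_commute)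
    then show False using ab(1) i'(1) by simp
  qed
  then show "a \<in> snd i" unfolding i'(2)[symmetric] using b ab(3) by blast
qed

text \<open>The first exit of the path from the unexplored region yields the inner connection, its
  last exit yields the link.\<close>

lemma connects_imp_ring:
  assumes v: "v \<in> V" and \<eta>: "\<eta> \<subseteq> E" and i: "ring_state v r k \<eta> = i" and rk: "r < k"
    and w: "w \<in> gball v (Suc r)" and Y: "Y \<inter> gball v (Suc k) = {}" and con: "connects Z {w} Y \<eta>"
  shows "connects (gball v (Suc k) - fst i) {w} (snd i) \<eta>" "ring_link v k Z Y i \<eta>"
proof -
  let ?I = "gball v (Suc k) - fst i"
  have "fst i \<subseteq> gball v (Suc k) - gball v (Suc r)"
    using ring_state_mem[OF v \<eta>, of r k] i by auto
  then have wI: "w \<in> ?I" using w gball_mono[of "Suc r" "Suc k" v] rk by auto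
  obtain y where y: "y \<in> Y" "joined_in \<eta> Z w y" using con by (auto elim: connectsE)
  have yI: "y \<notin> ?I" using y Y by auto
  note edge = ring_boundary_edge[OF v \<eta> i rk]
  obtain a b where ab: "joined_in \<eta> (Z \<inter> ?I) w a" "b \<in> Z - ?I" "{a, b} \<in> \<eta>"
    using joined_in_first_exit[OF y(2) wI yI] by metis
  have "a \<in> ?I" using joined_in_mem[OF ab(1)] by simp
  then have "a \<in> snd i" using ab by (intro edge(1)) auto
  moreover have "joined_in \<eta> ?I w a" by (rule joined_in_mono[OF ab(1)]) auto
  ultimately show "connects ?I {w} (snd i) \<eta>" by (intro connectsI) auto
  obtain a b where ab: "a \<in> Z \<inter> ?I" "b \<in> Z - ?I" "{a, b} \<in> \<eta>" "joined_in \<eta> (Z - ?I) b y"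
    using joined_in_last_exit[OF y(2) wI yI] by metis
  have "a \<in> snd i" "b \<in> fst i" using ab edge[of a b] by auto
  with ab y show "ring_link v k Z Y i \<eta>" unfolding ring_link_def by blast
qed

text \<open>The inner connection takes \<open>w\<close> to the outer sphere, and the link joins some
  arrival point \<open>a\<close> to \<open>Y\<close>. If \<open>w\<close> does not reach
  \<open>Y\<close>, then \<open>w\<close> and \<open>a\<close> lie in different clusters that both
  exit.\<close>

lemma ring_imp_split_exit:
  assumes v: "v \<in> V" and \<eta>: "\<eta> \<subseteq> E" and i: "ring_state v r k \<eta> = i" and rk: "r < k"
    and Z: "gball v (Suc k) \<subseteq> Z" "Z \<subseteq> V" and Y: "Y \<subseteq> Z - gball v (Suc k)" and w: "w \<in> gball v (Suc r)"
    and con: "connects (gball v (Suc k) - fst i) {w} (snd i) \<eta>" "ring_link v k Z Y i \<eta>"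
    and no: "\<not> connects Z {w} Y \<eta>"
  shows "(\<exists>y\<in>gball v (Suc r). split_exit (gball v k) w y \<eta>) \<and> outer v k Z Y \<eta>"
proof -
  let ?Q = "gball v (Suc k) - gball v (Suc r)"
  have i': "explored ?Q (gsphere v (Suc k)) \<eta> = fst i" "{y \<in> gball v (Suc r). \<exists>a\<in>fst i. {y, a} \<in> \<eta>} = snd i"
    using i by (simp_all add: ring_state_eq)
  have U: "fst i \<subseteq> ?Q" unfolding i'(1)[symmetric] by (rule explored_subset)
  have W: "snd i \<subseteq> gball v (Suc r)" unfolding i'(2)[symmetric] by blast
  have rB: "gball v (Suc r) \<subseteq> gball v k" using rk by (intro gball_mono) simp
  have kB: "gball v k \<subseteq> gball v (Suc k)" by (intro gball_mono) simp
  have exw: "exits (gball v k) w \<eta>"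
  proof -
    obtain a where a: "a \<in> snd i" "joined_in \<eta> (gball v (Suc k) - fst i) w a" using con(1) by (auto elim: connectsE)
    obtain u where u: "u \<in> fst i" "{a, u} \<in> \<eta>" using a(1) unfolding i'(2)[symmetric] by blast
    obtain s where s: "s \<in> gsphere v (Suc k)" "joined_in \<eta> ?Q s u"
      using u(1) unfolding i'(1)[symmetric] explored_def by blast
    have "joined_in \<eta> (gball v (Suc k)) w a" by (rule joined_in_mono[OF a(2)]) auto
    then have "joined_in \<eta> (gball v (Suc k)) w u" by (rule joined_in_step) (use u U in auto)
    moreover have "joined_in \<eta> (gball v (Suc k)) u s" by (rule joined_in_mono[OF joined_in_sym[OF s(2)]]) auto
    ultimately have "joined_in \<eta> (gball v (Suc k)) w s" by (rule joined_in_trans)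
    then show ?thesis
      using w rB s gball_subset_V by (intro exitsI[of \<eta> "gball v (Suc k)" w s]) (auto simp: in_gball in_gsphere)
  qed
  obtain a b y where aby: "a \<in> snd i" "b \<in> fst i" "y \<in> Y" "{a, b} \<in> \<eta>"
    "joined_in \<eta> (Z - (gball v (Suc k) - fst i)) b y"
    using con(2) unfolding ring_link_def by blast
  have aB: "a \<in> gball v (Suc r)" "a \<in> gball v k" using aby(1) W rB by auto
  have aZ: "a \<in> Z" using aB kB Z by auto
  have "joined_in \<eta> Z b y" by (rule joined_in_mono[OF aby(5)]) auto
  moreover have "joined_in \<eta> Z a b" using aby U Z aZ by (intro joined_in_edge) auto
  ultimately have ay: "joined_in \<eta> Z a y" by (meson joined_in_trans)
  have yk: "y \<notin> gball v k" using aby(3) Y kB by auto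
  have exa: "exits (gball v k) a \<eta>" by (rule exitsI[OF ay aB(2) yk Z(2)])
  have "\<not> joined_in \<eta> (gball v k) w a"
  proof
    assume "joined_in \<eta> (gball v k) w a"
    then have "joined_in \<eta> Z w a" by (rule joined_in_mono) (use kB Z in auto)
    then have "joined_in \<eta> Z w y" using ay by (rule joined_in_trans)
    then show False using no aby(3) by (auto intro: connectsI)
  qed
  then have "split_exit (gball v k) w a \<eta>" using exw exa by (simp add: split_exit_def)
  moreover have "connects Z {a} Y \<eta>" using ay aby(3) by (intro connectsI) auto
  then have "outer v k Z Y \<eta>"
    by (rule connects_imp_outer[OF v \<eta>]) (use aB kB Y Z in auto)
  ultimately show ?thesis using aB by blast
qed

text \<open>The unexplored region need not be connected. Its component of \<open>v\<close> contains
  the ball of radius \<open>Suc r\<close>, carries every open path from \<open>w\<close>, and is a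
  legitimate target region at the smaller radius \<open>r\<close>.\<close>

lemma ring_conn_ratio:
  assumes v: "v \<in> V" and rk: "r < k" and w: "w \<in> gball v r"
    and i: "i \<in> Pow (gball v (Suc k) - gball v (Suc r)) \<times> Pow (gsphere v (Suc r))" "snd i \<noteq> {}"
  shows "\<exists>Z. target v r Z (snd i) \<and> conn_ratio p A w (gball v (Suc k) - fst i) (snd i) = conn_ratio p A w Z (snd i)"
proof -
  let ?I = "gball v (Suc k) - fst i"
  define Z where "Z = explored ?I {v} E"
  have ZI: "Z \<subseteq> ?I" unfolding Z_def by (rule explored_subset)
  have rI: "gball v (Suc r) \<subseteq> ?I" using i gball_mono[of "Suc r" "Suc k" v] rk by auto
  have rZ: "gball v (Suc r) \<subseteq> Z"
  proof
    fix x assume "x \<in> gball v (Suc r)"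
    then have "joined_in E (gball v (Suc r)) v x" by (rule joined_in_gball[OF v])
    then have "joined_in E ?I v x" by (rule joined_in_mono) (use rI in auto)
    then show "x \<in> Z" by (simp add: Z_def explored_def)
  qed
  have vZ: "v \<in> Z" using rZ v gdist_0[OF v v] by (auto simp: in_gball)
  have "connected_set E Z"
  proof (rule connected_setI)
    fix x assume "x \<in> Z"
    then have "joined_in E ?I v x" by (simp add: Z_def explored_def)
    then show "joined_in E Z v x" using vZ unfolding Z_def by (rule joined_in_explored)
  qed
  moreover have "finite Z" using ZI finite_gball[OF v] finite_subset by blast
  moreover have "Z \<subseteq> V" using ZI gball_subset_V by blast
  moreover have "gsphere v (Suc r) \<subseteq> Z - gball v r" using rZ by (auto simp: in_gball in_gsphere subset_iff)
  then have "snd i \<subseteq> Z - gball v r" using i by auto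
  moreover have "gball v r \<subseteq> Z" using rZ gball_mono[of r "Suc r" v] by auto
  ultimately have T: "target v r Z (snd i)" using i(2) by (simp add: target_def)
  have eq: "connects ?I {w} (snd i) \<eta> \<longleftrightarrow> connects Z {w} (snd i) \<eta>" if "\<eta> \<subseteq> E" for \<eta>
  proof
    assume "connects ?I {w} (snd i) \<eta>"
    then obtain y where y: "y \<in> snd i" "joined_in \<eta> ?I w y" by (auto elim: connectsE)
    have "w \<in> Z" using w rZ gball_mono[of r "Suc r" v] by auto
    then have "joined_in \<eta> Z w y" unfolding Z_def by (rule joined_in_component[OF y(2) that])
    with y show "connects Z {w} (snd i) \<eta>" by (intro connectsI) auto
  next
    assume "connects Z {w} (snd i) \<eta>"
    then show "connects ?I {w} (snd i) \<eta>" by (rule connects_mono) (use ZI in auto)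
  qed
  have "perc_prob p (connects ?I {w} (snd i)) = perc_prob p (connects Z {w} (snd i))"
    "perc_prob p (\<lambda>\<eta>. A \<eta> \<and> connects ?I {w} (snd i) \<eta>) = perc_prob p (\<lambda>\<eta>. A \<eta> \<and> connects Z {w} (snd i) \<eta>)"
    using eq by (auto intro!: perc_prob_cong)
  with T show ?thesis unfolding conn_ratio_def by (intro exI[of _ Z]) simp
qed

text \<open>The support is complementary to the edges inside the unexplored region, so the link is
  independent of the inner connection.\<close>

lemma determined_ring_link:
  "determined_by (E - inner_edges (gball v (Suc k) - fst i)) (ring_link v k Z Y i)"
  unfolding ring_link_def
proof (intro determined_by_bex determined_by_conj)
  show "determined_by (E - inner_edges (gball v (Suc k) - fst i)) (\<lambda>\<eta>. {a, b} \<in> \<eta>)" if "b \<in> fst i" for a b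
    by (rule determined_edge) (use that in \<open>auto simp: inner_edges_def\<close>)
  show "determined_by (E - inner_edges (gball v (Suc k) - fst i)) (\<lambda>\<eta>. joined_in \<eta> (Z - (gball v (Suc k) - fst i)) b y)" for b y
  proof (rule determined_by_mono[OF determined_joined_in])
    show "inner_edges (Z - (gball v (Suc k) - fst i)) \<inter> E \<subseteq> E - inner_edges (gball v (Suc k) - fst i)"
    proof
      fix e assume "e \<in> inner_edges (Z - (gball v (Suc k) - fst i)) \<inter> E"
      then show "e \<in> E - inner_edges (gball v (Suc k) - fst i)"
        using edges[of e] by (auto simp: inner_edges_def)
    qed
  qed
qed

lemma cylinder_ring_link:
  assumes "finite Z" "finite (fst i)"
  shows "cylinder (ring_link v k Z Y i)"
proof (rule cylinder_touching[of "Z \<union> fst i"])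
  show "determined_by (touching_edges (Z \<union> fst i)) (ring_link v k Z Y i)"
    unfolding ring_link_def
  proof (intro determined_by_bex determined_by_conj)
    show "determined_by (touching_edges (Z \<union> fst i)) (\<lambda>\<eta>. {a, b} \<in> \<eta>)" if "b \<in> fst i" for a b
      by (rule determined_edge) (use that in \<open>auto simp: touching_edges_def\<close>)
    show "determined_by (touching_edges (Z \<union> fst i)) (\<lambda>\<eta>. joined_in \<eta> (Z - (gball v (Suc k) - fst i)) b y)" for b y
      by (rule determined_by_mono[OF determined_joined_touching]) (auto simp: touching_edges_def)
  qed
qed (use assms in auto)

text \<open>On \<open>e i\<close> (state \<open>i\<close>, inner connection, link) the inside is
  independent of the rest, so \<open>A\<close> has conditional probability exactly
  \<open>a i\<close> there. \<open>e i\<close> contains the event that the state is \<open>i\<close>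
  and \<open>w\<close> reaches \<open>Y\<close>; the excess \<open>\<delta> i\<close> lies in the
  two-cluster event.\<close>

lemma ring_decomposition:
  assumes v: "v \<in> V" and p: "p \<in> {0..1}" and rk: "r < k" and w: "w \<in> gball v r"
    and A: "cylinder A" "determined_by (inner_edges (gball v r)) A"
    and Z: "finite Z" "Z \<subseteq> V" "gball v (Suc k) \<subseteq> Z" and Y: "Y \<subseteq> Z - gball v (Suc k)"
    and I: "I = Pow (gball v (Suc k) - gball v (Suc r)) \<times> Pow (gsphere v (Suc r))"
  shows "\<bar>perc_prob p (\<lambda>\<eta>. A \<eta> \<and> connects Z {w} Y \<eta>)
      - (\<Sum>i\<in>I. conn_ratio p A w (gball v (Suc k) - fst i) (snd i) * perc_prob p (\<lambda>\<eta>. ring_state v r k \<eta> = i \<and> connects Z {w} Y \<eta>))\<bar>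
    \<le> perc_prob p (\<lambda>\<eta>. (\<exists>y\<in>gball v (Suc r). split_exit (gball v k) w y \<eta>) \<and> outer v k Z Y \<eta>)"
proof -
  let ?con = "connects Z {w} Y" and ?\<sigma> = "ring_state v r k"
  let ?B = "\<lambda>\<eta>. (\<exists>y\<in>gball v (Suc r). split_exit (gball v k) w y \<eta>) \<and> outer v k Z Y \<eta>"
  define J where "J = ring_link v k Z Y"
  define D where "D i = connects (gball v (Suc k) - fst i) {w} (snd i)" for i :: "'a set \<times> 'a set"
  define e where "e i \<eta> \<longleftrightarrow> D i \<eta> \<and> (?\<sigma> \<eta> = i \<and> J i \<eta>)" for i \<eta>
  define a where "a i = conn_ratio p A w (gball v (Suc k) - fst i) (snd i)" for i
  define \<mu> where "\<mu> i = perc_prob p (\<lambda>\<eta>. ?\<sigma> \<eta> = i \<and> ?con \<eta>)" for i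
  define \<delta> where "\<delta> i = perc_prob p (\<lambda>\<eta>. e i \<eta> \<and> \<not> ?con \<eta>)" for i
  have finI: "finite I" unfolding I using finite_gball[OF v] finite_gsphere[OF v] by auto
  have finU: "finite (fst i)" if "i \<in> I" for i
    by (rule finite_subset[OF _ finite_gball[OF v, of "Suc k"]]) (use that in \<open>auto simp: I\<close>)
  have w': "w \<in> gball v (Suc r)" using w gball_mono[of r "Suc r" v] by auto
  have cc: "cylinder ?con" by (rule cylinder_connects[OF Z(1)])
  have cD: "cylinder (D i)" for i unfolding D_def by (rule cylinder_connects) (use finite_gball[OF v] in auto)
  have c\<sigma>: "cylinder (\<lambda>\<eta>. ?\<sigma> \<eta> = i)" for i
    by (rule cylinder_inner[OF finite_gball[OF v] determined_ring_state(2)]) (use rk in simp)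
  have cJ: "cylinder (J i)" if "i \<in> I" for i unfolding J_def by (rule cylinder_ring_link[OF Z(1) finU[OF that]])
  have ce: "cylinder (e i)" if "i \<in> I" for i unfolding e_def by (intro cylinder_conj cD c\<sigma> cJ that)
  have cB: "cylinder ?B" by (intro cylinder_conj cylinder_bex cylinder_split_exit cylinder_outer finite_gball v Z)
  have \<sigma>I: "?\<sigma> \<eta> \<in> I" if "\<eta> \<subseteq> E" for \<eta> unfolding I by (rule ring_state_mem[OF v that])
  have YE: "Y \<inter> gball v (Suc k) = {}" using Y by auto
  have in_e: "e i \<eta>" if "\<eta> \<subseteq> E" "?\<sigma> \<eta> = i" "?con \<eta>" for i \<eta>
    using connects_imp_ring[OF v that(1,2) rk w' YE that(3)] that(2) unfolding e_def D_def J_def by simp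
  have part: "\<bar>perc_prob p (\<lambda>\<eta>. (A \<eta> \<and> ?con \<eta>) \<and> ?\<sigma> \<eta> = i) - a i * \<mu> i\<bar> \<le> \<delta> i" if i: "i \<in> I" for i
  proof -
    let ?in = "inner_edges (gball v (Suc k) - fst i)"
    have dD: "determined_by ?in (D i)" by (simp add: D_def determined_connects)
    have d1: "determined_by ?in (\<lambda>\<eta>. A \<eta> \<and> D i \<eta>)"
    proof (rule determined_by_conj)
      have "fst i \<inter> gball v r = {}" using i gball_mono[of r "Suc r" v] unfolding I by auto
      then show "determined_by ?in A"
        by (intro determined_by_mono[OF A(2)]) (use gball_mono[of r "Suc k" v] rk in \<open>auto simp: inner_edges_def\<close>)
    qed (rule dD)
    have d2: "determined_by (E - ?in) (\<lambda>\<eta>. ?\<sigma> \<eta> = i \<and> J i \<eta>)"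
      unfolding J_def
      by (intro determined_by_conj determined_ring_link determined_by_mono[OF determined_ring_state(1)])
        (auto simp: touching_edges_def inner_edges_def)
    have c2: "cylinder (\<lambda>\<eta>. ?\<sigma> \<eta> = i \<and> J i \<eta>)" by (intro cylinder_conj c\<sigma> cJ i)
    have f1: "perc_prob p (\<lambda>\<eta>. (A \<eta> \<and> D i \<eta>) \<and> (?\<sigma> \<eta> = i \<and> J i \<eta>))
        = perc_prob p (\<lambda>\<eta>. A \<eta> \<and> D i \<eta>) * perc_prob p (\<lambda>\<eta>. ?\<sigma> \<eta> = i \<and> J i \<eta>)"
      by (rule perc_prob_indep[OF p cylinder_conj[OF A(1) cD] d1 c2 d2]) auto
    have f2: "perc_prob p (e i) = perc_prob p (D i) * perc_prob p (\<lambda>\<eta>. ?\<sigma> \<eta> = i \<and> J i \<eta>)"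
      unfolding e_def
      by (rule perc_prob_indep[OF p cD dD c2 d2]) auto
    have "a i * perc_prob p (D i) = perc_prob p (\<lambda>\<eta>. A \<eta> \<and> D i \<eta>)"
      unfolding a_def D_def by (rule conn_ratio_times[OF cD[unfolded D_def]])
    then have f3: "perc_prob p (\<lambda>\<eta>. A \<eta> \<and> e i \<eta>) = a i * perc_prob p (e i)"
      using f1 f2 by (simp add: e_def mult.assoc[symmetric])
    have s1: "perc_prob p (e i) = \<mu> i + \<delta> i"
    proof -
      have "perc_prob p (\<lambda>\<eta>. e i \<eta> \<and> ?con \<eta>) = \<mu> i"
        unfolding \<mu>_def
      proof (rule perc_prob_cong)
        show "(e i \<eta> \<and> ?con \<eta>) = (?\<sigma> \<eta> = i \<and> ?con \<eta>)" if "\<eta> \<subseteq> E" for \<eta>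
          using in_e[OF that, of i] unfolding e_def by blast
      qed
      then show ?thesis using perc_prob_split[OF ce[OF i] cc, of p] by (simp add: \<delta>_def)
    qed
    have cAe: "cylinder (\<lambda>\<eta>. A \<eta> \<and> e i \<eta>)" by (intro cylinder_conj A ce i)
    have s2: "perc_prob p (\<lambda>\<eta>. A \<eta> \<and> e i \<eta>)
        = perc_prob p (\<lambda>\<eta>. (A \<eta> \<and> ?con \<eta>) \<and> ?\<sigma> \<eta> = i) + perc_prob p (\<lambda>\<eta>. (A \<eta> \<and> e i \<eta>) \<and> \<not> ?con \<eta>)"
    proof -
      have "perc_prob p (\<lambda>\<eta>. (A \<eta> \<and> e i \<eta>) \<and> ?con \<eta>) = perc_prob p (\<lambda>\<eta>. (A \<eta> \<and> ?con \<eta>) \<and> ?\<sigma> \<eta> = i)"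
      proof (rule perc_prob_cong)
        show "((A \<eta> \<and> e i \<eta>) \<and> ?con \<eta>) = ((A \<eta> \<and> ?con \<eta>) \<and> ?\<sigma> \<eta> = i)" if "\<eta> \<subseteq> E" for \<eta>
          using in_e[OF that, of i] unfolding e_def by blast
      qed
      then show ?thesis using perc_prob_split[OF cAe cc, of p] by simp
    qed
    have le: "perc_prob p (\<lambda>\<eta>. (A \<eta> \<and> e i \<eta>) \<and> \<not> ?con \<eta>) \<le> \<delta> i"
      unfolding \<delta>_def by (rule perc_prob_mono) (auto intro!: cylinder_imp_perc_event cylinder_conj cylinder_not ce i cc)
    have ge: "0 \<le> perc_prob p (\<lambda>\<eta>. (A \<eta> \<and> e i \<eta>) \<and> \<not> ?con \<eta>)" by simp
    have a01: "0 \<le> a i" "a i \<le> 1" unfolding a_def by (rule conn_ratio_bounds[OF cD[unfolded D_def]])+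
    have \<delta>0: "0 \<le> \<delta> i" by (simp add: \<delta>_def)
    \<comment> \<open>Two corrections enter with opposite signs, \<open>a i * \<delta> i\<close> and
      the part of \<open>A\<close> on the excess event. Both lie between 0 and
      \<open>\<delta> i\<close>, so the error is at most \<open>\<delta> i\<close> and not twice
      that.\<close>
    have "0 \<le> a i * \<delta> i" "a i * \<delta> i \<le> \<delta> i"
      using a01 \<delta>0 mult_right_mono[of "a i" 1 "\<delta> i"] by auto
    moreover have "perc_prob p (\<lambda>\<eta>. A \<eta> \<and> e i \<eta>) = a i * \<mu> i + a i * \<delta> i"
      unfolding f3 s1 by (rule distrib_left)
    ultimately show ?thesis using s2 le ge unfolding abs_le_iff by linarith
  qed
  have "perc_prob p (\<lambda>\<eta>. A \<eta> \<and> ?con \<eta>) = (\<Sum>i\<in>I. perc_prob p (\<lambda>\<eta>. (A \<eta> \<and> ?con \<eta>) \<and> ?\<sigma> \<eta> = i))"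
    by (rule perc_prob_partition[OF finI \<sigma>I]) (auto intro!: cylinder_imp_perc_event cylinder_conj A cc c\<sigma>)
  then have "\<bar>perc_prob p (\<lambda>\<eta>. A \<eta> \<and> ?con \<eta>) - (\<Sum>i\<in>I. a i * \<mu> i)\<bar>
      = \<bar>\<Sum>i\<in>I. perc_prob p (\<lambda>\<eta>. (A \<eta> \<and> ?con \<eta>) \<and> ?\<sigma> \<eta> = i) - a i * \<mu> i\<bar>"
    by (simp add: sum_subtractf)
  also have "\<dots> \<le> (\<Sum>i\<in>I. \<delta> i)"
    by (rule order_trans[OF sum_abs sum_mono[OF part]])
  also have "\<dots> \<le> (\<Sum>i\<in>I. perc_prob p (\<lambda>\<eta>. ?B \<eta> \<and> ?\<sigma> \<eta> = i))"
  proof (rule sum_mono)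
    fix i assume i: "i \<in> I"
    show "\<delta> i \<le> perc_prob p (\<lambda>\<eta>. ?B \<eta> \<and> ?\<sigma> \<eta> = i)"
      unfolding \<delta>_def
    proof (rule perc_prob_mono)
      show "perc_event (\<lambda>\<eta>. ?B \<eta> \<and> ?\<sigma> \<eta> = i)" by (intro cylinder_imp_perc_event cylinder_conj[OF cB c\<sigma>])
      fix \<eta> assume "\<eta> \<subseteq> E" "e i \<eta> \<and> \<not> ?con \<eta>"
      then show "?B \<eta> \<and> ?\<sigma> \<eta> = i"
        using ring_imp_split_exit[OF v \<open>\<eta> \<subseteq> E\<close> _ rk Z(3,2) Y w', of i] unfolding e_def D_def J_def by simp
    qed
  qed
  also have "\<dots> = perc_prob p ?B"
    by (rule perc_prob_partition[OF finI \<sigma>I cylinder_imp_perc_event[OF cylinder_conj[OF cB c\<sigma>]], symmetric])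
  finally show ?thesis by (simp add: a_def \<mu>_def)
qed

text \<open>Given the connection, the law of the ring state is \<open>c / 2\<close> times the fixed
  law \<open>\<nu>\<close> plus a remainder of mass \<open>1 - c / 2\<close>. The first part
  contributes the same amount for every target, and only the remainder inherits the oscillation
  \<theta>. The decomposition error \<epsilon> / c counts once at each end of the range.\<close>

lemma nearly_constant_contract:
  assumes v: "v \<in> V" and p: "0 < p" "p \<le> 1" and qm: "quasi_multiplicative V E v c p" and c: "c > 0"
    and w: "w \<in> gball v r" and A: "cylinder A" "determined_by (inner_edges (gball v r)) A"
    and m: "Suc r \<le> m" "Suc k = 2 * m"
    and small: "perc_prob p (\<lambda>\<eta>. \<exists>y\<in>gball v (Suc r). split_exit (gball v k) w y \<eta>) \<le> \<epsilon> * perc_prob p (exits (gball v k) w)"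
    and m': "Suc k \<le> m'" "Suc k' = 2 * m'"
    and small': "perc_prob p (\<lambda>\<eta>. \<exists>y\<in>gball v (Suc k). split_exit (gball v k') w y \<eta>) \<le> c / 2 * perc_prob p (exits (gball v k') w)"
    and m2: "k' < m2"
    and ann: "\<And>x y. x \<in> graph_annulus V E v m2 (4 * m2) \<Longrightarrow> y \<in> graph_annulus V E v m2 (4 * m2) \<Longrightarrow>
      joined_in E (gball v N - gball v k') x y"
    and r': "N \<le> r'" "4 * m2 \<le> r'"
    and nc: "nearly_constant p A w v r \<theta>"
  shows "nearly_constant p A w v r' ((1 - c / 2) * \<theta> + 2 * (\<epsilon> / c))"
proof -
  have pI: "p \<in> {0..1}" using p by simp
  have rk: "r < k" using m by linarith
  define I where "I = Pow (gball v (Suc k) - gball v (Suc r)) \<times> Pow (gsphere v (Suc r))"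
  have finI: "finite I" unfolding I_def using finite_gball[OF v] finite_gsphere[OF v] by auto
  let ?\<sigma> = "ring_state v r k"
  have wk: "w \<in> gball v (Suc k)" using w gball_mono[of r "Suc k" v] rk by auto
  have m'0: "0 < m'" using m' by simp
  have c\<sigma>: "cylinder (\<lambda>\<eta>. ?\<sigma> \<eta> = i)" for i
    by (rule cylinder_inner[OF finite_gball[OF v] determined_ring_state(2)]) (use rk in simp)
  obtain \<nu> where \<nu>: "\<And>i. i \<in> I \<Longrightarrow> \<nu> i \<ge> 0" "sum \<nu> I = 1"
    "\<And>Z Y i. target v r' Z Y \<Longrightarrow> i \<in> I \<Longrightarrow>
      c / 2 * \<nu> i * perc_prob p (connects Z {w} Y) \<le> perc_prob p (\<lambda>\<eta>. ?\<sigma> \<eta> = i \<and> connects Z {w} Y \<eta>)"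
  proof (rule conditional_minorization[OF v p qm c wk m'(1) m'0 m'(2) small' m2 ann r' finI, of ?\<sigma>])
    show "?\<sigma> \<eta> \<in> I" if "\<eta> \<subseteq> E" for \<eta> unfolding I_def by (rule ring_state_mem[OF v that])
    show "determined_by (inner_edges (gball v (Suc k))) (\<lambda>\<eta>. ?\<sigma> \<eta> = s)" for s
      by (rule determined_ring_state(2)) (use rk in simp)
  qed (use c\<sigma> in auto)
  define a where "a i = conn_ratio p A w (gball v (Suc k) - fst i) (snd i)" for i
  obtain lo where lo: "\<And>Z Y. target v r Z Y \<Longrightarrow> lo \<le> conn_ratio p A w Z Y \<and> conn_ratio p A w Z Y \<le> lo + \<theta>"
    using nc unfolding nearly_constant_def by blast
  have alo: "lo \<le> a i" "a i \<le> lo + \<theta>" if i: "i \<in> I" "snd i \<noteq> {}" for i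
  proof -
    obtain Z where "target v r Z (snd i)" "a i = conn_ratio p A w Z (snd i)"
      using ring_conn_ratio[OF v rk w i[unfolded I_def], of p A] unfolding a_def by metis
    with lo show "lo \<le> a i" "a i \<le> lo + \<theta>" by auto
  qed
  define na where "na = (\<Sum>i\<in>I. a i * \<nu> i)"
  \<comment> \<open>Common part, plus the remainder at its lowest, minus the decomposition
    error.\<close>
  define lo' where "lo' = c / 2 * na + (1 - c / 2) * lo - \<epsilon> / c"
  have "lo' \<le> conn_ratio p A w Z Y \<and> conn_ratio p A w Z Y \<le> lo' + ((1 - c / 2) * \<theta> + 2 * (\<epsilon> / c))"
    if T: "target v r' Z Y" for Z Y
  proof -
    have Z: "finite Z" "Z \<subseteq> V" "connected_set E Z" "gball v r' \<subseteq> Z" "Y \<subseteq> Z - gball v r'"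
      using T by (auto simp: target_def)
    have Bk: "gball v (Suc k) \<subseteq> gball v r'" using m' m2 r' by (intro gball_mono) linarith
    have B4: "gball v (4 * m) \<subseteq> gball v r'" using m m' m2 r' by (intro gball_mono) linarith
    have Zk: "gball v (Suc k) \<subseteq> Z" "Y \<subseteq> Z - gball v (Suc k)" using Z Bk by auto
    let ?con = "connects Z {w} Y"
    let ?B = "\<lambda>\<eta>. \<exists>y\<in>gball v (Suc r). split_exit (gball v k) w y \<eta>"
    define P where "P = perc_prob p ?con"
    define \<mu> where "\<mu> i = perc_prob p (\<lambda>\<eta>. ?\<sigma> \<eta> = i \<and> ?con \<eta>)" for i
    have cc: "cylinder ?con" by (rule cylinder_connects[OF Z(1)])
    have P: "P > 0" unfolding P_def by (rule target_prob_pos[OF T _ p]) (use wk Zk in auto)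
    have cB: "cylinder ?B" by (intro cylinder_bex cylinder_split_exit finite_gball v)
    have dB: "determined_by (touching_edges (gball v k)) ?B" by (intro determined_by_bex determined_split_exit)
    have err: "perc_prob p (\<lambda>\<eta>. ?B \<eta> \<and> outer v k Z Y \<eta>) \<le> \<epsilon> / c * P"
      unfolding P_def
      by (rule negligible_given_connection[OF qm c pI v _ m(2) _ Z(1,2,3) _ _ cB dB small])
        (use m w gball_mono[of r m v] B4 Z in auto)
    have dec: "\<bar>perc_prob p (\<lambda>\<eta>. A \<eta> \<and> ?con \<eta>) - (\<Sum>i\<in>I. a i * \<mu> i)\<bar> \<le> \<epsilon> / c * P"
      using ring_decomposition[OF v pI rk w A Z(1,2) Zk I_def] err unfolding a_def \<mu>_def by linarith
    have \<mu>sum: "(\<Sum>i\<in>I. \<mu> i) = P"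
      unfolding \<mu>_def P_def
    proof (subst conj_commute, rule perc_prob_partition[OF finI, symmetric])
      show "?\<sigma> \<eta> \<in> I" if "\<eta> \<subseteq> E" for \<eta> unfolding I_def by (rule ring_state_mem[OF v that])
    qed (auto intro!: cylinder_imp_perc_event cylinder_conj cc c\<sigma>)
    \<comment> \<open>States without arrival points offer no target, so the bounds on
      \<open>a i\<close> do not cover them; they carry no mass.\<close>
    have \<mu>0: "\<mu> i = 0" if "snd i = {}" for i
    proof -
      have "\<mu> i \<le> perc_prob p (\<lambda>_. False)"
        unfolding \<mu>_def
      proof (rule perc_prob_mono)
        fix \<eta> assume \<eta>: "\<eta> \<subseteq> E" "?\<sigma> \<eta> = i \<and> ?con \<eta>"
        have "connects (gball v (Suc k) - fst i) {w} (snd i) \<eta>"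
          by (rule connects_imp_ring(1)[OF v \<eta>(1) conjunct1[OF \<eta>(2)] rk _ _ conjunct2[OF \<eta>(2)]])
            (use w gball_mono[of r "Suc r" v] Zk in auto)
        then show False using that by (auto elim: connectsE)
      qed auto
      moreover have "perc_prob p (\<lambda>_. False) = 0" by (simp add: perc_prob_def)
      ultimately show ?thesis using perc_prob_nonneg[of p "\<lambda>\<eta>. ?\<sigma> \<eta> = i \<and> ?con \<eta>"] by (simp add: \<mu>_def)
    qed
    define d where "d i = \<mu> i - c / 2 * \<nu> i * P" for i
    have d0: "d i \<ge> 0" if "i \<in> I" for i using \<nu>(3)[OF T that] by (simp add: d_def \<mu>_def P_def)
    have dz: "d i = 0" if "i \<in> I" "snd i = {}" for i
    proof -
      have "0 \<le> c / 2 * \<nu> i * P" using c \<nu>(1)[OF that(1)] P by simp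
      with d0[OF that(1)] \<mu>0[OF that(2)] show ?thesis by (simp add: d_def)
    qed
    have dsum: "(\<Sum>i\<in>I. d i) = (1 - c / 2) * P"
    proof -
      have "(\<Sum>i\<in>I. d i) = P - c / 2 * (sum \<nu> I) * P"
        unfolding d_def sum_subtractf \<mu>sum sum_distrib_left sum_distrib_right ..
      then show ?thesis using \<nu>(2) by (simp add: algebra_simps)
    qed
    have split: "(\<Sum>i\<in>I. a i * \<mu> i) = c / 2 * na * P + (\<Sum>i\<in>I. a i * d i)"
      unfolding na_def sum_distrib_left sum_distrib_right sum.distrib[symmetric]
      by (intro sum.cong) (auto simp: d_def algebra_simps)
    have "lo * d i \<le> a i * d i \<and> a i * d i \<le> (lo + \<theta>) * d i" if "i \<in> I" for i
      using alo[OF that] d0[OF that] dz[OF that] by (cases "snd i = {}") (auto intro!: mult_right_mono)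
    then have "lo * (\<Sum>i\<in>I. d i) \<le> (\<Sum>i\<in>I. a i * d i)" "(\<Sum>i\<in>I. a i * d i) \<le> (lo + \<theta>) * (\<Sum>i\<in>I. d i)"
      unfolding sum_distrib_left by (auto intro!: sum_mono)
    then have "P * (lo' + \<epsilon> / c) \<le> (\<Sum>i\<in>I. a i * \<mu> i)"
      "(\<Sum>i\<in>I. a i * \<mu> i) \<le> P * (lo' + \<epsilon> / c + (1 - c / 2) * \<theta>)"
      unfolding split dsum lo'_def by (simp_all add: algebra_simps add_divide_distrib)
    moreover define t where "t = \<epsilon> / c"
    ultimately have bnd: "P * lo' + P * t \<le> (\<Sum>i\<in>I. a i * \<mu> i)"
      "(\<Sum>i\<in>I. a i * \<mu> i) \<le> P * lo' + P * t + P * ((1 - c / 2) * \<theta>)"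
      by (simp_all only: distrib_left)
    have "P * lo' \<le> perc_prob p (\<lambda>\<eta>. A \<eta> \<and> ?con \<eta>)"
      "perc_prob p (\<lambda>\<eta>. A \<eta> \<and> ?con \<eta>) \<le> P * lo' + (P * ((1 - c / 2) * \<theta>) + 2 * (P * t))"
      using bnd dec unfolding t_def[symmetric] mult.commute[of t P] by linarith+
    then have "P * lo' \<le> perc_prob p (\<lambda>\<eta>. A \<eta> \<and> ?con \<eta>)"
      "perc_prob p (\<lambda>\<eta>. A \<eta> \<and> ?con \<eta>) \<le> P * (lo' + ((1 - c / 2) * \<theta> + 2 * (\<epsilon> / c)))"
      unfolding t_def[symmetric] by (simp_all only: distrib_left mult.left_commute)
    then show ?thesis
      using P unfolding conn_ratio_def P_def[symmetric] by (simp add: pos_le_divide_eq pos_divide_le_eq mult.commute)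
  qed
  then show ?thesis unfolding nearly_constant_def by blast
qed

section \<open>The limits\<close>

text \<open>Used to reduce \<open>c\<close> to at most 1, so that the contraction factor
  \<open>1 - c / 2\<close> lies strictly between 0 and 1.\<close>

lemma quasi_multiplicative_mono:
  assumes "quasi_multiplicative V E v c p" "0 \<le> c'" "c' \<le> c"
  shows "quasi_multiplicative V E v c' p"
  unfolding quasi_multiplicative_def
proof (intro allI impI, goal_cases)
  case (1 m Z X Y)
  let ?P = "\<lambda>X Y. \<P>(\<omega> in bond_percolation E p. open_connection E Z X Y \<omega>)"
  let ?S = "graph_sphere V E v (2 * m)"
  have "c' * ?P X ?S * ?P Y ?S \<le> c * ?P X ?S * ?P Y ?S"
    using assms(3) by (intro mult_right_mono) auto
  also have "\<dots> \<le> ?P X Y" using assms(1) 1 unfolding quasi_multiplicative_def by blast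
  finally show ?case .
qed

lemma nearly_constant_one: "nearly_constant p A w v r 1"
  unfolding nearly_constant_def
  by (rule exI[of _ 0]) (use conn_ratio_bounds cylinder_target in auto)

lemma nearly_constant_mono: "nearly_constant p A w v r \<theta> \<Longrightarrow> \<theta> \<le> \<theta>' \<Longrightarrow> nearly_constant p A w v r \<theta>'"
  unfolding nearly_constant_def by (meson add_left_mono order_trans)

lemma determined_by_inner_ball:
  assumes v: "v \<in> V" and A: "cylinder A"
  obtains r where "r0 \<le> r" "determined_by (inner_edges (gball v r)) A"
proof -
  obtain F where F: "F \<subseteq> E" "finite F" "determined_by F A" using A unfolding cylinder_def by blast
  have "\<forall>\<^sub>F r in sequentially. \<forall>e\<in>F. e \<in> inner_edges (gball v r)"
  proof (rule eventually_ball_finite[OF F(2)], rule ballI)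
    fix e assume "e \<in> F"
    then obtain x y where e: "e \<in> E" "x \<in> V" "y \<in> V" "e = {x, y}" using F(1) edges[of e] by blast
    have "\<forall>\<^sub>F r in sequentially. gdist v x \<le> r \<and> gdist v y \<le> r"
      by (intro eventually_conj eventually_ge_at_top)
    then show "\<forall>\<^sub>F r in sequentially. e \<in> inner_edges (gball v r)"
      by (rule eventually_mono) (use e in \<open>auto simp: inner_edges_def in_gball\<close>)
  qed
  then have "\<forall>\<^sub>F r in sequentially. (\<forall>e\<in>F. e \<in> inner_edges (gball v r)) \<and> r0 \<le> r"
    by (intro eventually_conj eventually_ge_at_top)
  then obtain r where r: "\<forall>e\<in>F. e \<in> inner_edges (gball v r)" "r0 \<le> r"
    using eventually_happens'[OF sequentially_bot] by blast
  have "determined_by (inner_edges (gball v r)) A" by (rule determined_by_mono[OF F(3)]) (use r in auto)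
  with r(2) show ?thesis by (rule that)
qed

text \<open>Unlike \<open>at q within I\<close>, this filter sees \<open>q\<close> itself, so the
  same statements can be used with \<open>I = {q}\<close>.\<close>

lemma perc_prob_tendsto:
  assumes Q: "cylinder Q" and I: "I \<subseteq> {0..1}" "q \<in> I"
  shows "((\<lambda>p. perc_prob p Q) \<longlongrightarrow> perc_prob q Q) (inf (nhds q) (principal I))"
proof -
  have "continuous_on I (\<lambda>p. perc_prob p Q)"
    by (rule continuous_on_subset[OF continuous_on_perc_prob[OF Q] I(1)])
  then have lim: "((\<lambda>p. perc_prob p Q) \<longlongrightarrow> perc_prob q Q) (at q within I)"
    using I(2) by (simp add: continuous_on)
  show ?thesis
  proof (rule topological_tendstoI)
    fix S assume S: "open S" "perc_prob q Q \<in> S"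
    have "\<forall>\<^sub>F p in at q within I. perc_prob p Q \<in> S" by (rule topological_tendstoD[OF lim S])
    then have "\<forall>\<^sub>F p in nhds q. p \<noteq> q \<longrightarrow> p \<in> I \<longrightarrow> perc_prob p Q \<in> S" by (simp add: eventually_at_filter)
    then show "\<forall>\<^sub>F p in inf (nhds q) (principal I). perc_prob p Q \<in> S"
      unfolding eventually_inf_principal by (rule eventually_mono) (use S in auto)
  qed
qed

lemma perc_prob_less_eventually:
  assumes "cylinder Q" "cylinder R" and I: "I \<subseteq> {0..1}" "q \<in> I"
    and less: "perc_prob q Q < a * perc_prob q R"
  shows "\<forall>\<^sub>F p in inf (nhds q) (principal I). perc_prob p Q \<le> a * perc_prob p R"
proof -
  have "((\<lambda>p. a * perc_prob p R - perc_prob p Q) \<longlongrightarrow> a * perc_prob q R - perc_prob q Q) (inf (nhds q) (principal I))"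
    by (intro tendsto_intros perc_prob_tendsto assms)
  from order_tendstoD(1)[OF this, of 0] less
  have "\<forall>\<^sub>F p in inf (nhds q) (principal I). 0 < a * perc_prob p R - perc_prob p Q" by simp
  then show ?thesis by (rule eventually_mono) simp
qed

text \<open>All scales, and hence \<open>r'\<close>, are chosen at \<open>q\<close>. The two
  smallness conditions are strict inequalities between cylinder probabilities there and persist
  nearby; the connectedness of the annulus is a property of the graph. \<theta> is quantified under
  the filter so that steps can be chained along one sequence of radii.\<close>

lemma nearly_constant_step:
  assumes v: "v \<in> V" and w: "w \<in> gball v r" and A: "cylinder A" "determined_by (inner_edges (gball v r)) A"
    and q: "0 < q" "q < 1" "q \<in> I" and I: "I \<subseteq> {0<..1}" and c: "c > 0"
    and qm: "\<And>p. p \<in> I \<Longrightarrow> quasi_multiplicative V E v c p" and uniq: "unique_infinite_cluster V E q" and \<epsilon>: "\<epsilon> > 0"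
  shows "\<exists>r'\<ge>r. \<forall>\<^sub>F p in inf (nhds q) (principal I). \<forall>\<theta>. nearly_constant p A w v r \<theta> \<longrightarrow>
    nearly_constant p A w v r' ((1 - c / 2) * \<theta> + \<epsilon>)"
proof -
  have wV: "w \<in> V" using w by (simp add: in_gball)
  have I01: "I \<subseteq> {0..1}" using I by auto
  have scale: "\<exists>m k. s \<le> m \<and> Suc k = 2 * m \<and>
      (\<forall>\<^sub>F p in inf (nhds q) (principal I). perc_prob p (\<lambda>\<eta>. \<exists>y\<in>gball v s. split_exit (gball v k) w y \<eta>) \<le> a * perc_prob p (exits (gball v k) w))"
    if a: "a > 0" for a :: real and s
  proof -
    obtain k0 where k0: "\<And>k. k0 \<le> k \<Longrightarrow>
        perc_prob q (\<lambda>\<eta>. \<exists>y\<in>gball v s. split_exit (gball v k) w y \<eta>) < a * perc_prob q (exits (gball v k) w)"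
      using split_exit_negligible[OF v wV q(1) _ uniq a, of s] q unfolding eventually_sequentially by auto
    define m where "m = max s (Suc k0)"
    define k where "k = 2 * m - 1"
    have "Suc k0 \<le> m" by (simp add: m_def)
    then have k: "Suc k = 2 * m" "k0 \<le> k" unfolding k_def by linarith+
    have "\<forall>\<^sub>F p in inf (nhds q) (principal I). perc_prob p (\<lambda>\<eta>. \<exists>y\<in>gball v s. split_exit (gball v k) w y \<eta>) \<le> a * perc_prob p (exits (gball v k) w)"
      by (intro perc_prob_less_eventually[OF _ _ I01 q(3) k0[OF k(2)]] cylinder_bex cylinder_split_exit cylinder_exits finite_gball v)
    then show ?thesis using k by (intro exI[of _ m] exI[of _ k]) (auto simp: m_def)
  qed
  \<comment> \<open>The first value turns the error \<open>2 * (\<epsilon> * c / 2 / c)\<close> of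
    the contraction into \<epsilon>; the second is the one required for the common law.\<close>
  have "\<epsilon> * c / 2 > 0" "c / 2 > 0" using \<epsilon> c by auto
  obtain m k where mk: "Suc r \<le> m" "Suc k = 2 * m"
    "\<forall>\<^sub>F p in inf (nhds q) (principal I). perc_prob p (\<lambda>\<eta>. \<exists>y\<in>gball v (Suc r). split_exit (gball v k) w y \<eta>) \<le> \<epsilon> * c / 2 * perc_prob p (exits (gball v k) w)"
    using scale[OF \<open>\<epsilon> * c / 2 > 0\<close>, of "Suc r"] by blast
  obtain m' k' where mk': "Suc k \<le> m'" "Suc k' = 2 * m'"
    "\<forall>\<^sub>F p in inf (nhds q) (principal I). perc_prob p (\<lambda>\<eta>. \<exists>y\<in>gball v (Suc k). split_exit (gball v k') w y \<eta>) \<le> c / 2 * perc_prob p (exits (gball v k') w)"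
    using scale[OF \<open>c / 2 > 0\<close>, of "Suc k"] by blast
  obtain m2 N where m2: "k' < m2" "\<forall>x\<in>graph_annulus V E v m2 (4 * m2). \<forall>y\<in>graph_annulus V E v m2 (4 * m2).
      joined_in E (gball v N - gball v k') x y"
    using annulus_joined_outside_ball[OF v q(1,2) qm[OF q(3)] c uniq, of k'] by blast
  define r' where "r' = max N (4 * m2)"
  have "r \<le> r'" using mk mk' m2 by (simp add: r'_def)
  moreover have "\<forall>\<^sub>F p in inf (nhds q) (principal I). p \<in> I"
    by (simp add: eventually_inf_principal)
  with mk(3) mk'(3) have "\<forall>\<^sub>F p in inf (nhds q) (principal I). \<forall>\<theta>. nearly_constant p A w v r \<theta> \<longrightarrow>
      nearly_constant p A w v r' ((1 - c / 2) * \<theta> + \<epsilon>)"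
  proof eventually_elim
    case (elim p)
    have p: "0 < p" "p \<le> 1" using elim(3) I by auto
    have eq: "2 * (\<epsilon> * c / 2 / c) = \<epsilon>" using c by simp
    show ?case
    proof (intro allI impI)
      fix \<theta> assume nc: "nearly_constant p A w v r \<theta>"
      have "nearly_constant p A w v r' ((1 - c / 2) * \<theta> + 2 * (\<epsilon> * c / 2 / c))"
        by (rule nearly_constant_contract[OF v p qm[OF elim(3)] c w A mk(1,2) elim(1) mk'(1,2) elim(2) m2(1) _ _ _ nc])
          (use m2(2) in \<open>auto simp: r'_def\<close>)
      then show "nearly_constant p A w v r' ((1 - c / 2) * \<theta> + \<epsilon>)" unfolding eq .
    qed
  qed
  ultimately show ?thesis by blast
qed

lemma nearly_constant_eventually:
  assumes v: "v \<in> V" and w: "w \<in> V" and A: "cylinder A"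
    and q: "0 < q" "q < 1" "q \<in> I" and I: "I \<subseteq> {0<..1}" and c: "c > 0"
    and qm: "\<And>p. p \<in> I \<Longrightarrow> quasi_multiplicative V E v c p" and uniq: "unique_infinite_cluster V E q" and \<epsilon>: "\<epsilon> > 0"
  shows "\<exists>r. \<forall>\<^sub>F p in inf (nhds q) (principal I). nearly_constant p A w v r \<epsilon>"
proof -
  define \<kappa> where "\<kappa> = min c 1 / 2"
  have \<kappa>: "0 < \<kappa>" "\<kappa> < 1" using c by (auto simp: \<kappa>_def)
  have qm': "quasi_multiplicative V E v (min c 1) p" if "p \<in> I" for p
    by (rule quasi_multiplicative_mono[OF qm[OF that]]) (use c in auto)
  have c': "min c 1 > 0" using c by simp
  obtain r0 where r0: "gdist v w \<le> r0" "determined_by (inner_edges (gball v r0)) A"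
    using determined_by_inner_ball[OF v A] by metis
  \<comment> \<open>The iteration of \<theta> to
    \<open>(1 - \<kappa>) * \<theta> + \<epsilon>0\<close> has the fixed point
    \<open>\<epsilon>0 / \<kappa>\<close>, which is \<epsilon> / 2.\<close>
  define \<epsilon>0 where "\<epsilon>0 = \<kappa> * \<epsilon> / 2"
  have \<epsilon>0: "\<epsilon>0 > 0" using \<kappa> \<epsilon> by (simp add: \<epsilon>0_def)
  have iter: "\<exists>r\<ge>r0. \<forall>\<^sub>F p in inf (nhds q) (principal I). nearly_constant p A w v r ((1 - \<kappa>) ^ n + \<epsilon>0 / \<kappa>)" for n
  proof (induction n)
    case 0
    show ?case
      using \<kappa> \<epsilon>0 by (intro exI[of _ r0] conjI always_eventually allI nearly_constant_mono[OF nearly_constant_one]) auto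
  next
    case (Suc n)
    then obtain r where r: "r0 \<le> r"
      "\<forall>\<^sub>F p in inf (nhds q) (principal I). nearly_constant p A w v r ((1 - \<kappa>) ^ n + \<epsilon>0 / \<kappa>)" by blast
    have wr: "w \<in> gball v r" using w r r0 by (simp add: in_gball)
    have dr: "determined_by (inner_edges (gball v r)) A"
      by (rule determined_by_mono[OF r0(2)]) (use gball_mono[OF r(1), of v] in \<open>auto simp: inner_edges_def\<close>)
    obtain r' where r': "r \<le> r'" "\<forall>\<^sub>F p in inf (nhds q) (principal I). \<forall>\<theta>. nearly_constant p A w v r \<theta> \<longrightarrow>
        nearly_constant p A w v r' ((1 - \<kappa>) * \<theta> + \<epsilon>0)"
      using nearly_constant_step[OF v wr A dr q I c' qm' uniq \<epsilon>0] unfolding \<kappa>_def by blast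
    have eq: "(1 - \<kappa>) * ((1 - \<kappa>) ^ n + \<epsilon>0 / \<kappa>) + \<epsilon>0 = (1 - \<kappa>) ^ Suc n + \<epsilon>0 / \<kappa>"
      using \<kappa> by (simp add: field_simps)
    from r(2) r'(2) have "\<forall>\<^sub>F p in inf (nhds q) (principal I). nearly_constant p A w v r' ((1 - \<kappa>) ^ Suc n + \<epsilon>0 / \<kappa>)"
      by eventually_elim (metis eq)
    then show ?case using r(1) r'(1) by (intro exI[of _ r']) auto
  qed
  obtain n where n: "(1 - \<kappa>) ^ n < \<epsilon> / 2" using real_arch_pow_inv[of "\<epsilon> / 2" "1 - \<kappa>"] \<kappa> \<epsilon> by auto
  have "(1 - \<kappa>) ^ n + \<epsilon>0 / \<kappa> \<le> \<epsilon>" using n \<kappa> by (simp add: \<epsilon>0_def)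
  moreover obtain r where "\<forall>\<^sub>F p in inf (nhds q) (principal I). nearly_constant p A w v r ((1 - \<kappa>) ^ n + \<epsilon>0 / \<kappa>)"
    using iter by blast
  ultimately show ?thesis by (intro exI[of _ r]) (auto elim!: eventually_mono intro: nearly_constant_mono)
qed

section \<open>Conditioning on reaching a distant sphere around w\<close>

definition exit_ratio :: "real \<Rightarrow> ('a set set \<Rightarrow> bool) \<Rightarrow> 'a \<Rightarrow> nat \<Rightarrow> real" where
  "exit_ratio p A w n = perc_prob p (\<lambda>\<eta>. A \<eta> \<and> exits (gball w n) w \<eta>) / perc_prob p (exits (gball w n) w)"

lemma centre_in_gball: "w \<in> V \<Longrightarrow> w \<in> gball w n"
  using gdist_0[of w w] by (simp add: in_gball)

text \<open>Index \<open>n\<close> stands for the sphere of radius \<open>Suc n\<close>. The freedom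
  in \<open>Z\<close> is used twice: a ball makes the ratio one of a target, and
  \<open>Z = V\<close> gives the conditioning in the theorem.\<close>

lemma exit_ratio_eq_conn_ratio:
  assumes w: "w \<in> V" and Z: "gball w (Suc n) \<subseteq> Z" "Z \<subseteq> V"
  shows "exit_ratio p A w n = conn_ratio p A w Z (gsphere w (Suc n))"
proof -
  have eq: "connects Z {w} (gsphere w (Suc n)) \<eta> \<longleftrightarrow> exits (gball w n) w \<eta>" if "\<eta> \<subseteq> E" for \<eta>
    by (rule connects_sphere_iff_exits[OF w that Z centre_in_gball[OF w]])
  have "perc_prob p (exits (gball w n) w) = perc_prob p (connects Z {w} (gsphere w (Suc n)))"
    "perc_prob p (\<lambda>\<eta>. A \<eta> \<and> exits (gball w n) w \<eta>) = perc_prob p (\<lambda>\<eta>. A \<eta> \<and> connects Z {w} (gsphere w (Suc n)) \<eta>)"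
    using eq by (auto intro!: perc_prob_cong)
  then show ?thesis by (simp add: exit_ratio_def conn_ratio_def)
qed

text \<open>Targets are centred at \<open>v\<close>, spheres at \<open>w\<close>. From index
  \<open>r + gdist w v\<close> on, the balls around \<open>w\<close> contain the ball of radius
  \<open>r\<close> around \<open>v\<close>.\<close>

lemma exit_ratio_nearly_constant:
  assumes v: "v \<in> V" and w: "w \<in> V" and nc: "nearly_constant p A w v r \<epsilon>"
  shows "\<exists>lo. \<forall>n\<ge>r + gdist w v. lo \<le> exit_ratio p A w n \<and> exit_ratio p A w n \<le> lo + \<epsilon>"
proof -
  obtain lo where lo: "\<And>Z Y. target v r Z Y \<Longrightarrow> lo \<le> conn_ratio p A w Z Y \<and> conn_ratio p A w Z Y \<le> lo + \<epsilon>"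
    using nc unfolding nearly_constant_def by blast
  have "lo \<le> exit_ratio p A w n \<and> exit_ratio p A w n \<le> lo + \<epsilon>" if n: "r + gdist w v \<le> n" for n
  proof -
    have near: "gdist w x \<le> n" if "x \<in> gball v r" for x
      using gdist_triangle[OF w v, of x] that n by (simp add: in_gball)
    have "target v r (gball w (Suc n)) (gsphere w (Suc n))"
      unfolding target_def
    proof (intro conjI)
      show "gball v r \<subseteq> gball w (Suc n)" using near by (fastforce simp: in_gball)
      show "gsphere w (Suc n) \<subseteq> gball w (Suc n) - gball v r" using near by (fastforce simp: in_gball in_gsphere)
    qed (use finite_gball connected_gball gsphere_nonempty gball_subset_V w in auto)
    from lo[OF this] show ?thesis
      using exit_ratio_eq_conn_ratio[OF w order_refl gball_subset_V] by simp
  qed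
  then show ?thesis by blast
qed

lemma exit_ratio_uniform:
  assumes v: "v \<in> V" and w: "w \<in> V" and A: "cylinder A"
    and q: "0 < q" "q < 1" "q \<in> I" and I: "I \<subseteq> {0<..1}" and c: "c > 0"
    and qm: "\<And>p. p \<in> I \<Longrightarrow> quasi_multiplicative V E v c p" and uniq: "unique_infinite_cluster V E q" and \<epsilon>: "\<epsilon> > 0"
  shows "\<exists>N. \<forall>\<^sub>F p in inf (nhds q) (principal I). \<exists>lo. \<forall>n\<ge>N. lo \<le> exit_ratio p A w n \<and> exit_ratio p A w n \<le> lo + \<epsilon>"
proof -
  obtain r where "\<forall>\<^sub>F p in inf (nhds q) (principal I). nearly_constant p A w v r \<epsilon>"
    using nearly_constant_eventually[OF v w A q I c qm uniq \<epsilon>] by blast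
  then have "\<forall>\<^sub>F p in inf (nhds q) (principal I). \<exists>lo. \<forall>n\<ge>r + gdist w v. lo \<le> exit_ratio p A w n \<and> exit_ratio p A w n \<le> lo + \<epsilon>"
    by (rule eventually_mono) (rule exit_ratio_nearly_constant[OF v w])
  then show ?thesis by (rule exI)
qed

lemma convergent_exit_ratio:
  assumes v: "v \<in> V" and w: "w \<in> V" and A: "cylinder A" and q: "0 < q" "q < 1" and c: "c > 0"
    and qm: "quasi_multiplicative V E v c q" and uniq: "unique_infinite_cluster V E q"
  shows "convergent (exit_ratio q A w)"
proof -
  have "Cauchy (exit_ratio q A w)"
  proof (rule metric_CauchyI)
    fix \<epsilon> :: real assume \<epsilon>: "\<epsilon> > 0"
    \<comment> \<open>With \<open>I = {q}\<close> a property that holds eventually holds at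
      \<open>q\<close>, so the uniform estimate becomes a Cauchy estimate.\<close>
    have "\<exists>N. \<forall>\<^sub>F p in inf (nhds q) (principal {q}). \<exists>lo. \<forall>n\<ge>N. lo \<le> exit_ratio p A w n \<and> exit_ratio p A w n \<le> lo + \<epsilon> / 2"
      by (rule exit_ratio_uniform[OF v w A q, of "{q}" c "\<epsilon> / 2"]) (use q c qm uniq \<epsilon> in auto)
    then obtain N where "\<forall>\<^sub>F p in inf (nhds q) (principal {q}). \<exists>lo. \<forall>n\<ge>N. lo \<le> exit_ratio p A w n \<and> exit_ratio p A w n \<le> lo + \<epsilon> / 2" ..
    from eventually_nhds_x_imp_x[OF this[unfolded eventually_inf_principal]]
    obtain lo where lo: "\<And>n. n \<ge> N \<Longrightarrow> lo \<le> exit_ratio q A w n \<and> exit_ratio q A w n \<le> lo + \<epsilon> / 2" by blast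
    have "dist (exit_ratio q A w m) (exit_ratio q A w n) < \<epsilon>" if "m \<ge> N" "n \<ge> N" for m n
      using lo[OF that(1)] lo[OF that(2)] \<epsilon> unfolding dist_real_def by linarith
    then show "\<exists>N. \<forall>m\<ge>N. \<forall>n\<ge>N. dist (exit_ratio q A w m) (exit_ratio q A w n) < \<epsilon>" by blast
  qed
  then show ?thesis by (simp add: Cauchy_convergent_iff)
qed

text \<open>At parameter 1 the conditioning event has probability one. The case is separate because
  keeping two ends apart required closed edges.\<close>

lemma convergent_exit_ratio_1:
  assumes w: "w \<in> V" and A: "cylinder A"
  shows "convergent (exit_ratio 1 A w)"
proof -
  have "exit_ratio 1 A w n = perc_prob 1 A" for n
  proof -
    let ?Q = "exits (gball w n) w"
    have cQ: "cylinder ?Q" by (rule cylinder_exits[OF finite_gball[OF w]])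
    have one: "perc_prob 1 ?Q = 1"
      using exits_prob_ge[OF w _ centre_in_gball[OF w], of 1 n] perc_prob_le_1[of 1 ?Q] by simp
    then have "perc_prob 1 (\<lambda>\<eta>. \<not> ?Q \<eta>) = 0"
      using perc_prob_split[OF cylinder_const[of True] cQ, of 1] perc_prob_True[of 1] by simp
    moreover have "perc_prob 1 (\<lambda>\<eta>. A \<eta> \<and> \<not> ?Q \<eta>) \<le> perc_prob 1 (\<lambda>\<eta>. \<not> ?Q \<eta>)"
      by (rule perc_prob_mono) (use cQ in auto)
    ultimately have "perc_prob 1 (\<lambda>\<eta>. A \<eta> \<and> \<not> ?Q \<eta>) = 0"
      using perc_prob_nonneg[of 1 "\<lambda>\<eta>. A \<eta> \<and> \<not> ?Q \<eta>"] by linarith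
    then show ?thesis using perc_prob_split[OF A cQ, of 1] one by (simp add: exit_ratio_def)
  qed
  then have "exit_ratio 1 A w = (\<lambda>_. perc_prob 1 A)" by (simp add: fun_eq_iff)
  then show ?thesis by (simp add: convergent_const)
qed

lemma exit_ratio_tendsto_infinite:
  assumes w: "w \<in> V" and A: "cylinder A" and pos: "perc_prob p (inf_cluster w) > 0"
  shows "exit_ratio p A w \<longlonglongrightarrow> perc_prob p (\<lambda>\<eta>. A \<eta> \<and> inf_cluster w \<eta>) / perc_prob p (inf_cluster w)"
proof -
  have dec: "exits (gball w n) w \<eta>" if "exits (gball w (Suc n)) w \<eta>" for n \<eta>
    by (rule exits_antimono[OF that gball_mono gball_subset_V centre_in_gball[OF w]]) simp
  have "(\<lambda>n. perc_prob p (\<lambda>\<eta>. A \<eta> \<and> exits (gball w n) w \<eta>)) \<longlonglongrightarrow> perc_prob p (\<lambda>\<eta>. \<forall>n. A \<eta> \<and> exits (gball w n) w \<eta>)"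
    by (rule perc_prob_decseq(1)) (use dec in \<open>auto intro!: cylinder_conj A cylinder_exits finite_gball w\<close>)
  also have "(\<lambda>\<eta>. \<forall>n. A \<eta> \<and> exits (gball w n) w \<eta>) = (\<lambda>\<eta>. A \<eta> \<and> inf_cluster w \<eta>)"
    using inf_cluster_iff_exits[OF w centre_in_gball[OF w, of 0]] by (auto simp: fun_eq_iff)
  finally show ?thesis
    unfolding exit_ratio_def using pos by (intro tendsto_divide exits_prob_tendsto(1) w) auto
qed

text \<open>An interchange of limits. For \<open>p\<close> near \<open>q\<close> the limit in
  \<open>n\<close> is within \<epsilon> / 4 of the ratio at a fixed \<open>N\<close>, the same holds
  at \<open>q\<close>, and the ratio at \<open>N\<close> is continuous in \<open>p\<close>; the
  three errors stay below \<epsilon>.\<close>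

lemma exit_ratio_limits_agree:
  assumes v: "v \<in> V" and w: "w \<in> V" and A: "cylinder A" and q: "0 < q" and \<delta>: "\<delta> > 0" "q + \<delta> \<le> 1" and c: "c > 0"
    and qm: "\<And>p. p \<in> {q..q + \<delta>} \<Longrightarrow> quasi_multiplicative V E v c p" and uniq: "unique_infinite_cluster V E q"
    and pos: "\<And>p. q < p \<Longrightarrow> p \<le> 1 \<Longrightarrow> perc_prob p (inf_cluster w) > 0"
    and L: "exit_ratio q A w \<longlonglongrightarrow> L"
  shows "((\<lambda>p. perc_prob p (\<lambda>\<eta>. A \<eta> \<and> inf_cluster w \<eta>) / perc_prob p (inf_cluster w)) \<longlongrightarrow> L) (at_right q)"
proof (rule tendstoI)
  fix \<epsilon> :: real assume \<epsilon>: "\<epsilon> > 0"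
  define g where "g p = perc_prob p (\<lambda>\<eta>. A \<eta> \<and> inf_cluster w \<eta>) / perc_prob p (inf_cluster w)" for p
  define I where "I = {q..q + \<delta>}"
  have I: "I \<subseteq> {0<..1}" "q \<in> I" "I \<subseteq> {0..1}" using q \<delta> by (auto simp: I_def)
  have "\<exists>N. \<forall>\<^sub>F p in inf (nhds q) (principal I). \<exists>lo. \<forall>n\<ge>N. lo \<le> exit_ratio p A w n \<and> exit_ratio p A w n \<le> lo + \<epsilon> / 4"
    by (rule exit_ratio_uniform[OF v w A q _ I(2,1) c _ uniq, of "\<epsilon> / 4"]) (use \<delta> \<epsilon> qm in \<open>auto simp: I_def\<close>)
  then obtain N where N: "\<forall>\<^sub>F p in inf (nhds q) (principal I). \<exists>lo. \<forall>n\<ge>N. lo \<le> exit_ratio p A w n \<and> exit_ratio p A w n \<le> lo + \<epsilon> / 4" ..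
  have close: "\<bar>l - exit_ratio p A w N\<bar> \<le> \<epsilon> / 4"
    if near: "\<exists>lo. \<forall>n\<ge>N. lo \<le> exit_ratio p A w n \<and> exit_ratio p A w n \<le> lo + \<epsilon> / 4"
      and lim: "exit_ratio p A w \<longlonglongrightarrow> l" for p l
  proof -
    obtain lo where lo: "\<And>n. n \<ge> N \<Longrightarrow> lo \<le> exit_ratio p A w n \<and> exit_ratio p A w n \<le> lo + \<epsilon> / 4" using near by blast
    have "lo \<le> l" by (rule LIMSEQ_le_const[OF lim]) (use lo in blast)
    moreover have "l \<le> lo + \<epsilon> / 4" by (rule LIMSEQ_le_const2[OF lim]) (use lo in blast)
    ultimately show ?thesis using lo[of N] unfolding abs_le_iff by linarith
  qed
  have cN: "cylinder (exits (gball w N) w)" by (rule cylinder_exits[OF finite_gball[OF w]])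
  have "((\<lambda>p. exit_ratio p A w N) \<longlongrightarrow> exit_ratio q A w N) (inf (nhds q) (principal I))"
    unfolding exit_ratio_def
  proof (intro tendsto_divide perc_prob_tendsto I)
    show "perc_prob q (exits (gball w N) w) \<noteq> 0"
      using exits_prob_pos[OF w q _ centre_in_gball[OF w], of N] \<delta> by simp
  qed (use cN A in auto)
  then have cont: "\<forall>\<^sub>F p in inf (nhds q) (principal I). dist (exit_ratio p A w N) (exit_ratio q A w N) < \<epsilon> / 4"
    using \<epsilon> by (intro tendstoD) auto
  have Nq: "\<exists>lo. \<forall>n\<ge>N. lo \<le> exit_ratio q A w n \<and> exit_ratio q A w n \<le> lo + \<epsilon> / 4"
    using eventually_nhds_x_imp_x[OF N[unfolded eventually_inf_principal]] I(2) by blast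
  have inI: "\<forall>\<^sub>F p in inf (nhds q) (principal I). p \<in> I" by (simp add: eventually_inf_principal)
  from N cont inI have "\<forall>\<^sub>F p in inf (nhds q) (principal I). q < p \<longrightarrow> dist (g p) L < \<epsilon>"
  proof eventually_elim
    case (elim p)
    show ?case
    proof
      assume "q < p"
      then have "exit_ratio p A w \<longlonglongrightarrow> g p"
        unfolding g_def using elim(3) \<delta> by (intro exit_ratio_tendsto_infinite w A pos) (auto simp: I_def)
      from close[OF elim(1) this] close[OF Nq L] elim(2) show "dist (g p) L < \<epsilon>"
        unfolding dist_real_def by linarith
    qed
  qed
  then have "\<forall>\<^sub>F p in at_right q. p \<in> I \<longrightarrow> q < p \<longrightarrow> dist (g p) L < \<epsilon>"
    unfolding eventually_inf_principal eventually_at_filter by (rule eventually_mono) simp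
  moreover have "\<forall>\<^sub>F p in at_right q. p \<in> {q<..<q + \<delta>}" using \<delta> by (intro eventually_at_right_real) simp
  ultimately show "\<forall>\<^sub>F p in at_right q. dist (g p) L < \<epsilon>"
    by eventually_elim (auto simp: I_def)
qed

section \<open>Back from sets of open edges to configurations\<close>

definition config_event :: "('a set \<Rightarrow> bool) set \<Rightarrow> 'a set set \<Rightarrow> bool" where
  "config_event A \<eta> \<longleftrightarrow> (\<lambda>e\<in>E. e \<in> \<eta>) \<in> A"

lemma cylinder_config_event:
  assumes "cylinder_event E A"
  shows "cylinder (config_event A)"
proof -
  obtain F where F: "finite F" "F \<subseteq> E"
    "\<forall>\<omega> \<in> (\<Pi>\<^sub>E e\<in>E. UNIV). \<forall>\<omega>' \<in> (\<Pi>\<^sub>E e\<in>E. UNIV). (\<forall>e\<in>F. \<omega> e = \<omega>' e) \<longrightarrow> (\<omega> \<in> A \<longleftrightarrow> \<omega>' \<in> A)"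
    using assms unfolding cylinder_event_def by (elim conjE exE) (rule that)
  have "determined_by F (config_event A)"
  proof (rule determined_byI)
    fix \<eta> \<eta>' assume *: "\<eta> \<subseteq> E" "\<eta>' \<subseteq> E" "\<eta> \<inter> F = \<eta>' \<inter> F" "config_event A \<eta>"
    have "(\<lambda>e\<in>E. e \<in> \<eta>) \<in> A \<longleftrightarrow> (\<lambda>e\<in>E. e \<in> \<eta>') \<in> A"
      by (rule F(3)[rule_format]) (use * F(2) in auto)
    then show "config_event A \<eta>'" using * by (simp add: config_event_def)
  qed
  then show ?thesis using F by (intro cylinderI) auto
qed

text \<open>Points of the product space are \<open>undefined\<close> outside \<open>E\<close>;
  restricting the indicator to \<open>E\<close> in \<open>config_event\<close> recovers exactly such
  a point.\<close>

lemma config_event_open_edges: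
  assumes "\<omega> \<in> space (bond_percolation E p)"
  shows "config_event A (open_edges E \<omega>) \<longleftrightarrow> \<omega> \<in> A"
proof -
  have "(\<lambda>e\<in>E. e \<in> open_edges E \<omega>) = \<omega>"
    using assms unfolding space_bond_percolation by (auto simp: open_edges_def fun_eq_iff PiE_def extensional_def)
  then show ?thesis by (simp add: config_event_def)
qed

lemma cond_prob_config_event:
  assumes "\<And>\<omega>. Q \<omega> \<longleftrightarrow> R (open_edges E \<omega>)"
  shows "\<P>(\<omega> in bond_percolation E p. \<omega> \<in> A \<bar> Q \<omega>) = perc_prob p (\<lambda>\<eta>. config_event A \<eta> \<and> R \<eta>) / perc_prob p R"
proof -
  have "{\<omega> \<in> space (bond_percolation E p). \<omega> \<in> A \<and> Q \<omega>}
      = {\<omega> \<in> space (bond_percolation E p). config_event A (open_edges E \<omega>) \<and> R (open_edges E \<omega>)}"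
    using config_event_open_edges assms by auto
  then show ?thesis unfolding cond_prob_def perc_prob_def using assms by simp
qed

lemma cond_prob_sphere:
  assumes w: "w \<in> V"
  shows "\<P>(\<omega> in bond_percolation E p. \<omega> \<in> A \<bar> open_connection E V {w} (gsphere w (Suc n)) \<omega>)
    = exit_ratio p (config_event A) w n"
  unfolding exit_ratio_eq_conn_ratio[OF w gball_subset_V order_refl] conn_ratio_def
  by (rule cond_prob_config_event) (rule open_connection_eq)

lemma cond_prob_infinite:
  "\<P>(\<omega> in bond_percolation E p. \<omega> \<in> A \<bar> infinite (open_cluster V E \<omega> w))
    = perc_prob p (\<lambda>\<eta>. config_event A \<eta> \<and> inf_cluster w \<eta>) / perc_prob p (inf_cluster w)"
  by (rule cond_prob_config_event) (simp add: inf_cluster_open_edges)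

end

theorem theorem1p1:
  fixes V :: "'a set" and E :: "'a set set" and v0 :: 'a and p_c :: real
  assumes graph: "infinite_bounded_degree_graph V E"
    and v0: "v0 \<in> V"
    and p_c: "p_c = critical_threshold V E v0"
  shows
    "((\<forall>p\<in>{0..1}. unique_infinite_cluster V E p) \<and>
      (\<exists>v\<in>V. \<exists>\<delta>>0. p_c + \<delta> \<le> 1 \<and>
         (\<exists>c>0. \<forall>p\<in>{p_c..p_c + \<delta>}. quasi_multiplicative V E v c p))
      \<longrightarrow>
      (\<forall>w\<in>V. \<forall>A. cylinder_event E A \<longrightarrow>
         (\<exists>L.
            ((\<lambda>n. \<P>(\<omega> in bond_percolation E p_c.
                      \<omega> \<in> A \<bar> open_connection E V {w} (graph_sphere V E w n) \<omega>))
               \<longlonglongrightarrow> L) \<and>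
            ((\<lambda>p. \<P>(\<omega> in bond_percolation E p.
                      \<omega> \<in> A \<bar> infinite (open_cluster V E \<omega> w)))
               \<longlongrightarrow> L) (at_right p_c))))
     \<and>
     (unique_infinite_cluster V E p_c \<and>
      (\<exists>v\<in>V. \<exists>c>0. quasi_multiplicative V E v c p_c)
      \<longrightarrow>
      (\<forall>w\<in>V. \<forall>A. cylinder_event E A \<longrightarrow>
         convergent (\<lambda>n. \<P>(\<omega> in bond_percolation E p_c.
            \<omega> \<in> A \<bar> open_connection E V {w} (graph_sphere V E w n) \<omega>))))"
proof -
  interpret infinite_bounded_degree_graph V E by (rule graph)
  have q: "0 < p_c" "p_c \<le> 1" unfolding p_c by (rule critical_threshold_bounds[OF v0])+
  let ?f = "\<lambda>w A n. \<P>(\<omega> in bond_percolation E p_c. \<omega> \<in> A \<bar> open_connection E V {w} (graph_sphere V E w n) \<omega>)"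
  \<comment> \<open>\<open>exit_ratio\<close> at \<open>n\<close> belongs to the sphere of radius
    \<open>Suc n\<close>, so the sequence of the theorem is shifted by one term, which leaves limits
    unchanged.\<close>
  have Suc_f: "(\<lambda>n. ?f w A (Suc n)) = exit_ratio p_c (config_event A) w" if "w \<in> V" for w A
    using cond_prob_sphere[OF that] by (simp add: fun_eq_iff)
  have conv: "convergent (exit_ratio p_c (config_event A) w)"
    if "v \<in> V" "c > 0" "quasi_multiplicative V E v c p_c" "unique_infinite_cluster V E p_c" "w \<in> V" "cylinder_event E A"
    for v c w A
  \<comment> \<open>The value 1 can arise only for the second part, since the first has room for
    \<delta> above p_c.\<close>
  proof (cases "p_c = 1")
    case True
    then show ?thesis using convergent_exit_ratio_1[OF that(5) cylinder_config_event[OF that(6)]] by simp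
  next
    case False
    then show ?thesis using that q by (intro convergent_exit_ratio[of v w _ _ c] cylinder_config_event) auto
  qed
  show ?thesis
  proof (intro conjI impI ballI allI)
    fix w A
    assume asm: "(\<forall>p\<in>{0..1}. unique_infinite_cluster V E p) \<and>
      (\<exists>v\<in>V. \<exists>\<delta>>0. p_c + \<delta> \<le> 1 \<and> (\<exists>c>0. \<forall>p\<in>{p_c..p_c + \<delta>}. quasi_multiplicative V E v c p))"
      and w: "w \<in> V" and A: "cylinder_event E A"
    then obtain v \<delta> c where v: "v \<in> V" and \<delta>: "\<delta> > 0" "p_c + \<delta> \<le> 1" and c: "c > 0"
      and qm: "\<And>p. p \<in> {p_c..p_c + \<delta>} \<Longrightarrow> quasi_multiplicative V E v c p"
      by blast
    have uniq: "unique_infinite_cluster V E p_c" using asm q by auto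
    obtain L where L: "exit_ratio p_c (config_event A) w \<longlonglongrightarrow> L"
      using conv[OF v c qm uniq w A] \<delta> unfolding convergent_def by auto
    have "?f w A \<longlonglongrightarrow> L" using L unfolding Suc_f[OF w, symmetric] by (rule LIMSEQ_imp_Suc)
    moreover have "((\<lambda>p. \<P>(\<omega> in bond_percolation E p. \<omega> \<in> A \<bar> infinite (open_cluster V E \<omega> w))) \<longlongrightarrow> L) (at_right p_c)"
      unfolding cond_prob_infinite
      by (rule exit_ratio_limits_agree[OF v w cylinder_config_event[OF A] q(1) \<delta> c qm uniq inf_cluster_prob_pos[OF v0 w, folded p_c] L])
    ultimately show "\<exists>L. (?f w A \<longlonglongrightarrow> L) \<and>
        ((\<lambda>p. \<P>(\<omega> in bond_percolation E p. \<omega> \<in> A \<bar> infinite (open_cluster V E \<omega> w))) \<longlongrightarrow> L) (at_right p_c)"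
      by blast
  next
    fix w A
    assume "unique_infinite_cluster V E p_c \<and> (\<exists>v\<in>V. \<exists>c>0. quasi_multiplicative V E v c p_c)"
      and w: "w \<in> V" and A: "cylinder_event E A"
    then have "convergent (exit_ratio p_c (config_event A) w)" using conv by blast
    then show "convergent (?f w A)"
      unfolding Suc_f[OF w, symmetric] using convergent_Suc_iff[of "?f w A"] by simp
  qed
qed

end
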